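(* Let $(W,S)$ be a Coxeter system with $W$ finite and longest element $w_0$. Let $S=S_x\amalg S_y$ be a partition with $S_x,S_y\neq\varnothing$ such that no generator in $S_x$ is conjugate in $W$ to a generator in $S_y$. For integers $a,b>0$ let $L_{a,b}$ be the weight function on $W$ with $L_{a,b}(s)=a$ for $s\in S_x$ and $L_{a,b}(t)=b$ for $t\in S_y$. Let $$\mathcal{E}=\{q\in\mathbb{Q}_{>0}\mid q=\pm i/j\text{ where } i,j\neq 0\text{ are integers with } -2l(w_0)<i,j<2l(w_0)\}=\{x_1,\ldots,x_n\}.$$ Let $L=L_{a,b}$ be any such weight function, where $a,b>0$. (1) If $b/a=x_k$ for some $1\leq k\leq n$, then $L_{a,b}$ is equivalent to $L_{c,d}$, where $0<c,d<2l(w_0)$ are integers such that $b/a=d/c$. (2) If $b/a\notin\mathcal{E}$, then there exist integers $1\leq a',b'\leq 8\,l(w_0)^3$ such that $L_{a,b}$ is equivalent to $L_{a',b'}$.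
   Context: $(W,S)$ is a Coxeter system with length function $l$ and Bruhat--Chevalley order $\leq$. A weight function is a map $L\colon W\to\mathbb{Z}$ with $L(ww')=L(w)+L(w')$ whenever $l(ww')=l(w)+l(w')$. **General setting.** A total order on a (multiplicative) abelian group $\Gamma$ is specified by a multiplicatively closed subset $\Gamma_+\subseteq\Gamma\setminus\{1\}$ with $\Gamma=\Gamma_+\amalg\{1\}\amalg\Gamma_-$, $\Gamma_-=\{g^{-1}\mid g\in\Gamma_+\}$. Given parameters $v_s\in\Gamma_+$ ($s\in S$) with $v_s=v_t$ whenever $s,t\in S$ are conjugate, $\mathbf{H}$ is the $\mathbb{Z}[\Gamma]$-algebra with basis $\{\mathbf{T}_w\mid w\in W\}$ and, for $s\in S$, $\mathbf{T}_s\mathbf{T}_w=\mathbf{T}_{sw}$ if $l(sw)>l(w)$, $\mathbf{T}_s\mathbf{T}_w=\mathbf{T}_{sw}+(v_s-v_s^{-1})\mathbf{T}_w$ if $l(sw)<l(w)$. Let $h\mapsto\overline{h}$ be the ring involution of $\mathbf{H}$ with $\overline{g}=g^{-1}$ ($g\in\Gamma$) and $\overline{\mathbf{T}_w}=\mathbf{T}_{w^{-1}}^{-1}$. For each $w\in W$ there is a unique $\mathbf{C}_w\in\mathbf{H}$ with $\overline{\mathbf{C}_w}=\mathbf{C}_w$ and $\mathbf{C}_w=\mathbf{T}_w+\sum_{z<w}\mathbf{P}^*_{z,w}\mathbf{T}_z$, where $\mathbf{P}^*_{z,w}\in\mathbb{Z}[\Gamma_-]$ (the $\mathbb{Z}$-span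 of $\Gamma_-$). For $s\in S$ with $sw>w$, $$\mathbf{T}_s\mathbf{C}_w=\mathbf{C}_{sw}-v_s^{-1}\mathbf{C}_w+\sum_{z<w,\;sz<z}\mathbf{M}^s_{z,w}\mathbf{C}_z,$$ which defines $\mathbf{M}^s_{z,w}\in\mathbb{Z}[\Gamma]$ for $sz<z<w<sw$. **The set $\Gamma_+(W)$.** Let $\Gamma_+^{(a)}(W)$ be the set of all $\gamma\in\Gamma_+$ such that $\gamma^{-1}$ occurs with non-zero coefficient in $\mathbf{P}^*_{z,w}$ for some $z<w$. For $z,w,s$ with $sz<z<w<sw$ and $\mathbf{M}^s_{z,w}\neq0$, write $\mathbf{M}^s_{z,w}=n_1\gamma_1+\cdots+n_r\gamma_r$ with $0\neq n_i\in\mathbb{Z}$, $\gamma_i\in\Gamma$ and $\gamma_{i-1}^{-1}\gamma_i\in\Gamma_+$ for $2\leq i\leq r$; $\Gamma_+^{(b)}(W)$ is the set of all elements $\gamma_{i-1}^{-1}\gamma_i$ arising in this way. $\Gamma_+(W)=\Gamma_+^{(a)}(W)\cup\Gamma_+^{(b)}(W)$. **Equivalence of weight functions.** Given an abelian group $\Gamma$, a total order on $\Gamma$ specified by $\Gamma_+\subset\Gamma$, and parameters $\{v_s\mid s\in S\}\subset\Gamma_+$ with $v_s=v_t$ whenever $s,t\in S$ are conjugate in $W$, weight functions $L,L'$ (positive on $S$) are $\Gamma_+$-equivalent if there are ring homomorphisms $\sigma,\sigma'\colon\mathbb{Z}[\Gamma]\to\mathbb{Z}[v,v^{-1}]$ ($v$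 an indeterminate) with $\sigma(v_s)=v^{L(s)}$, $\sigma'(v_s)=v^{L'(s)}$ for all $s\in S$, $\sigma(\Gamma_+(W))\subseteq\{v^n\mid n>0\}$ and $\sigma'(\Gamma_+(W))\subseteq\{v^n\mid n>0\}$. $L,L'$ are equivalent if $L=L'$ or there is a sequence $L=L_0,L_1,\ldots,L_n=L'$ of weight functions and totally ordered abelian groups $(\Gamma_i)_+\subset\Gamma_i$ (with parameters in $(\Gamma_i)_+$) such that $L_{i-1},L_i$ are $(\Gamma_i)_+$-equivalent for $1\leq i\leq n$. *)

theory Defs
  imports "HOL-Algebra.Elementary_Groups" "HOL-Algebra.Multiplicative_Group"
    "HOL-Algebra.Module" "HOL-Library.Poly_Mapping"
begin

section \<open>Coxeter systems\<close>

definition word_eval :: "'w monoid \<Rightarrow> 'w list \<Rightarrow> 'w" where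
  "word_eval W xs = foldr (\<lambda>s w. s \<otimes>\<^bsub>W\<^esub> w) xs \<one>\<^bsub>W\<^esub>"

text \<open>Deletion of a defining relator \<open>(st)\<^sup>m\<close>, with \<open>m\<close> the order of \<open>st\<close>, from a word.
  For \<open>s = t\<close> this is deletion of \<open>ss\<close>. If \<open>st\<close> has infinite order then \<open>ord\<close> is \<open>0\<close> and
  the relator is the empty word.\<close>

inductive coxeter_step :: "'w monoid \<Rightarrow> 'w set \<Rightarrow> 'w list \<Rightarrow> 'w list \<Rightarrow> bool"
  for W S where
  "s \<in> S \<Longrightarrow> t \<in> S \<Longrightarrow>
   coxeter_step W S
     (xs @ concat (replicate (group.ord W (s \<otimes>\<^bsub>W\<^esub> t)) [s, t]) @ ys) (xs @ ys)"

text \<open>\<open>W\<close> is presented by the generating set \<open>S\<close> of involutions subject to the relators above.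
  As \<open>ss\<close> is among the relators, the presentation can be read in the free monoid on \<open>S\<close>.\<close>

definition coxeter_system :: "'w monoid \<Rightarrow> 'w set \<Rightarrow> bool" where
  "coxeter_system W S \<longleftrightarrow>
     group W \<and> S \<subseteq> carrier W \<and> generate W S = carrier W \<and>
     (\<forall>s\<in>S. s \<noteq> \<one>\<^bsub>W\<^esub> \<and> s \<otimes>\<^bsub>W\<^esub> s = \<one>\<^bsub>W\<^esub>) \<and>
     (\<forall>xs. set xs \<subseteq> S \<longrightarrow> word_eval W xs = \<one>\<^bsub>W\<^esub> \<longrightarrow> equivclp (coxeter_step W S) xs [])"

definition cox_length :: "'w monoid \<Rightarrow> 'w set \<Rightarrow> 'w \<Rightarrow> nat" where
  "cox_length W S w = (LEAST n. \<exists>xs. set xs \<subseteq> S \<and> length xs = n \<and> word_eval W xs = w)"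

definition longest_element :: "'w monoid \<Rightarrow> 'w set \<Rightarrow> 'w \<Rightarrow> bool" where
  "longest_element W S w0 \<longleftrightarrow>
     w0 \<in> carrier W \<and> (\<forall>w\<in>carrier W. cox_length W S w \<le> cox_length W S w0)"

definition conjugate_in :: "'w monoid \<Rightarrow> 'w \<Rightarrow> 'w \<Rightarrow> bool" where
  "conjugate_in W s t \<longleftrightarrow> (\<exists>w\<in>carrier W. t = w \<otimes>\<^bsub>W\<^esub> s \<otimes>\<^bsub>W\<^esub> inv\<^bsub>W\<^esub> w)"

definition reflections :: "'w monoid \<Rightarrow> 'w set \<Rightarrow> 'w set" where
  "reflections W S = {t. \<exists>s\<in>S. conjugate_in W s t}"

text \<open>The strict Bruhat--Chevalley order.\<close>

definition bruhat_less :: "'w monoid \<Rightarrow> 'w set \<Rightarrow> 'w \<Rightarrow> 'w \<Rightarrow> bool" where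
  "bruhat_less W S =
     (\<lambda>y w. y \<in> carrier W \<and> cox_length W S y < cox_length W S w \<and>
            (\<exists>t\<in>reflections W S. w = y \<otimes>\<^bsub>W\<^esub> t))\<^sup>+\<^sup>+"

text \<open>Weight functions are functions on \<open>carrier W\<close>; extensionality makes HOL equality the
  equality of such functions.\<close>

definition weight_function :: "'w monoid \<Rightarrow> 'w set \<Rightarrow> ('w \<Rightarrow> int) \<Rightarrow> bool" where
  "weight_function W S L \<longleftrightarrow>
     L \<in> extensional (carrier W) \<and>
     (\<forall>w\<in>carrier W. \<forall>w'\<in>carrier W.
        cox_length W S (w \<otimes>\<^bsub>W\<^esub> w') = cox_length W S w + cox_length W S w' \<longrightarrow>
        L (w \<otimes>\<^bsub>W\<^esub> w') = L w + L w')"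

definition weight_ab :: "'w monoid \<Rightarrow> 'w set \<Rightarrow> 'w set \<Rightarrow> int \<Rightarrow> int \<Rightarrow> 'w \<Rightarrow> int" where
  "weight_ab W Sx Sy a b =
     (THE L. weight_function W (Sx \<union> Sy) L \<and> (\<forall>s\<in>Sx. L s = a) \<and> (\<forall>t\<in>Sy. L t = b))"


section \<open>Totally ordered abelian groups and group rings\<close>

definition total_order_on_group :: "'g monoid \<Rightarrow> 'g set \<Rightarrow> bool" where
  "total_order_on_group G Gp \<longleftrightarrow>
     comm_group G \<and> Gp \<subseteq> carrier G - {\<one>\<^bsub>G\<^esub>} \<and>
     (\<forall>g\<in>Gp. \<forall>h\<in>Gp. g \<otimes>\<^bsub>G\<^esub> h \<in> Gp) \<and>
     carrier G = Gp \<union> {\<one>\<^bsub>G\<^esub>} \<union> m_inv G ` Gp \<and>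
     Gp \<inter> m_inv G ` Gp = {} \<and> \<one>\<^bsub>G\<^esub> \<notin> m_inv G ` Gp"

definition parameters :: "'w monoid \<Rightarrow> 'w set \<Rightarrow> 'g set \<Rightarrow> ('w \<Rightarrow> 'g) \<Rightarrow> bool" where
  "parameters W S Gp v \<longleftrightarrow>
     (\<forall>s\<in>S. v s \<in> Gp) \<and> (\<forall>s\<in>S. \<forall>t\<in>S. conjugate_in W s t \<longrightarrow> v s = v t)"

text \<open>The integral group ring; its elements are the finitely supported functions on \<open>carrier G\<close>.\<close>

definition group_ring :: "'g monoid \<Rightarrow> ('g \<Rightarrow>\<^sub>0 int) ring" where
  "group_ring G =
     \<lparr>carrier = {f. Poly_Mapping.keys f \<subseteq> carrier G},
      monoid.mult = (\<lambda>f g. \<Sum>a\<in>Poly_Mapping.keys f. \<Sum>b\<in>Poly_Mapping.keys g.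
        Poly_Mapping.single (a \<otimes>\<^bsub>G\<^esub> b) (Poly_Mapping.lookup f a * Poly_Mapping.lookup g b)),
      one = Poly_Mapping.single \<one>\<^bsub>G\<^esub> 1,
      ring.zero = 0,
      add = (+)\<rparr>"

text \<open>The Laurent polynomial ring in one indeterminate \<open>v\<close> is the group ring of the infinite
  cyclic group.\<close>

definition laurent_ring :: "(int \<Rightarrow>\<^sub>0 int) ring" where
  "laurent_ring = group_ring integer_group"

definition v_pow :: "int \<Rightarrow> (int \<Rightarrow>\<^sub>0 int)" where
  "v_pow n = Poly_Mapping.single n 1"

definition group_ring_bar :: "'g monoid \<Rightarrow> ('g \<Rightarrow>\<^sub>0 int) \<Rightarrow> ('g \<Rightarrow>\<^sub>0 int)" where
  "group_ring_bar G f =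
     (\<Sum>a\<in>Poly_Mapping.keys f. Poly_Mapping.single (inv\<^bsub>G\<^esub> a) (Poly_Mapping.lookup f a))"

definition neg_span :: "'g monoid \<Rightarrow> 'g set \<Rightarrow> ('g \<Rightarrow>\<^sub>0 int) set" where
  "neg_span G Gp = {f. Poly_Mapping.keys f \<subseteq> m_inv G ` Gp}"


section \<open>The generic Hecke algebra\<close>

text \<open>Elements are finitely supported functions on \<open>carrier W\<close> with values in the group ring;
  \<open>Poly_Mapping.single w c\<close> stands for \<open>c T\<^sub>w\<close>.\<close>

definition hecke_smult ::
  "'g monoid \<Rightarrow> ('g \<Rightarrow>\<^sub>0 int) \<Rightarrow> ('w \<Rightarrow>\<^sub>0 'g \<Rightarrow>\<^sub>0 int) \<Rightarrow> ('w \<Rightarrow>\<^sub>0 'g \<Rightarrow>\<^sub>0 int)" where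
  "hecke_smult G c h =
     (\<Sum>w\<in>Poly_Mapping.keys h. Poly_Mapping.single w (c \<otimes>\<^bsub>group_ring G\<^esub> Poly_Mapping.lookup h w))"

definition hecke_T :: "'g monoid \<Rightarrow> 'w \<Rightarrow> ('w \<Rightarrow>\<^sub>0 'g \<Rightarrow>\<^sub>0 int)" where
  "hecke_T G w = Poly_Mapping.single w \<one>\<^bsub>group_ring G\<^esub>"

text \<open>The right-hand side of the defining relation for \<open>T\<^sub>s T\<^sub>w\<close>.\<close>

definition hecke_gen_T ::
  "'w monoid \<Rightarrow> 'w set \<Rightarrow> 'g monoid \<Rightarrow> ('w \<Rightarrow> 'g) \<Rightarrow> 'w \<Rightarrow> 'w \<Rightarrow> ('w \<Rightarrow>\<^sub>0 'g \<Rightarrow>\<^sub>0 int)" where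
  "hecke_gen_T W S G v s w =
     (if cox_length W S w < cox_length W S (s \<otimes>\<^bsub>W\<^esub> w)
      then hecke_T G (s \<otimes>\<^bsub>W\<^esub> w)
      else hecke_T G (s \<otimes>\<^bsub>W\<^esub> w) +
        Poly_Mapping.single w
          (Poly_Mapping.single (v s) 1 - Poly_Mapping.single (inv\<^bsub>G\<^esub> (v s)) 1))"

definition hecke_gen_mult ::
  "'w monoid \<Rightarrow> 'w set \<Rightarrow> 'g monoid \<Rightarrow> ('w \<Rightarrow> 'g) \<Rightarrow> 'w \<Rightarrow>
   ('w \<Rightarrow>\<^sub>0 'g \<Rightarrow>\<^sub>0 int) \<Rightarrow> ('w \<Rightarrow>\<^sub>0 'g \<Rightarrow>\<^sub>0 int)" where
  "hecke_gen_mult W S G v s h =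
     (\<Sum>w\<in>Poly_Mapping.keys h. hecke_smult G (Poly_Mapping.lookup h w) (hecke_gen_T W S G v s w))"

definition reduced_word :: "'w monoid \<Rightarrow> 'w set \<Rightarrow> 'w \<Rightarrow> 'w list" where
  "reduced_word W S w =
     (SOME xs. set xs \<subseteq> S \<and> length xs = cox_length W S w \<and> word_eval W xs = w)"

text \<open>As \<open>T\<^sub>w\<close> is the product of the \<open>T\<^sub>s\<close> along any reduced word of \<open>w\<close>, the product of the
  algebra is determined by the left multiplications by the \<open>T\<^sub>s\<close>. The choice of reduced words is
  immaterial, and the resulting algebra is the unique one with the required relations.\<close>

definition hecke_algebra ::
  "'w monoid \<Rightarrow> 'w set \<Rightarrow> 'g monoid \<Rightarrow> ('w \<Rightarrow> 'g) \<Rightarrow> ('g \<Rightarrow>\<^sub>0 int, 'w \<Rightarrow>\<^sub>0 'g \<Rightarrow>\<^sub>0 int) module" where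
  "hecke_algebra W S G v =
     \<lparr>carrier = {h. Poly_Mapping.keys h \<subseteq> carrier W \<and>
                    (\<forall>w. Poly_Mapping.lookup h w \<in> carrier (group_ring G))},
      monoid.mult = (\<lambda>h k. \<Sum>w\<in>Poly_Mapping.keys h.
        hecke_smult G (Poly_Mapping.lookup h w)
          (foldr (hecke_gen_mult W S G v) (reduced_word W S w) k)),
      one = hecke_T G \<one>\<^bsub>W\<^esub>,
      ring.zero = 0,
      add = (+),
      smult = hecke_smult G\<rparr>"

definition hecke_bar ::
  "'w monoid \<Rightarrow> 'w set \<Rightarrow> 'g monoid \<Rightarrow> ('w \<Rightarrow> 'g) \<Rightarrow>
   ('w \<Rightarrow>\<^sub>0 'g \<Rightarrow>\<^sub>0 int) \<Rightarrow> ('w \<Rightarrow>\<^sub>0 'g \<Rightarrow>\<^sub>0 int)" where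
  "hecke_bar W S G v h =
     (\<Sum>w\<in>Poly_Mapping.keys h.
        hecke_smult G (group_ring_bar G (Poly_Mapping.lookup h w))
          (inv\<^bsub>hecke_algebra W S G v\<^esub> (hecke_T G (inv\<^bsub>W\<^esub> w))))"


section \<open>The Kazhdan--Lusztig basis and the set of positive elements attached to it\<close>

definition kl_C ::
  "'w monoid \<Rightarrow> 'w set \<Rightarrow> 'g monoid \<Rightarrow> 'g set \<Rightarrow> ('w \<Rightarrow> 'g) \<Rightarrow> 'w \<Rightarrow> ('w \<Rightarrow>\<^sub>0 'g \<Rightarrow>\<^sub>0 int)" where
  "kl_C W S G Gp v w =
     (THE c. c \<in> carrier (hecke_algebra W S G v) \<and> hecke_bar W S G v c = c \<and>
        (\<exists>p. (\<forall>z. p z \<in> neg_span G Gp) \<and>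
           c = hecke_T G w + (\<Sum>z | bruhat_less W S z w. Poly_Mapping.single z (p z))))"

definition kl_P ::
  "'w monoid \<Rightarrow> 'w set \<Rightarrow> 'g monoid \<Rightarrow> 'g set \<Rightarrow> ('w \<Rightarrow> 'g) \<Rightarrow> 'w \<Rightarrow> 'w \<Rightarrow> ('g \<Rightarrow>\<^sub>0 int)" where
  "kl_P W S G Gp v z w = Poly_Mapping.lookup (kl_C W S G Gp v w) z"

text \<open>The triples \<open>s, z, w\<close> with \<open>sz < z < w < sw\<close> for which \<open>M\<^sup>s\<^sub>z\<^sub>,\<^sub>w\<close> is defined.\<close>

definition M_triple :: "'w monoid \<Rightarrow> 'w set \<Rightarrow> 'w \<Rightarrow> 'w \<Rightarrow> 'w \<Rightarrow> bool" where
  "M_triple W S s z w \<longleftrightarrow>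
     s \<in> S \<and> bruhat_less W S (s \<otimes>\<^bsub>W\<^esub> z) z \<and> bruhat_less W S z w \<and>
     bruhat_less W S w (s \<otimes>\<^bsub>W\<^esub> w)"

text \<open>The family \<open>z \<mapsto> M\<^sup>s\<^sub>z\<^sub>,\<^sub>w\<close>, extended by zero, for fixed \<open>s\<close> and \<open>w\<close> with \<open>sw > w\<close>.\<close>

definition kl_M ::
  "'w monoid \<Rightarrow> 'w set \<Rightarrow> 'g monoid \<Rightarrow> 'g set \<Rightarrow> ('w \<Rightarrow> 'g) \<Rightarrow> 'w \<Rightarrow> 'w \<Rightarrow> 'w \<Rightarrow> ('g \<Rightarrow>\<^sub>0 int)" where
  "kl_M W S G Gp v s w =
     (THE m. (\<forall>z. m z \<in> carrier (group_ring G)) \<and> (\<forall>z. \<not> M_triple W S s z w \<longrightarrow> m z = 0) \<and>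
        hecke_T G s \<otimes>\<^bsub>hecke_algebra W S G v\<^esub> kl_C W S G Gp v w =
          kl_C W S G Gp v (s \<otimes>\<^bsub>W\<^esub> w)
          - hecke_smult G (Poly_Mapping.single (inv\<^bsub>G\<^esub> (v s)) 1) (kl_C W S G Gp v w)
          + (\<Sum>z | M_triple W S s z w. hecke_smult G (m z) (kl_C W S G Gp v z)))"

definition Gamma_plus_a ::
  "'w monoid \<Rightarrow> 'w set \<Rightarrow> 'g monoid \<Rightarrow> 'g set \<Rightarrow> ('w \<Rightarrow> 'g) \<Rightarrow> 'g set" where
  "Gamma_plus_a W S G Gp v =
     {\<gamma>\<in>Gp. \<exists>z w. bruhat_less W S z w \<and>
        Poly_Mapping.lookup (kl_P W S G Gp v z w) (inv\<^bsub>G\<^esub> \<gamma>) \<noteq> 0}"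

definition Gamma_plus_b ::
  "'w monoid \<Rightarrow> 'w set \<Rightarrow> 'g monoid \<Rightarrow> 'g set \<Rightarrow> ('w \<Rightarrow> 'g) \<Rightarrow> 'g set" where
  "Gamma_plus_b W S G Gp v =
     {\<delta>. \<exists>s z w r n \<gamma>. M_triple W S s z w \<and> kl_M W S G Gp v s w z \<noteq> 0 \<and>
        kl_M W S G Gp v s w z = (\<Sum>i=1..(r::nat). Poly_Mapping.single (\<gamma> i) (n i)) \<and>
        (\<forall>i\<in>{1..r}. n i \<noteq> 0 \<and> \<gamma> i \<in> carrier G) \<and>
        (\<forall>i\<in>{2..r}. inv\<^bsub>G\<^esub> (\<gamma> (i - 1)) \<otimes>\<^bsub>G\<^esub> \<gamma> i \<in> Gp) \<and>
        (\<exists>i\<in>{2..r}. \<delta> = inv\<^bsub>G\<^esub> (\<gamma> (i - 1)) \<otimes>\<^bsub>G\<^esub> \<gamma> i)}"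

definition Gamma_plus_W ::
  "'w monoid \<Rightarrow> 'w set \<Rightarrow> 'g monoid \<Rightarrow> 'g set \<Rightarrow> ('w \<Rightarrow> 'g) \<Rightarrow> 'g set" where
  "Gamma_plus_W W S G Gp v = Gamma_plus_a W S G Gp v \<union> Gamma_plus_b W S G Gp v"


section \<open>Equivalence of weight functions\<close>

definition specializes_to ::
  "'w monoid \<Rightarrow> 'w set \<Rightarrow> 'g monoid \<Rightarrow> 'g set \<Rightarrow> ('w \<Rightarrow> 'g) \<Rightarrow> ('w \<Rightarrow> int) \<Rightarrow> bool" where
  "specializes_to W S G Gp v L \<longleftrightarrow>
     (\<exists>\<sigma> \<in> ring_hom (group_ring G) laurent_ring.
        (\<forall>s\<in>S. \<sigma> (Poly_Mapping.single (v s) 1) = v_pow (L s)) \<and>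
        (\<forall>\<gamma>\<in>Gamma_plus_W W S G Gp v. \<exists>n>0. \<sigma> (Poly_Mapping.single \<gamma> 1) = v_pow n))"

definition Gamma_equivalent ::
  "'w monoid \<Rightarrow> 'w set \<Rightarrow> 'g monoid \<Rightarrow> 'g set \<Rightarrow> ('w \<Rightarrow> 'g) \<Rightarrow> ('w \<Rightarrow> int) \<Rightarrow> ('w \<Rightarrow> int) \<Rightarrow> bool" where
  "Gamma_equivalent W S G Gp v L L' \<longleftrightarrow>
     total_order_on_group G Gp \<and> parameters W S Gp v \<and>
     weight_function W S L \<and> (\<forall>s\<in>S. L s > 0) \<and>
     weight_function W S L' \<and> (\<forall>s\<in>S. L' s > 0) \<and>
     specializes_to W S G Gp v L \<and> specializes_to W S G Gp v L'"

text \<open>HOL cannot quantify over all abelian groups inside a formula, so the groups in the chain have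
  their carriers inside the type below. For finite \<open>S\<close> nothing is lost: all data depend only on the
  subgroup generated by the finitely many \<open>v\<^sub>s\<close>, which is countable and hence
  isomorphic to a group carried by a subset of the (uncountable) type.\<close>

type_synonym universe = "nat \<Rightarrow> int"

definition equivalent_weights ::
  "'w monoid \<Rightarrow> 'w set \<Rightarrow> ('w \<Rightarrow> int) \<Rightarrow> ('w \<Rightarrow> int) \<Rightarrow> bool" where
  "equivalent_weights W S L L' \<longleftrightarrow>
     L = L' \<or>
     (\<exists>(n::nat) \<Lambda> (G :: nat \<Rightarrow> universe monoid) Gp v.
        \<Lambda> 0 = L \<and> \<Lambda> n = L' \<and>
        (\<forall>i\<in>{1..n}. Gamma_equivalent W S (G i) (Gp i) (v i) (\<Lambda> (i - 1)) (\<Lambda> i)))"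


definition ratio_set :: "nat \<Rightarrow> rat set" where
  "ratio_set N =
     {q. q > 0 \<and> (\<exists>i j :: int. i \<noteq> 0 \<and> j \<noteq> 0 \<and>
           - 2 * int N < i \<and> i < 2 * int N \<and> - 2 * int N < j \<and> j < 2 * int N \<and>
           (q = of_int i / of_int j \<or> q = - (of_int i / of_int j)))}"

end

theory Submission
  imports Defs "HOL-Library.Function_Algebras"
begin

text \<open>If \<open>b/a = d/c\<close>, both weight functions are specializations of the rank one group generated by
  a primitive pair of weights, where every positive element stays positive. Otherwise let
  \<open>x\<close>, \<open>y\<close> be the two parameters, ordered by \<open>x\<^sup>iy\<^sup>j > 1\<close> if \<open>ai + bj > 0\<close>. Running the recursion
  for the Kazhdan--Lusztig basis shows that the exponents of \<open>x\<close> in \<open>P\<^sub>z\<^sub>,\<^sub>w\<close> and \<open>M\<^sup>s\<^sub>z\<^sub>,\<^sub>w\<close> are bounded by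
  \<open>l\<^sub>x(w) - l\<^sub>x(z)\<close> and \<open>l\<^sub>x(sw) - l\<^sub>x(z)\<close>, where \<open>l\<^sub>x\<close> counts the letters from \<open>S\<^sub>x\<close>; similarly for \<open>y\<close>.
  Hence all elements of \<open>\<Gamma>\<^sub>+(W)\<close> have exponents smaller than \<open>2l(w\<^sub>0)\<close> in absolute value, and \<open>(a, b)\<close>
  can be replaced by the mediant of the two elements of \<open>\<E>\<close> next to \<open>b/a\<close>.\<close>

section \<open>Coxeter groups\<close>

text \<open>Comparing monomials by the weight \<open>ai + bj\<close> leaves ties, while
  \<open>\<Gamma>\<close> has to be totally ordered; ties are broken lexicographically. A
  specialization must send every element of \<open>\<Gamma>\<^sub>+(W)\<close> to a strictly
  positive power, so a tied element in that set would ruin it. A tie \<open>ai + bj = 0\<close> with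
  \<open>i\<close>, \<open>j\<close> nonzero forces \<open>b/a = -i/j\<close>, and \<E> is made so
  that outside it no tie with exponents below \<open>2l(w\<^sub>0)\<close> occurs. The factor 2
  comes from the second part of \<open>\<Gamma>\<^sub>+(W)\<close>, whose elements are quotients of
  two monomials of one \<open>M\<^sup>s\<^sub>z\<^sub>,\<^sub>w\<close>; the inequality is strict
  because the letter \<open>s\<close> either counts in \<open>z\<close> or does not count in
  \<open>sw\<close>. The mediant has entries at most \<open>4l(w\<^sub>0)\<close>, within the cubic
  bound. The obstacle lies earlier: the product, the bar involution and the families
  \<open>C\<close> and \<open>M\<close> are given by choice or by unique existence, and each
  description must be shown to single out an object before degrees can be estimated.\<close>

text \<open>Parity of the number of indices \<open>i\<close> with \<open>t = s\<^sub>1 \<dots> s\<^sub>i \<dots> s\<^sub>1\<close>; it depends only on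
  the element represented by the word, whose left inversions are the \<open>t\<close> of odd parity.\<close>

primrec word_parity :: "'w monoid \<Rightarrow> 'w list \<Rightarrow> 'w \<Rightarrow> bool" where
  "word_parity W [] t = False"
| "word_parity W (s # xs) t = ((t = s) \<noteq> word_parity W xs (s \<otimes>\<^bsub>W\<^esub> t \<otimes>\<^bsub>W\<^esub> s))"

locale coxeter = group W for W :: "'w monoid" (structure) +
  fixes S :: "'w set"
  assumes system: "coxeter_system W S"
    and finite_carrier: "finite (carrier W)"
begin

abbreviation len :: "'w \<Rightarrow> nat" where "len \<equiv> cox_length W S"
abbreviation eval :: "'w list \<Rightarrow> 'w" where "eval \<equiv> word_eval W"
abbreviation par :: "'w list \<Rightarrow> 'w \<Rightarrow> bool" where "par \<equiv> word_parity W"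
abbreviation refl :: "'w set" where "refl \<equiv> reflections W S"

lemma S_carrier [simp, intro]: "s \<in> S \<Longrightarrow> s \<in> carrier W"
  using system by (auto simp: coxeter_system_def)

lemma S_square [simp]: "s \<in> S \<Longrightarrow> s \<otimes> s = \<one>"
  using system by (auto simp: coxeter_system_def)

lemma S_not_one: "s \<in> S \<Longrightarrow> s \<noteq> \<one>"
  using system by (auto simp: coxeter_system_def)

lemma S_inv [simp]: "s \<in> S \<Longrightarrow> inv s = s"
  by (simp add: inv_equality)

lemma S_cancel [simp]: "s \<in> S \<Longrightarrow> x \<in> carrier W \<Longrightarrow> s \<otimes> (s \<otimes> x) = x"
  by (simp flip: m_assoc)

lemma S_cancel_right [simp]: "s \<in> S \<Longrightarrow> x \<in> carrier W \<Longrightarrow> x \<otimes> s \<otimes> s = x"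
  by (simp add: m_assoc)

lemma inv_cancel [simp]:
  "x \<in> carrier W \<Longrightarrow> y \<in> carrier W \<Longrightarrow> x \<otimes> (inv x \<otimes> y) = y"
  "x \<in> carrier W \<Longrightarrow> y \<in> carrier W \<Longrightarrow> inv x \<otimes> (x \<otimes> y) = y"
  by (simp_all flip: m_assoc)

lemma conj_eq_iff:
  "x \<in> carrier W \<Longrightarrow> s \<in> carrier W \<Longrightarrow> t \<in> carrier W \<Longrightarrow> x \<otimes> s \<otimes> inv x = t \<longleftrightarrow> s = inv x \<otimes> t \<otimes> x"
  by (metis inv_closed inv_solve_left' inv_solve_right m_assoc m_closed)

lemma S_conj_eq_iff:
  "s \<in> S \<Longrightarrow> r \<in> carrier W \<Longrightarrow> t \<in> carrier W \<Longrightarrow> s \<otimes> r \<otimes> s = t \<longleftrightarrow> r = s \<otimes> t \<otimes> s"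
  using conj_eq_iff[of s r t] by simp

subsection \<open>Words\<close>

lemma eval_simps [simp]: "eval [] = \<one>" "eval (s # xs) = s \<otimes> eval xs"
  by (simp_all add: word_eval_def)

lemma eval_closed [simp, intro]: "set xs \<subseteq> S \<Longrightarrow> eval xs \<in> carrier W"
  by (induction xs) auto

lemma eval_append [simp]:
  "set xs \<subseteq> S \<Longrightarrow> set ys \<subseteq> S \<Longrightarrow> eval (xs @ ys) = eval xs \<otimes> eval ys"
  by (induction xs) (auto simp: m_assoc)

lemma eval_rev: "set xs \<subseteq> S \<Longrightarrow> eval (rev xs) = inv (eval xs)"
  by (induction xs) (auto simp: inv_mult_group)

lemma ex_word:
  assumes "w \<in> carrier W"
  shows "\<exists>xs. set xs \<subseteq> S \<and> eval xs = w"
proof -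
  have "w \<in> generate W S"
    using assms system by (simp add: coxeter_system_def)
  thus ?thesis
  proof induction
    case one
    show ?case by (intro exI[of _ "[]"]) auto
  next
    case (incl h)
    thus ?case by (intro exI[of _ "[h]"]) auto
  next
    case (inv h)
    thus ?case by (intro exI[of _ "[h]"]) auto
  next
    case (eng h1 h2)
    then obtain xs ys where "set xs \<subseteq> S" "eval xs = h1" "set ys \<subseteq> S" "eval ys = h2"
      by blast
    thus ?case by (intro exI[of _ "xs @ ys"]) auto
  qed
qed

lemma len_le: "set xs \<subseteq> S \<Longrightarrow> len (eval xs) \<le> length xs"
  unfolding cox_length_def by (rule Least_le) blast

lemma ex_reduced:
  assumes "w \<in> carrier W"
  shows "\<exists>xs. set xs \<subseteq> S \<and> length xs = len w \<and> eval xs = w"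
proof -
  obtain xs where "set xs \<subseteq> S" "eval xs = w"
    using ex_word[OF assms] by blast
  hence "\<exists>n. \<exists>xs. set xs \<subseteq> S \<and> length xs = n \<and> eval xs = w"
    by blast
  from LeastI_ex[OF this] show ?thesis
    unfolding cox_length_def .
qed

lemma reduced_word:
  assumes "w \<in> carrier W"
  shows "set (reduced_word W S w) \<subseteq> S" "length (reduced_word W S w) = len w"
    "eval (reduced_word W S w) = w"
  using someI_ex[OF ex_reduced[OF assms]] unfolding reduced_word_def by blast+

lemma len_one [simp]: "len \<one> = 0"
  using len_le[of "[]"] by simp

lemma len_eq_0_iff: "w \<in> carrier W \<Longrightarrow> len w = 0 \<longleftrightarrow> w = \<one>"
  using ex_reduced[of w] by auto

lemma len_inv [simp]:
  assumes "w \<in> carrier W"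
  shows "len (inv w) = len w"
proof -
  have le: "len (inv u) \<le> len u" if u: "u \<in> carrier W" for u
  proof -
    obtain xs where "set xs \<subseteq> S" "length xs = len u" "eval xs = u"
      using ex_reduced[OF u] by blast
    thus ?thesis using len_le[of "rev xs"] by (simp add: eval_rev)
  qed
  show ?thesis using le[OF assms] le[of "inv w"] assms by simp
qed

lemma len_mult_le:
  assumes "x \<in> carrier W" "y \<in> carrier W"
  shows "len (x \<otimes> y) \<le> len x + len y"
proof -
  obtain xs ys where "set xs \<subseteq> S" "length xs = len x" "eval xs = x"
    "set ys \<subseteq> S" "length ys = len y" "eval ys = y"
    using ex_reduced assms by metis
  thus ?thesis using len_le[of "xs @ ys"] by simp
qed

lemma len_S [simp]: "s \<in> S \<Longrightarrow> len s = 1"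
  using len_le[of "[s]"] len_eq_0_iff[of s] S_not_one[of s] by force

subsection \<open>The reflection cocycle\<close>

text \<open>Putting \<open>xs\<close> in front conjugates the reflections attached to the letters of
  \<open>ys\<close> by \<open>eval xs\<close>. This cocycle identity is behind all later statements
  about inversions.\<close>

lemma par_append:
  "set xs \<subseteq> S \<Longrightarrow> set ys \<subseteq> S \<Longrightarrow> t \<in> carrier W \<Longrightarrow>
    par (xs @ ys) t = (par xs t \<noteq> par ys (inv (eval xs) \<otimes> t \<otimes> eval xs))"
  by (induction xs arbitrary: t) (auto simp: inv_mult_group m_assoc)

text \<open>The reflections attached to the word \<open>stst...\<close> of length \<open>2n\<close>
  are \<open>s\<close>, \<open>sts\<close>, \<open>ststs\<close> and so on, that is
  \<open>(st)^j s\<close>.\<close>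

lemma par_alternating:
  assumes "s \<in> S" "t \<in> S" "r \<in> carrier W"
  shows "par (concat (replicate n [s, t])) r \<longleftrightarrow>
    odd (\<Sum>j<2 * n. of_bool (r = (s \<otimes> t) [^] j \<otimes> s) :: nat)"
  using assms(3)
proof (induction n arbitrary: r)
  case 0
  show ?case by simp
next
  case (Suc n)
  define p where "p = s \<otimes> t"
  have p: "p \<in> carrier W" using assms by (simp add: p_def)
  have ip: "inv p = t \<otimes> s" using assms by (simp add: p_def inv_mult_group)
  have sp: "s \<otimes> p = inv p \<otimes> s"
    using assms unfolding ip by (simp add: p_def m_assoc)
  \<comment> \<open>The index moves by two because \<open>s\<close> conjugates \<open>p = st\<close>
    to its inverse.\<close>
  have shift: "(t \<otimes> (s \<otimes> r \<otimes> s) \<otimes> t = p [^] j \<otimes> s) \<longleftrightarrow> (r = p [^] Suc (Suc j) \<otimes> s)" for j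
  proof -
    have "t \<otimes> (s \<otimes> r \<otimes> s) \<otimes> t = inv p \<otimes> r \<otimes> inv (inv p)"
      using assms Suc.prems unfolding ip by (simp add: p_def m_assoc inv_mult_group)
    also have "\<dots> = p [^] j \<otimes> s \<longleftrightarrow> r = inv (inv p) \<otimes> (p [^] j \<otimes> s) \<otimes> inv p"
      using p assms Suc.prems by (subst conj_eq_iff) auto
    also have "inv (inv p) \<otimes> (p [^] j \<otimes> s) \<otimes> inv p = p \<otimes> p [^] j \<otimes> (s \<otimes> inv p)"
      using p assms by (simp add: m_assoc)
    also have "s \<otimes> inv p = p \<otimes> s"
      using assms unfolding ip by (simp add: p_def m_assoc)
    also have "p \<otimes> p [^] j \<otimes> (p \<otimes> s) = p [^] Suc (Suc j) \<otimes> s"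
      using p assms nat_pow_mult[OF p, of 1 j] by (simp add: m_assoc nat_pow_comm flip: nat_pow_Suc2)
    finally show ?thesis .
  qed
  have base: "(s \<otimes> r \<otimes> s = t) \<longleftrightarrow> (r = p \<otimes> s)"
    using assms Suc.prems by (metis S_inv conj_eq_iff p_def S_carrier)
  have "par (concat (replicate (Suc n) [s, t])) r \<longleftrightarrow>
      ((r = s) \<noteq> ((s \<otimes> r \<otimes> s = t) \<noteq>
         odd (\<Sum>j<2 * n. of_bool (t \<otimes> (s \<otimes> r \<otimes> s) \<otimes> t = p [^] j \<otimes> s) :: nat)))"
    using Suc.IH[of "t \<otimes> (s \<otimes> r \<otimes> s) \<otimes> t"] assms Suc.prems by (simp add: p_def)
  also have "\<dots> \<longleftrightarrow> odd (\<Sum>j<Suc (Suc (2 * n)). of_bool (r = p [^] j \<otimes> s) :: nat)"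
    unfolding shift base sum.lessThan_Suc_shift using p assms by simp
  finally show ?case by (simp add: p_def)
qed

text \<open>The elements \<open>(st)^j s\<close> are periodic in \<open>j\<close> with period
  \<open>m = ord (st)\<close>, so the \<open>2m\<close> letters of the relator hit each reflection
  an even number of times.\<close>

lemma par_relator:
  assumes "s \<in> S" "t \<in> S" "r \<in> carrier W"
  shows "\<not> par (concat (replicate (ord (s \<otimes> t)) [s, t])) r"
proof -
  define m where "m = ord (s \<otimes> t)"
  define f where "f j = (of_bool (r = (s \<otimes> t) [^] j \<otimes> s) :: nat)" for j :: nat
  have st: "s \<otimes> t \<in> carrier W" using assms by simp
  have "f (j + m) = f j" for j
    using pow_ord_eq_1[OF st] st by (simp add: f_def m_def flip: nat_pow_mult)
  hence "(\<Sum>j<m + m. f j) = (\<Sum>j<m. f j) + (\<Sum>j<m. f j)"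
    by (simp add: lessThan_atLeast0 sum.atLeastLessThan_concat [of 0 m "m + m", symmetric]
        sum.shift_bounds_nat_ivl [of f 0 m m, simplified])
  hence "even (\<Sum>j<2 * m. f j)" by (simp add: mult_2)
  thus ?thesis unfolding par_alternating[OF assms] m_def f_def by blast
qed

lemma eval_relator:
  assumes "s \<in> S" "t \<in> S"
  shows "eval (concat (replicate (ord (s \<otimes> t)) [s, t])) = \<one>"
proof -
  have "eval (concat (replicate n [s, t])) = (s \<otimes> t) [^] n" for n
  proof (induction n)
    case (Suc n)
    have "eval (concat (replicate (Suc n) [s, t])) = (s \<otimes> t) \<otimes> (s \<otimes> t) [^] n"
      using Suc assms by (simp add: m_assoc)
    also have "\<dots> = (s \<otimes> t) [^] Suc n"
      using assms by (metis nat_pow_Suc2 m_closed S_carrier)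
    finally show ?case .
  qed simp
  thus ?thesis using assms by simp
qed

lemma step_par:
  assumes "coxeter_step W S us vs"
  shows "(set us \<subseteq> S \<longleftrightarrow> set vs \<subseteq> S) \<and> (set us \<subseteq> S \<longrightarrow> (\<forall>t\<in>carrier W. par us t = par vs t))"
  using assms
proof cases
  case (1 s t xs ys)
  define rel where "rel = concat (replicate (ord (s \<otimes> t)) [s, t])"
  have rel: "set rel \<subseteq> S" "eval rel = \<one>" "\<And>r. r \<in> carrier W \<Longrightarrow> \<not> par rel r"
    using 1 by (auto simp: rel_def eval_relator par_relator)
  have us: "us = xs @ rel @ ys" and vs: "vs = xs @ ys"
    using 1 by (simp_all add: rel_def)
  show ?thesis
    unfolding us vs using rel by (auto simp: par_append)
qed

text \<open>This is where completeness of the relations enters: a trivial word is linked to the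
  empty one by inserting and deleting relators, and neither changes the parity.\<close>

lemma par_trivial:
  assumes "set xs \<subseteq> S" "eval xs = \<one>" "t \<in> carrier W"
  shows "\<not> par xs t"
proof -
  have "equivclp (coxeter_step W S) xs []"
    using system assms by (auto simp: coxeter_system_def)
  hence "set xs \<subseteq> S \<longrightarrow> (\<forall>t\<in>carrier W. \<not> par xs t)"
  proof (induction rule: converse_equivclp_induct)
    case (step y z)
    thus ?case using step_par[of y z] step_par[of z y] by auto
  qed auto
  thus ?thesis using assms by blast
qed

lemma par_cong:
  assumes "set xs \<subseteq> S" "set ys \<subseteq> S" "eval xs = eval ys" "t \<in> carrier W"
  shows "par xs t = par ys t"
proof -
  \<comment> \<open>Appending the reversed \<open>ys\<close> makes either word trivial, so both
    parities equal the same third one.\<close>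
  have "par xs t = par (rev ys) (inv (eval ys) \<otimes> t \<otimes> eval ys)" if "set xs \<subseteq> S" "eval xs = eval ys" for xs
    using par_trivial[of "xs @ rev ys" t] that assms by (auto simp: par_append eval_rev)
  from this[of xs] this[of ys] assms show ?thesis by auto
qed

text \<open>Strong exchange condition: odd parity means that \<open>t\<close> occurs as
  \<open>s1...si...s1\<close> for some \<open>i\<close>, and multiplying by this reflection deletes
  the letter \<open>si\<close>.\<close>

lemma par_exchange:
  assumes "par xs t" "set xs \<subseteq> S" "t \<in> carrier W"
  shows "t \<in> refl \<and> (\<exists>ys. set ys \<subseteq> S \<and> Suc (length ys) = length xs \<and> eval ys = t \<otimes> eval xs)"
  using assms
proof (induction xs arbitrary: t)
  case (Cons s xs)
  have s: "s \<in> S" and xs: "set xs \<subseteq> S" using Cons.prems by auto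
  show ?case
  proof (cases "t = s")
    case True
    have "t \<in> refl"
      unfolding reflections_def conjugate_in_def using s True
      by (intro CollectI bexI[of _ s] bexI[of _ "\<one>"]) auto
    thus ?thesis using s xs True by (auto intro!: exI[of _ xs])
  next
    case False
    hence "par xs (s \<otimes> t \<otimes> s)" using Cons.prems by simp
    from Cons.IH[OF this xs] obtain ys where ys: "set ys \<subseteq> S" "Suc (length ys) = length xs"
      "eval ys = s \<otimes> t \<otimes> s \<otimes> eval xs" and r: "s \<otimes> t \<otimes> s \<in> refl"
      using Cons.prems by auto
    from r obtain u w where u: "u \<in> S" "w \<in> carrier W" "s \<otimes> t \<otimes> s = w \<otimes> u \<otimes> inv w"
      by (auto simp: reflections_def conjugate_in_def)
    have "t = s \<otimes> (s \<otimes> t \<otimes> s) \<otimes> s"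
      using s Cons.prems by (simp add: m_assoc)
    also have "\<dots> = s \<otimes> w \<otimes> u \<otimes> inv (s \<otimes> w)"
      unfolding u(3) using s u by (simp add: m_assoc inv_mult_group)
    finally have "t \<in> refl"
      unfolding reflections_def conjugate_in_def using s u by auto
    thus ?thesis using s ys xs Cons.prems
      by (auto intro!: exI[of _ "s # ys"] simp: m_assoc)
  qed
qed auto

section \<open>Inversion sets and the length function\<close>

definition inversions :: "'w \<Rightarrow> 'w set" where
  "inversions w = {t \<in> carrier W. par (reduced_word W S w) t}"

lemma inversions_word:
  "set xs \<subseteq> S \<Longrightarrow> t \<in> inversions (eval xs) \<longleftrightarrow> t \<in> carrier W \<and> par xs t"
  unfolding inversions_def using par_cong reduced_word by (metis (mono_tags, lifting) eval_closed mem_Collect_eq)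

lemma inversions_carrier: "inversions w \<subseteq> carrier W"
  by (auto simp: inversions_def)

lemma finite_inversions [simp]: "finite (inversions w)"
  using inversions_carrier finite_carrier finite_subset by blast

lemma inversions_mult:
  assumes "x \<in> carrier W" "y \<in> carrier W" "t \<in> carrier W"
  shows "t \<in> inversions (x \<otimes> y) \<longleftrightarrow> (t \<in> inversions x) \<noteq> (inv x \<otimes> t \<otimes> x \<in> inversions y)"
proof -
  obtain xs ys where "set xs \<subseteq> S" "eval xs = x" "set ys \<subseteq> S" "eval ys = y"
    using ex_word assms by metis
  thus ?thesis
    using assms inversions_word[of "xs @ ys" t] inversions_word[of xs t]
      inversions_word[of ys "inv x \<otimes> t \<otimes> x"] by (auto simp: par_append)
qed

lemma inversions_one [simp]: "inversions \<one> = {}"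
  using inversions_word[of "[]"] by auto

lemma inversions_S [simp]: "s \<in> S \<Longrightarrow> inversions s = {s}"
  using inversions_word[of "[s]"] by auto

lemma inversions_refl: "w \<in> carrier W \<Longrightarrow> inversions w \<subseteq> refl"
  using par_exchange reduced_word by (auto simp: inversions_def)

lemma refl_carrier: "refl \<subseteq> carrier W"
  by (auto simp: reflections_def conjugate_in_def)

lemma refl_square:
  assumes "t \<in> refl"
  shows "t \<otimes> t = \<one>"
proof -
  obtain s w where "s \<in> S" "w \<in> carrier W" "t = w \<otimes> s \<otimes> inv w"
    using assms by (auto simp: reflections_def conjugate_in_def)
  thus ?thesis by (simp add: m_assoc)
qed

lemma refl_conj:
  assumes "t \<in> refl" "x \<in> carrier W"
  shows "x \<otimes> t \<otimes> inv x \<in> refl"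
proof -
  obtain s w where "s \<in> S" "w \<in> carrier W" "t = w \<otimes> s \<otimes> inv w"
    using assms by (auto simp: reflections_def conjugate_in_def)
  thus ?thesis unfolding reflections_def conjugate_in_def using assms(2)
    by (intro CollectI bexI[of _ s] bexI[of _ "x \<otimes> w"]) (auto simp: m_assoc inv_mult_group)
qed

lemma S_refl: "S \<subseteq> refl"
  using refl_conj inversions_refl[of "_"] by (metis S_carrier inversions_S singletonI subsetD subsetI)

text \<open>Write \<open>t = w s w^-1\<close> and expand by the cocycle identity: the contributions
  of \<open>w\<close> and of its inverse agree and cancel modulo 2, leaving that of
  \<open>s\<close>, which is odd.\<close>

lemma refl_inversion_self:
  assumes "t \<in> refl"
  shows "t \<in> inversions t"
proof -
  obtain s w where sw: "s \<in> S" "w \<in> carrier W" "t = w \<otimes> s \<otimes> inv w"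
    using assms by (auto simp: reflections_def conjugate_in_def)
  have t: "t \<in> carrier W" using assms refl_carrier by blast
  have c: "inv w \<otimes> t \<otimes> w = s" using sw by (simp add: m_assoc)
  have "t \<in> inversions (w \<otimes> (s \<otimes> inv w)) \<longleftrightarrow> (t \<in> inversions w) \<noteq> (s \<in> inversions (s \<otimes> inv w))"
    using inversions_mult[of w "s \<otimes> inv w" t] sw(1,2) t c by simp
  also have "s \<in> inversions (s \<otimes> inv w) \<longleftrightarrow> s \<notin> inversions (inv w)"
    using inversions_mult[of s "inv w" s] sw by simp
  also have "s \<in> inversions (inv w) \<longleftrightarrow> t \<in> inversions w"
    using inversions_mult[of w "inv w" t] sw(1,2) t c by auto
  finally show ?thesis using sw by (simp add: m_assoc)
qed

lemma refl_inversion_flip: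
  assumes "t \<in> refl" "w \<in> carrier W"
  shows "t \<in> inversions (t \<otimes> w) \<longleftrightarrow> t \<notin> inversions w"
  using inversions_mult[of t w t] assms refl_inversion_self[of t] refl_square[of t] refl_carrier
  by (auto simp: inv_equality)

lemma inversion_len_less:
  assumes "t \<in> inversions w" "w \<in> carrier W"
  shows "len (t \<otimes> w) < len w"
proof -
  have "par (reduced_word W S w) t" "t \<in> carrier W" using assms by (auto simp: inversions_def)
  from par_exchange[OF this(1) reduced_word(1)[OF assms(2)] this(2)]
  show ?thesis using reduced_word[OF assms(2)] len_le by fastforce
qed

text \<open>One direction is the exchange condition. For the other, \<open>t\<close> is an inversion
  of exactly one of \<open>w\<close> and \<open>tw\<close>, and the exchange condition for
  \<open>tw\<close> would contradict the lengths.\<close>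

lemma inversion_iff:
  assumes "t \<in> refl" "w \<in> carrier W"
  shows "t \<in> inversions w \<longleftrightarrow> len (t \<otimes> w) < len w"
proof
  assume "len (t \<otimes> w) < len w"
  moreover have "t \<in> carrier W" using assms refl_carrier by blast
  ultimately show "t \<in> inversions w"
    using inversion_len_less[of t "t \<otimes> w"] refl_inversion_flip[OF assms] assms refl_square
    by (fastforce simp flip: m_assoc)
qed (use inversion_len_less assms in blast)

lemma refl_len_neq:
  assumes "t \<in> refl" "w \<in> carrier W"
  shows "len (t \<otimes> w) \<noteq> len w"
proof -
  have t: "t \<in> carrier W" and "t \<otimes> (t \<otimes> w) = w"
    using assms refl_carrier refl_square[of t] by (auto simp flip: m_assoc)
  thus ?thesis
    using refl_inversion_flip[OF assms] inversion_iff[OF assms] inversion_iff[of t "t \<otimes> w"] assms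
    by (metis m_closed nat_neq_iff)
qed

lemma S_len_cases:
  assumes "s \<in> S" "w \<in> carrier W"
  shows "len (s \<otimes> w) = Suc (len w) \<or> Suc (len (s \<otimes> w)) = len w"
proof -
  have "len (s \<otimes> w) \<noteq> len w" using refl_len_neq S_refl assms by blast
  moreover have "len (s \<otimes> w) \<le> Suc (len w)" using len_mult_le[of s w] assms by simp
  moreover have "len w \<le> Suc (len (s \<otimes> w))" using len_mult_le[of s "s \<otimes> w"] assms by simp
  ultimately show ?thesis by linarith
qed

lemma S_inversion_iff: "s \<in> S \<Longrightarrow> w \<in> carrier W \<Longrightarrow> s \<in> inversions w \<longleftrightarrow> len (s \<otimes> w) < len w"
  using inversion_iff S_refl by blast

lemma ex_descent:
  assumes "w \<in> carrier W" "w \<noteq> \<one>"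
  shows "\<exists>s\<in>S. len (s \<otimes> w) < len w"
proof -
  obtain s xs where s: "s \<in> S" "set xs \<subseteq> S" "Suc (length xs) = len w" "s \<otimes> eval xs = w"
    using ex_reduced[OF assms(1)] assms(2) by (metis eval_simps insert_subset length_Cons list.exhaust list.simps(15))
  hence "s \<otimes> w = eval xs" by auto
  thus ?thesis using len_le[OF s(2)] s by (intro bexI[of _ s]) auto
qed

lemma len_induct [consumes 1, case_names one step]:
  assumes "w \<in> carrier W" "P \<one>"
    and "\<And>s w. s \<in> S \<Longrightarrow> w \<in> carrier W \<Longrightarrow> len (s \<otimes> w) = Suc (len w) \<Longrightarrow> P w \<Longrightarrow> P (s \<otimes> w)"
  shows "P w"
  using assms(1)
proof (induction "len w" arbitrary: w rule: less_induct)
  case less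
  show ?case
  proof (cases "w = \<one>")
    case False
    then obtain s where s: "s \<in> S" "len (s \<otimes> w) < len w" using ex_descent less.prems by blast
    have "P (s \<otimes> (s \<otimes> w))"
      using s less.prems S_len_cases[OF s(1) less.prems] by (intro assms(3) less.hyps) auto
    thus ?thesis using s less.prems by simp
  qed (use assms in simp)
qed

text \<open>Prefixing an ascent \<open>s\<close> conjugates the old inversions by \<open>s\<close>
  and adds the new inversion \<open>s\<close>.\<close>

lemma card_inversions:
  assumes "w \<in> carrier W"
  shows "card (inversions w) = len w"
  using assms
proof (induction rule: len_induct)
  case (step s w)
  have s: "s \<notin> inversions w" using step by (simp add: S_inversion_iff)
  have "inversions (s \<otimes> w) = insert s ((\<lambda>t. s \<otimes> t \<otimes> s) ` inversions w)" (is "_ = insert s (?f ` _)")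
  proof (intro Set.set_eqI iffI)
    fix t assume t: "t \<in> inversions (s \<otimes> w)"
    hence tc: "t \<in> carrier W" using inversions_carrier by blast
    show "t \<in> insert s (?f ` inversions w)"
    proof (cases "t = s")
      case False
      hence "s \<otimes> t \<otimes> s \<in> inversions w" using t tc step inversions_mult[of s w t] by simp
      moreover have "t = s \<otimes> (s \<otimes> t \<otimes> s) \<otimes> s" using tc step by (simp add: m_assoc)
      ultimately show ?thesis by blast
    qed simp
  next
    fix t assume "t \<in> insert s (?f ` inversions w)"
    moreover have "s \<in> inversions (s \<otimes> w)"
      using step s inversions_mult[of s w s] by simp
    moreover have "s \<otimes> r \<otimes> s \<in> inversions (s \<otimes> w)" if r: "r \<in> inversions w" for r
    proof -
      have rc: "r \<in> carrier W" using r inversions_carrier by blast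
      have "s \<otimes> (s \<otimes> r \<otimes> s) \<otimes> s = r" using rc step by (simp add: m_assoc)
      moreover have "s \<otimes> r \<otimes> s \<noteq> s"
      proof
        assume "s \<otimes> r \<otimes> s = s"
        hence "r = s \<otimes> s \<otimes> s" using rc step S_conj_eq_iff[of s r s] by blast
        hence "r = s" using step by simp
        thus False using s r by simp
      qed
      ultimately show ?thesis
        using rc r step inversions_mult[of s w "s \<otimes> r \<otimes> s"] by simp
    qed
    ultimately show "t \<in> inversions (s \<otimes> w)" by blast
  qed
  moreover have "s \<notin> ?f ` inversions w"
  proof
    assume "s \<in> ?f ` inversions w"
    then obtain r where r: "r \<in> inversions w" "s = s \<otimes> r \<otimes> s" by blast
    have rc: "r \<in> carrier W" using r inversions_carrier by blast
    hence "r = s" using r(2) step S_conj_eq_iff[of s r s] by simp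
    thus False using s r by simp
  qed
  moreover have "inj_on ?f (inversions w)"
  proof (rule inj_onI)
    fix r t assume "r \<in> inversions w" "t \<in> inversions w" and eq: "s \<otimes> r \<otimes> s = s \<otimes> t \<otimes> s"
    hence "r \<in> carrier W" "t \<in> carrier W" using inversions_carrier by blast+
    thus "r = t" using eq step by simp
  qed
  ultimately show ?case using step by (simp add: card_image)
qed simp

section \<open>Descents on the left and on the right\<close>

lemma len_right: "s \<in> S \<Longrightarrow> w \<in> carrier W \<Longrightarrow> len (w \<otimes> s) = len (s \<otimes> inv w)"
  using len_inv[of "w \<otimes> s"] by (simp add: inv_mult_group)

text \<open>The inversion sets of \<open>u\<close> and \<open>ut\<close> differ by the single
  reflection \<open>u t u^-1\<close>, which is \<open>s\<close> only if
  \<open>su = ut\<close>.\<close>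

lemma descent_left_mult_right:
  assumes "s \<in> S" "t \<in> S" "u \<in> carrier W" "s \<otimes> u \<noteq> u \<otimes> t"
  shows "len (s \<otimes> (u \<otimes> t)) < len (u \<otimes> t) \<longleftrightarrow> len (s \<otimes> u) < len u"
proof -
  have "inv u \<otimes> s \<otimes> u \<noteq> t"
    using assms by (metis S_carrier inv_closed inv_solve_left' m_assoc m_closed)
  hence "s \<in> inversions (u \<otimes> t) \<longleftrightarrow> s \<in> inversions u"
    using inversions_mult[of u t s] assms by simp
  thus ?thesis using assms by (simp add: S_inversion_iff)
qed

lemma descent_right_mult_left:
  assumes "s \<in> S" "t \<in> S" "u \<in> carrier W" "s \<otimes> u \<noteq> u \<otimes> t"
  shows "len (s \<otimes> (u \<otimes> t)) < len (s \<otimes> u) \<longleftrightarrow> len (u \<otimes> t) < len u"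
proof -
  have "t \<otimes> inv u \<noteq> inv u \<otimes> s"
  proof
    assume "t \<otimes> inv u = inv u \<otimes> s"
    hence "inv (t \<otimes> inv u) = inv (inv u \<otimes> s)" by simp
    thus False using assms by (simp add: inv_mult_group)
  qed
  hence "len (t \<otimes> (inv u \<otimes> s)) < len (inv u \<otimes> s) \<longleftrightarrow> len (t \<otimes> inv u) < len (inv u)"
    using descent_left_mult_right[of t s "inv u"] assms by simp
  moreover have "len (inv u \<otimes> s) = len (s \<otimes> u)"
    using len_right[of s "inv u"] assms by simp
  moreover have "len (t \<otimes> (inv u \<otimes> s)) = len (s \<otimes> (u \<otimes> t))"
    using len_inv[of "s \<otimes> (u \<otimes> t)"] assms by (simp add: inv_mult_group m_assoc)
  ultimately show ?thesis using assms by (simp add: len_right)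
qed

subsection \<open>Bruhat order\<close>

abbreviation bless :: "'w \<Rightarrow> 'w \<Rightarrow> bool" where "bless \<equiv> bruhat_less W S"

lemma bruhat_base_iff:
  assumes "y \<in> carrier W"
  shows "(\<exists>t\<in>refl. w = y \<otimes> t) \<longleftrightarrow> (\<exists>t\<in>refl. w = t \<otimes> y)"
proof
  assume "\<exists>t\<in>refl. w = y \<otimes> t"
  then obtain t where t: "t \<in> refl" "w = y \<otimes> t" by blast
  moreover have "t \<in> carrier W" using t refl_carrier by blast
  ultimately have "w = y \<otimes> t \<otimes> inv y \<otimes> y" using assms by (simp add: m_assoc)
  thus "\<exists>t\<in>refl. w = t \<otimes> y" using refl_conj[OF t(1) assms] by blast
next
  assume "\<exists>t\<in>refl. w = t \<otimes> y"
  then obtain t where t: "t \<in> refl" "w = t \<otimes> y" by blast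
  moreover have "t \<in> carrier W" using t refl_carrier by blast
  ultimately have "w = y \<otimes> (inv y \<otimes> t \<otimes> inv (inv y))" using assms by (simp add: m_assoc)
  thus "\<exists>t\<in>refl. w = y \<otimes> t" using refl_conj[OF t(1), of "inv y"] assms by blast
qed

lemma bless_base:
  assumes "t \<in> refl" "y \<in> carrier W" "len y < len (t \<otimes> y)"
  shows "bless y (t \<otimes> y)"
  unfolding bruhat_less_def using assms bruhat_base_iff[of y "t \<otimes> y"]
  by (intro tranclp.r_into_trancl) auto

lemma bless_S: "s \<in> S \<Longrightarrow> y \<in> carrier W \<Longrightarrow> len y < len (s \<otimes> y) \<Longrightarrow> bless y (s \<otimes> y)"
  using bless_base S_refl by blast

lemma bless_trans: "bless x y \<Longrightarrow> bless y z \<Longrightarrow> bless x z"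
  unfolding bruhat_less_def by (rule tranclp_trans)

lemma bless_induct [consumes 1, case_names base step]:
  assumes "bless y w"
    and base: "\<And>t y. t \<in> refl \<Longrightarrow> y \<in> carrier W \<Longrightarrow> len y < len (t \<otimes> y) \<Longrightarrow> w = t \<otimes> y \<Longrightarrow> P y"
    and step: "\<And>t y. t \<in> refl \<Longrightarrow> y \<in> carrier W \<Longrightarrow> len y < len (t \<otimes> y) \<Longrightarrow> bless (t \<otimes> y) w \<Longrightarrow>
      P (t \<otimes> y) \<Longrightarrow> P y"
  shows "P y"
  using assms(1) unfolding bruhat_less_def
proof (induction rule: converse_tranclp_induct)
  case (base y)
  then obtain t where "t \<in> refl" "w = t \<otimes> y" using bruhat_base_iff[of y w] by metis
  thus ?case using base assms(2)[of t y] by simp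
next
  case (step y z)
  then obtain t where "t \<in> refl" "z = t \<otimes> y" using bruhat_base_iff[of y z] by metis
  thus ?case using step assms(3)[of t y] by (simp add: bruhat_less_def)
qed

lemma bless_carrier: "bless y w \<Longrightarrow> y \<in> carrier W \<and> w \<in> carrier W"
  by (induction rule: bless_induct) (use refl_carrier in auto)

lemma bless_len: "bless y w \<Longrightarrow> len y < len w"
  by (induction rule: bless_induct) auto

lemma bless_irrefl: "\<not> bless w w"
  using bless_len by blast

lemma finite_bless: "finite {z. bless z w}"
  by (rule finite_subset[OF _ finite_carrier]) (use bless_carrier in blast)

text \<open>Left multiplication by \<open>s\<close> turns the reflection \<open>t\<close> into
  \<open>sts\<close>, still different from \<open>s\<close>. By the cocycle identity it is not an
  inversion of \<open>sy\<close>, so the step still goes up.\<close>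

lemma bless_mult_S:
  assumes "t \<in> refl" "s \<in> S" "t \<noteq> s" "y \<in> carrier W" "len y < len (t \<otimes> y)"
  shows "bless (s \<otimes> y) (s \<otimes> (t \<otimes> y))"
proof -
  have t: "t \<in> carrier W" using assms refl_carrier by blast
  have r: "s \<otimes> t \<otimes> s \<in> refl" using refl_conj[OF assms(1), of s] assms by simp
  have eq: "s \<otimes> t \<otimes> s \<otimes> (s \<otimes> y) = s \<otimes> (t \<otimes> y)" using t assms by (simp add: m_assoc)
  have "t \<notin> inversions y" using assms inversion_iff by auto
  moreover have "s \<otimes> (s \<otimes> t \<otimes> s) \<otimes> s = t" using t assms by (simp add: m_assoc)
  moreover have "s \<otimes> t \<otimes> s \<noteq> s"
    using S_conj_eq_iff[of s t s] assms t by auto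
  ultimately have "s \<otimes> t \<otimes> s \<notin> inversions (s \<otimes> y)"
    using inversions_mult[of s y "s \<otimes> t \<otimes> s"] assms t by simp
  hence "len (s \<otimes> y) < len (s \<otimes> t \<otimes> s \<otimes> (s \<otimes> y))"
    using inversion_iff[OF r, of "s \<otimes> y"] refl_len_neq[OF r, of "s \<otimes> y"] assms by simp
  thus ?thesis using bless_base[OF r, of "s \<otimes> y"] assms eq by simp
qed

text \<open>Along a chain of reflections only a step by \<open>s\<close> itself fails to survive
  left multiplication by \<open>s\<close>. Such a step makes \<open>sy\<close> the next member of
  the chain, whence the last two alternatives.\<close>

lemma bless_lift:
  assumes "bless y w" "s \<in> S"
  shows "bless (s \<otimes> y) (s \<otimes> w) \<or> s \<otimes> y = w \<or> bless (s \<otimes> y) w"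
  using assms(1)
proof (induction rule: bless_induct)
  case (base t y)
  show ?case
  proof (cases "t = s")
    case False
    thus ?thesis using bless_mult_S[OF base(1) assms(2) False base(2,3)] base(4) by simp
  qed (use base in simp)
next
  case (step t y)
  show ?case
  proof (cases "t = s")
    case False
    have "bless (s \<otimes> y) (s \<otimes> (t \<otimes> y))"
      by (rule bless_mult_S[OF step(1) assms(2) False step(2,3)])
    thus ?thesis using step(5) bless_trans by metis
  qed (use step in simp)
qed

lemma bless_lift_up:
  assumes "bless y w" "s \<in> S" "len w < len (s \<otimes> w)"
  shows "bless (s \<otimes> y) (s \<otimes> w)"
  using bless_lift[OF assms(1,2)] bless_S[of s w] bless_trans assms bless_carrier by blast

text \<open>For left multiplication by a generator, Bruhat comparison amounts to comparison of
  lengths.\<close>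

lemma M_triple_iff:
  "M_triple W S s z w \<longleftrightarrow>
    s \<in> S \<and> len (s \<otimes> z) < len z \<and> bless z w \<and> len w < len (s \<otimes> w)"
  using bless_S[of s w] bless_S[of s "s \<otimes> z"] bless_len[of "s \<otimes> z" z] bless_len[of w "s \<otimes> w"] bless_carrier[of z w]
  unfolding M_triple_def by fastforce

subsection \<open>Weight functions\<close>

lemma conjugate_refl: "s \<in> carrier W \<Longrightarrow> conjugate_in W s s"
  unfolding conjugate_in_def by (intro bexI[of _ "\<one>"]) auto

lemma conjugate_sym:
  assumes "conjugate_in W s t" "s \<in> carrier W"
  shows "conjugate_in W t s"
proof -
  obtain w where "w \<in> carrier W" "t = w \<otimes> s \<otimes> inv w"
    using assms by (auto simp: conjugate_in_def)
  thus ?thesis unfolding conjugate_in_def using assms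
    by (intro bexI[of _ "inv w"]) (auto simp: m_assoc)
qed

lemma conjugate_trans:
  assumes "conjugate_in W r s" "conjugate_in W s t" "r \<in> carrier W"
  shows "conjugate_in W r t"
proof -
  obtain x y where "x \<in> carrier W" "y \<in> carrier W" "s = x \<otimes> r \<otimes> inv x" "t = y \<otimes> s \<otimes> inv y"
    using assms by (auto simp: conjugate_in_def)
  thus ?thesis unfolding conjugate_in_def using assms
    by (intro bexI[of _ "y \<otimes> x"]) (auto simp: m_assoc inv_mult_group)
qed

definition refl_weight :: "('w \<Rightarrow> int) \<Rightarrow> 'w \<Rightarrow> int" where
  "refl_weight c t = c (SOME s. s \<in> S \<and> conjugate_in W s t)"

lemma refl_weight_eq:
  assumes "\<forall>s\<in>S. \<forall>t\<in>S. conjugate_in W s t \<longrightarrow> c s = c t" "s \<in> S" "conjugate_in W s t"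
  shows "refl_weight c t = c s"
proof -
  define r where "r = (SOME s. s \<in> S \<and> conjugate_in W s t)"
  have "r \<in> S \<and> conjugate_in W r t"
    unfolding r_def by (rule someI[of _ s]) (use assms in auto)
  moreover have "conjugate_in W r s"
    using calculation assms by (meson S_carrier conjugate_sym conjugate_trans)
  ultimately show ?thesis using assms unfolding refl_weight_def r_def[symmetric] by metis
qed

lemma refl_weight_conj:
  assumes "\<forall>s\<in>S. \<forall>t\<in>S. conjugate_in W s t \<longrightarrow> c s = c t" "t \<in> refl" "x \<in> carrier W"
  shows "refl_weight c (x \<otimes> t \<otimes> inv x) = refl_weight c t"
proof -
  obtain s where s: "s \<in> S" "conjugate_in W s t" using assms by (auto simp: reflections_def)
  moreover have "conjugate_in W t (x \<otimes> t \<otimes> inv x)"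
    using assms(3) by (auto simp: conjugate_in_def)
  ultimately show ?thesis
    using conjugate_trans[of s t "x \<otimes> t \<otimes> inv x"] refl_weight_eq[OF assms(1)] by (metis S_carrier)
qed

text \<open>The weight of an element is the total weight of its inversions, a reflection weighing as
  much as any generator conjugate to it. If lengths add, counting forces the inversions of
  \<open>xy\<close> to be the disjoint union of those of \<open>x\<close> and the
  \<open>x\<close>-conjugates of those of \<open>y\<close>.\<close>

lemma ex_weight_function:
  assumes c: "\<forall>s\<in>S. \<forall>t\<in>S. conjugate_in W s t \<longrightarrow> c s = c t"
  shows "\<exists>L. weight_function W S L \<and> (\<forall>s\<in>S. L s = c s)"
proof (intro exI conjI ballI)
  define L where "L = restrict (\<lambda>w. \<Sum>t\<in>inversions w. refl_weight c t) (carrier W)"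
  show "L s = c s" if "s \<in> S" for s
    using that refl_weight_eq[OF c that] conjugate_refl[of s] by (simp add: L_def)
  show "weight_function W S L"
    unfolding weight_function_def
  proof (intro conjI ballI impI)
    show "L \<in> extensional (carrier W)" by (simp add: L_def)
    fix x y assume xy: "x \<in> carrier W" "y \<in> carrier W" and l: "len (x \<otimes> y) = len x + len y"
    define f where "f = (\<lambda>t. x \<otimes> t \<otimes> inv x)"
    have inj: "inj_on f (inversions y)"
      using xy inversions_carrier[of y] unfolding f_def inj_on_def by (auto simp: subset_iff)
    have "inversions (x \<otimes> y) \<subseteq> inversions x \<union> f ` inversions y"
    proof
      fix t assume t: "t \<in> inversions (x \<otimes> y)"
      hence tc: "t \<in> carrier W" using inversions_carrier by blast
      show "t \<in> inversions x \<union> f ` inversions y"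
      proof (cases "t \<in> inversions x")
        case False
        hence "inv x \<otimes> t \<otimes> x \<in> inversions y" using t tc xy inversions_mult[of x y t] by simp
        moreover have "t = f (inv x \<otimes> t \<otimes> x)" using tc xy by (simp add: f_def m_assoc)
        ultimately show ?thesis by blast
      qed simp
    qed
    moreover have card: "card (inversions x \<union> f ` inversions y) \<le> card (inversions (x \<otimes> y))"
      using card_Un_le[of "inversions x" "f ` inversions y"] xy l
      by (simp add: card_inversions card_image[OF inj])
    ultimately have eq: "inversions (x \<otimes> y) = inversions x \<union> f ` inversions y"
      by (intro card_seteq) auto
    have "card (inversions x \<inter> f ` inversions y) = 0"
      using card_Un_Int[of "inversions x" "f ` inversions y"] xy l
      unfolding eq[symmetric] by (simp add: card_inversions card_image[OF inj])
    hence "(\<Sum>t\<in>inversions (x \<otimes> y). refl_weight c t) =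
        (\<Sum>t\<in>inversions x. refl_weight c t) + (\<Sum>t\<in>f ` inversions y. refl_weight c t)"
      unfolding eq by (intro sum.union_disjoint) auto
    also have "(\<Sum>t\<in>f ` inversions y. refl_weight c t) = (\<Sum>t\<in>inversions y. refl_weight c t)"
      unfolding sum.reindex[OF inj] o_def
      using refl_weight_conj[OF c _ xy(1)] inversions_refl[OF xy(2)]
      by (intro sum.cong) (auto simp: f_def)
    finally show "L (x \<otimes> y) = L x + L y" using xy by (simp add: L_def)
  qed
qed

lemma weight_function_S_mult:
  "weight_function W S L \<Longrightarrow> s \<in> S \<Longrightarrow> w \<in> carrier W \<Longrightarrow> len w < len (s \<otimes> w) \<Longrightarrow>
    L (s \<otimes> w) = L s + L w"
  using S_len_cases[of s w] unfolding weight_function_def by fastforce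

lemma weight_function_one: "weight_function W S L \<Longrightarrow> L \<one> = 0"
  unfolding weight_function_def by (metis add_0 add_cancel_right_right len_one one_closed r_one)

lemma weight_function_unique:
  assumes "weight_function W S L" "weight_function W S L'" "\<forall>s\<in>S. L s = L' s"
  shows "L = L'"
proof
  fix w
  show "L w = L' w"
  proof (cases "w \<in> carrier W")
    case True
    thus ?thesis
      by (induction rule: len_induct) (use assms in \<open>simp_all add: weight_function_one weight_function_S_mult\<close>)
  next
    case False
    hence "L w = undefined" "L' w = undefined"
      using assms(1,2) extensional_arb unfolding weight_function_def by metis+
    thus ?thesis by simp
  qed
qed

lemma weight_function_bounds:
  assumes "weight_function W S L" "\<forall>s\<in>S. 0 \<le> L s \<and> L s \<le> 1" "w \<in> carrier W"
  shows "0 \<le> L w \<and> L w \<le> int (len w)"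
  using assms(3)
proof (induction rule: len_induct)
  case one
  thus ?case using assms(1) by (simp add: weight_function_one)
next
  case (step s w)
  have "L (s \<otimes> w) = L s + L w" using assms(1) step by (simp add: weight_function_S_mult)
  moreover have "0 \<le> L s" "L s \<le> 1" using assms(2) step(1) by auto
  ultimately show ?case using step by simp
qed

text \<open>The prescribed values are constant on conjugacy classes, so existence and uniqueness
  turn the definite description into an actual weight function.\<close>

lemma weight_ab:
  assumes "S = Sx \<union> Sy" "Sx \<inter> Sy = {}" "\<forall>s\<in>Sx. \<forall>t\<in>Sy. \<not> conjugate_in W s t"
  shows "weight_function W S (weight_ab W Sx Sy a b)"
    "s \<in> Sx \<Longrightarrow> weight_ab W Sx Sy a b s = a" "t \<in> Sy \<Longrightarrow> weight_ab W Sx Sy a b t = b"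
proof -
  define c where "c s = (if s \<in> Sx then a else b)" for s
  have "\<forall>s\<in>S. \<forall>t\<in>S. conjugate_in W s t \<longrightarrow> c s = c t"
    using assms conjugate_sym unfolding c_def by (metis S_carrier Un_iff)
  then obtain L where L: "weight_function W S L" "\<forall>s\<in>S. L s = c s"
    using ex_weight_function by blast
  hence L': "weight_function W (Sx \<union> Sy) L \<and> (\<forall>s\<in>Sx. L s = a) \<and> (\<forall>t\<in>Sy. L t = b)"
    using assms by (auto simp: c_def)
  have "\<exists>!L. weight_function W (Sx \<union> Sy) L \<and> (\<forall>s\<in>Sx. L s = a) \<and> (\<forall>t\<in>Sy. L t = b)"
  proof (rule ex1I[of _ L])
    fix L' assume "weight_function W (Sx \<union> Sy) L' \<and> (\<forall>s\<in>Sx. L' s = a) \<and> (\<forall>t\<in>Sy. L' t = b)"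
    thus "L' = L" using L' assms(1) by (intro weight_function_unique) auto
  qed (fact L')
  from theI'[OF this, folded weight_ab_def]
  show "weight_function W S (weight_ab W Sx Sy a b)"
    "s \<in> Sx \<Longrightarrow> weight_ab W Sx Sy a b s = a" "t \<in> Sy \<Longrightarrow> weight_ab W Sx Sy a b t = b"
    using assms(1) by auto
qed

end

section \<open>The Hecke algebra as an algebra of functions\<close>

text \<open>An element \<open>\<Sum> f(w) T\<^sub>w\<close> is represented by its coefficient function \<open>f\<close>; \<open>opl s\<close> and \<open>opr s\<close> are the
  multiplications by \<open>T\<^sub>s\<close> from the left and from the right, and \<open>q s\<close> stands for \<open>v\<^sub>s - v\<^sub>s\<^sup>-\<^sup>1\<close>.\<close>

locale hecke_ring = coxeter W S for W :: "'w monoid" (structure) and S +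
  fixes q :: "'w \<Rightarrow> 'r :: comm_ring_1" and bar :: "'r \<Rightarrow> 'r"
  assumes q_conj: "\<And>s t. s \<in> S \<Longrightarrow> t \<in> S \<Longrightarrow> conjugate_in W s t \<Longrightarrow> q s = q t"
    and bar_add: "\<And>x y. bar (x + y) = bar x + bar y"
    and bar_mult: "\<And>x y. bar (x * y) = bar x * bar y"
    and bar_one: "bar 1 = 1"
    and bar_q: "\<And>s. s \<in> S \<Longrightarrow> bar (q s) = - q s"
begin

definition supported :: "('w \<Rightarrow> 'r) \<Rightarrow> bool" where
  "supported f \<longleftrightarrow> (\<forall>u. u \<notin> carrier W \<longrightarrow> f u = 0)"

text \<open>The coefficient of \<open>T_u\<close> always receives \<open>f (su)\<close> from
  \<open>T_s T_(su)\<close>, and in addition \<open>q s * f u\<close> from \<open>T_s T_u\<close>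
  when \<open>su < u\<close>.\<close>

definition opl :: "'w \<Rightarrow> ('w \<Rightarrow> 'r) \<Rightarrow> 'w \<Rightarrow> 'r" where
  "opl s f u = (if u \<in> carrier W
     then f (s \<otimes> u) + (if len (s \<otimes> u) < len u then q s * f u else 0) else 0)"

definition opr :: "'w \<Rightarrow> ('w \<Rightarrow> 'r) \<Rightarrow> 'w \<Rightarrow> 'r" where
  "opr t f u = (if u \<in> carrier W
     then f (u \<otimes> t) + (if len (u \<otimes> t) < len u then q t * f u else 0) else 0)"

definition opl_inv :: "'w \<Rightarrow> ('w \<Rightarrow> 'r) \<Rightarrow> 'w \<Rightarrow> 'r" where
  "opl_inv s f u = opl s f u - q s * f u"

definition delta :: "'w \<Rightarrow> 'w \<Rightarrow> 'r" where
  "delta w u = of_bool (u = w)"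

lemma supported_simps [simp, intro]:
  "w \<in> carrier W \<Longrightarrow> supported (delta w)"
  "supported (opl s f)" "supported (opr s f)"
  "supported f \<Longrightarrow> supported (opl_inv s f)"
  "supported f \<Longrightarrow> supported g \<Longrightarrow> supported (\<lambda>u. f u + g u)"
  "supported f \<Longrightarrow> supported g \<Longrightarrow> supported (\<lambda>u. f u - g u)"
  "supported f \<Longrightarrow> supported (\<lambda>u. c * f u)"
  by (auto simp: supported_def delta_def opl_def opr_def opl_inv_def)

lemma supported_sum:
  "(\<And>i. i \<in> I \<Longrightarrow> supported (g i)) \<Longrightarrow> supported (\<lambda>u. \<Sum>i\<in>I. c i * g i u)"
  by (auto simp: supported_def intro!: sum.neutral)

lemma conjugate_of_commute:
  assumes "s \<in> S" "t \<in> S" "u \<in> carrier W" "s \<otimes> u = u \<otimes> t"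
  shows "q s = q t"
proof -
  have "s = u \<otimes> t \<otimes> inv u" using assms by (metis S_carrier inv_solve_right m_closed)
  hence "conjugate_in W t s" using assms by (auto simp: conjugate_in_def)
  thus ?thesis using q_conj assms by metis
qed

text \<open>If \<open>su = ut\<close>, then \<open>s\<close> and \<open>t\<close> are conjugate and
  their parameters agree; otherwise multiplying on one side does not affect the descent on the
  other. This is the smallest instance of associativity, available before a product is
  defined.\<close>

lemma opl_opr_commute:
  assumes "s \<in> S" "t \<in> S"
  shows "opl s (opr t f) = opr t (opl s f)"
proof
  fix u
  show "opl s (opr t f) u = opr t (opl s f) u"
  proof (cases "u \<in> carrier W")
    case u: True
    show ?thesis
    proof (cases "s \<otimes> u = u \<otimes> t")
      case True
      have "s \<otimes> u \<otimes> t = u" using assms u unfolding True by simp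
      moreover have "s \<otimes> (u \<otimes> t) = u" using assms u calculation by (simp add: m_assoc)
      ultimately show ?thesis
        using assms u conjugate_of_commute[OF assms u True] True
        by (simp add: opl_def opr_def algebra_simps)
    next
      case False
      have "s \<otimes> u \<otimes> t = s \<otimes> (u \<otimes> t)" using assms u by (simp add: m_assoc)
      thus ?thesis
        using assms u descent_left_mult_right[OF assms u False] descent_right_mult_left[OF assms u False]
        by (simp add: opl_def opr_def algebra_simps)
    qed
  qed (simp add: opl_def opr_def)
qed

text \<open>Endomorphisms of the right regular module; once the product exists, these are the left
  multiplications.\<close>

definition equivariant :: "(('w \<Rightarrow> 'r) \<Rightarrow> 'w \<Rightarrow> 'r) \<Rightarrow> bool" where
  "equivariant A \<longleftrightarrow>
     (\<forall>f. supported f \<longrightarrow> supported (A f)) \<and>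
     (\<forall>f g. supported f \<longrightarrow> supported g \<longrightarrow> A (\<lambda>u. f u + g u) = (\<lambda>u. A f u + A g u)) \<and>
     (\<forall>c f. supported f \<longrightarrow> A (\<lambda>u. c * f u) = (\<lambda>u. c * A f u)) \<and>
     (\<forall>t\<in>S. \<forall>f. supported f \<longrightarrow> A (opr t f) = opr t (A f))"

lemma equivariantD:
  assumes "equivariant A" "supported f"
  shows "supported (A f)" "supported g \<Longrightarrow> A (\<lambda>u. f u + g u) = (\<lambda>u. A f u + A g u)"
    "A (\<lambda>u. c * f u) = (\<lambda>u. c * A f u)" "t \<in> S \<Longrightarrow> A (opr t f) = opr t (A f)"
  using assms unfolding equivariant_def by blast+

lemma equivariant_sum:
  assumes "equivariant A" "finite I" "\<And>i. i \<in> I \<Longrightarrow> supported (g i)"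
  shows "A (\<lambda>u. \<Sum>i\<in>I. c i * g i u) = (\<lambda>u. \<Sum>i\<in>I. c i * A (g i) u)"
  using assms(2,3)
proof induction
  case empty
  have "A (\<lambda>u. 0 * delta \<one> u) = (\<lambda>u. 0 * A (delta \<one>) u)"
    by (rule equivariantD) (use assms in auto)
  thus ?case by simp
next
  case (insert i I)
  have "A (\<lambda>u. c i * g i u + (\<Sum>i\<in>I. c i * g i u)) =
      (\<lambda>u. A (\<lambda>u. c i * g i u) u + A (\<lambda>u. \<Sum>i\<in>I. c i * g i u) u)"
    by (rule equivariantD) (use assms insert in \<open>auto intro!: supported_sum\<close>)
  also have "A (\<lambda>u. c i * g i u) = (\<lambda>u. c i * A (g i) u)"
    by (rule equivariantD) (use assms insert in auto)
  finally show ?case using insert by simp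
qed

lemma delta_expansion:
  assumes "supported f"
  shows "f = (\<lambda>u. \<Sum>w\<in>carrier W. f w * delta w u)"
proof
  fix u
  have "(\<Sum>w\<in>carrier W. f w * delta w u) = (\<Sum>w\<in>carrier W. if u = w then f w else 0)"
    by (intro sum.cong) (auto simp: delta_def)
  thus "f u = (\<Sum>w\<in>carrier W. f w * delta w u)"
    using assms finite_carrier by (simp add: supported_def)
qed

lemma equivariant_expansion:
  assumes "equivariant A" "supported f"
  shows "A f u = (\<Sum>w\<in>carrier W. f w * A (delta w) u)"
  using equivariant_sum[OF assms(1) finite_carrier, of delta f] delta_expansion[OF assms(2)] by simp

lemma opr_delta:
  assumes "s \<in> S" "x \<in> carrier W" "len x < len (x \<otimes> s)"
  shows "opr s (delta x) = delta (x \<otimes> s)"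
proof
  fix u
  have "(u \<otimes> s = x) = (u = x \<otimes> s)" if "u \<in> carrier W" using assms that by auto
  thus "opr s (delta x) u = delta (x \<otimes> s) u" using assms by (auto simp: opr_def delta_def)
qed

lemma opl_delta:
  assumes "s \<in> S" "x \<in> carrier W" "len x < len (s \<otimes> x)"
  shows "opl s (delta x) = delta (s \<otimes> x)"
proof
  fix u
  have "(s \<otimes> u = x) = (u = s \<otimes> x)" if "u \<in> carrier W" using assms that by auto
  thus "opl s (delta x) u = delta (s \<otimes> x) u" using assms by (auto simp: opl_def delta_def)
qed

text \<open>The right multiplications generate all basis elements from the unit, so operators commuting
  with them are determined by their value there. This replaces Matsumoto's theorem.\<close>

lemma equivariant_eqI:
  assumes "equivariant A" "equivariant B" "A (delta \<one>) = B (delta \<one>)" "supported f"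
  shows "A f = B f"
proof -
  \<comment> \<open>Induction on length adds letters on the left; passing to inverses turns them
    into right multiplications, with which \<open>A\<close> and \<open>B\<close> commute.\<close>
  have "A (delta (inv w)) = B (delta (inv w))" if "w \<in> carrier W" for w
    using that
  proof (induction rule: len_induct)
    case (step s w)
    have "len (inv w \<otimes> s) = Suc (len (inv w))"
      using step by (simp add: len_right)
    hence "delta (inv (s \<otimes> w)) = opr s (delta (inv w))"
      using step by (simp add: opr_delta inv_mult_group)
    thus ?case using step equivariantD(4)[OF assms(1)] equivariantD(4)[OF assms(2)] by simp
  qed (use assms in simp)
  hence "A (delta w) = B (delta w)" if "w \<in> carrier W" for w
    using that by (metis inv_closed inv_inv)
  thus ?thesis
    using equivariant_expansion[OF assms(1,4)] equivariant_expansion[OF assms(2,4)] by (simp add: fun_eq_iff)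
qed

lemma equivariant_opl:
  assumes "s \<in> S"
  shows "equivariant (opl s)"
  unfolding equivariant_def
proof (intro conjI allI impI ballI)
  show "opl s (opr t f) = opr t (opl s f)" if "t \<in> S" for t f
    using opl_opr_commute assms that by simp
qed (auto simp: opl_def algebra_simps fun_eq_iff)

lemma opr_diff: "opr t (\<lambda>u. f u - c * g u) = (\<lambda>u. opr t f u - c * opr t g u)"
  by (auto simp: opr_def algebra_simps fun_eq_iff)

lemma equivariant_opl_inv:
  assumes "s \<in> S"
  shows "equivariant (opl_inv s)"
  unfolding equivariant_def
proof (intro conjI allI impI ballI)
  show "opl_inv s (opr t f) = opr t (opl_inv s f)" if "t \<in> S" for t f
    using opl_opr_commute[OF assms that, of f] opr_diff[of t "opl s f" "q s" f]
    by (simp add: opl_inv_def[abs_def])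
qed (auto simp: opl_inv_def opl_def algebra_simps fun_eq_iff)

lemma equivariant_comp: "equivariant A \<Longrightarrow> equivariant B \<Longrightarrow> equivariant (\<lambda>f. A (B f))"
  unfolding equivariant_def by simp

lemma equivariant_id: "equivariant (\<lambda>f. f)"
  unfolding equivariant_def by simp

lemma equivariant_foldr:
  assumes "\<And>s. s \<in> S \<Longrightarrow> equivariant (F s)" "set xs \<subseteq> S"
  shows "equivariant (foldr F xs)"
  using assms(2)
proof (induction xs)
  case Nil
  thus ?case using equivariant_id by (simp add: id_def)
next
  case (Cons s xs)
  thus ?case using equivariant_comp[of "F s" "foldr F xs"] assms(1) by (simp add: o_def)
qed

lemma equivariant_words:
  assumes "set xs \<subseteq> S"
  shows "equivariant (foldr opl xs)" "equivariant (foldr opl_inv xs)"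
  using assms equivariant_foldr equivariant_opl equivariant_opl_inv by blast+

text \<open>The quadratic relation \<open>T_s^2 = 1 + q T_s\<close>, which makes
  \<open>T_s - q\<close> the inverse of \<open>T_s\<close>.\<close>

lemma opl_opl:
  assumes "s \<in> S" "supported f"
  shows "opl s (opl s f) u = f u + q s * opl s f u"
proof (cases "u \<in> carrier W")
  case True
  thus ?thesis
    using S_len_cases[OF assms(1) True] assms by (auto simp: opl_def algebra_simps)
qed (use assms in \<open>simp add: opl_def supported_def\<close>)

lemma opl_opl_inv:
  assumes "s \<in> S" "supported f"
  shows "opl s (opl_inv s f) = f" "opl_inv s (opl s f) = f"
proof -
  have "opl s (opl_inv s f) u = opl s (opl s f) u - q s * opl s f u" for u
    by (simp add: opl_def opl_inv_def algebra_simps)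
  thus "opl s (opl_inv s f) = f" using opl_opl[OF assms] by (simp add: fun_eq_iff)
  show "opl_inv s (opl s f) = f" using opl_opl[OF assms] by (simp add: opl_inv_def fun_eq_iff)
qed

lemma foldr_opl_inv:
  assumes "set xs \<subseteq> S" "supported f"
  shows "foldr opl (rev xs) (foldr opl_inv xs f) = f" "foldr opl_inv xs (foldr opl (rev xs) f) = f"
proof -
  show "foldr opl (rev xs) (foldr opl_inv xs f) = f"
    using assms(1)
  proof (induction xs)
    case (Cons s xs)
    have "supported (foldr opl_inv xs f)"
      using equivariantD(1)[OF equivariant_words(2) assms(2)] Cons.prems by simp
    thus ?case using Cons by (simp add: opl_opl_inv)
  qed simp
  show "foldr opl_inv xs (foldr opl (rev xs) f) = f"
    using assms
  proof (induction xs arbitrary: f)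
    case (Cons s xs)
    have "foldr opl_inv xs (foldr opl (rev xs) (opl s f)) = opl s f"
      using Cons by simp
    thus ?case using Cons.prems by (simp add: opl_opl_inv)
  qed simp
qed

text \<open>If the lengths add up for the whole word, every letter must raise the length, so each
  factor acts by \<open>T_s T_x = T_(sx)\<close>.\<close>

lemma foldr_opl_delta:
  assumes "set xs \<subseteq> S" "y \<in> carrier W" "length xs + len y = len (eval xs \<otimes> y)"
  shows "foldr opl xs (delta y) = delta (eval xs \<otimes> y)"
  using assms
proof (induction xs)
  case (Cons s xs)
  let ?z = "eval xs \<otimes> y"
  have z: "?z \<in> carrier W" "s \<in> S" "s \<otimes> eval xs \<otimes> y = s \<otimes> ?z" using Cons.prems by (auto simp: m_assoc)
  have "len ?z \<le> length xs + len y"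
    using len_mult_le[of "eval xs" y] len_le[of xs] Cons.prems by auto
  moreover have "len (s \<otimes> ?z) \<le> Suc (len ?z)" using S_len_cases z by fastforce
  moreover have "len (s \<otimes> ?z) = Suc (length xs + len y)" using Cons.prems z by simp
  ultimately have "length xs + len y = len ?z" "len ?z < len (s \<otimes> ?z)" by linarith+
  thus ?case using Cons z by (simp add: opl_delta)
qed simp

lemma foldr_opl_one:
  "set xs \<subseteq> S \<Longrightarrow> length xs = len (eval xs) \<Longrightarrow> foldr opl xs (delta \<one>) = delta (eval xs)"
  using foldr_opl_delta[of xs \<one>] by simp

subsection \<open>The product\<close>

definition lmult :: "'w \<Rightarrow> ('w \<Rightarrow> 'r) \<Rightarrow> 'w \<Rightarrow> 'r" where
  "lmult w = foldr opl (reduced_word W S w)"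

definition star :: "('w \<Rightarrow> 'r) \<Rightarrow> ('w \<Rightarrow> 'r) \<Rightarrow> 'w \<Rightarrow> 'r" where
  "star h k u = (\<Sum>w\<in>carrier W. h w * lmult w k u)"

lemma equivariant_lmult: "w \<in> carrier W \<Longrightarrow> equivariant (lmult w)"
  unfolding lmult_def using equivariant_words(1) reduced_word by blast

lemma opr_sum:
  "opr t (\<lambda>u. \<Sum>i\<in>I. c i * g i u) u = (\<Sum>i\<in>I. c i * opr t (g i) u)"
  by (simp add: opr_def sum_distrib_left sum.distrib[symmetric] algebra_simps)

lemma equivariant_star: "equivariant (star h)"
  unfolding equivariant_def
proof (intro conjI allI impI ballI)
  fix f g t c assume f: "supported f"
  have eq: "equivariant (lmult w)" if "w \<in> carrier W" for w using equivariant_lmult that .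
  show "supported (star h f)"
    unfolding star_def using supported_sum[of "carrier W" "\<lambda>w. lmult w f"] equivariantD(1)[OF eq f]
    by blast
  show "star h (\<lambda>u. f u + g u) = (\<lambda>u. star h f u + star h g u)" if "supported g"
    using equivariantD(2)[OF eq f that] unfolding star_def
    by (simp add: fun_eq_iff algebra_simps flip: sum.distrib cong: sum.cong)
  show "star h (\<lambda>u. c * f u) = (\<lambda>u. c * star h f u)"
    using equivariantD(3)[OF eq f] unfolding star_def
    by (simp add: fun_eq_iff sum_distrib_left mult.left_commute cong: sum.cong)
  show "star h (opr t f) = opr t (star h f)" if "t \<in> S"
    using equivariantD(4)[OF eq f that] unfolding star_def[abs_def]
    by (simp add: fun_eq_iff opr_sum cong: sum.cong)
qed

lemma star_one_right:
  assumes "supported h"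
  shows "star h (delta \<one>) = h"
proof -
  have "lmult w (delta \<one>) = delta w" if "w \<in> carrier W" for w
    unfolding lmult_def using foldr_opl_one[of "reduced_word W S w"] reduced_word[OF that] by simp
  thus ?thesis using delta_expansion[OF assms] unfolding star_def[abs_def]
    by (simp cong: sum.cong)
qed

lemma supported_star: "supported k \<Longrightarrow> supported (star h k)"
  using equivariantD(1)[OF equivariant_star] .

text \<open>As functions of \<open>m\<close>, both sides commute with right multiplications and take
  the unit to \<open>star h k\<close>.\<close>

lemma star_assoc:
  assumes "supported h" "supported k" "supported m"
  shows "star (star h k) m = star h (star k m)"
proof (rule equivariant_eqI[OF equivariant_star equivariant_comp[OF equivariant_star equivariant_star] _ assms(3)])
  show "star (star h k) (delta \<one>) = star h (star k (delta \<one>))"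
    using assms by (simp add: star_one_right supported_star)
qed

text \<open>Makes the product independent of the reduced words selected in its definition: both
  operators send the unit to \<open>delta (eval xs)\<close>.\<close>

lemma star_eq_word:
  assumes "set xs \<subseteq> S" "length xs = len (eval xs)" "supported f"
  shows "star (delta (eval xs)) f = foldr opl xs f"
proof (rule equivariant_eqI[OF equivariant_star equivariant_words(1)[OF assms(1)] _ assms(3)])
  have "supported (delta (eval xs))" using assms(1) by simp
  thus "star (delta (eval xs)) (delta \<one>) = foldr opl xs (delta \<one>)"
    by (simp only: star_one_right foldr_opl_one[OF assms(1,2)])
qed

lemma star_one_left: "supported f \<Longrightarrow> star (delta \<one>) f = f"
  using star_eq_word[of "[]" f] by simp

lemma star_S: "s \<in> S \<Longrightarrow> supported f \<Longrightarrow> star (delta s) f = opl s f"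
  using star_eq_word[of "[s]" f] by simp

subsection \<open>The bar involution\<close>

text \<open>The inverse of \<open>T_(w^-1)\<close>: inversion reverses the order of the factors, so
  a word for \<open>w\<close> itself is read forwards.\<close>

definition T_inv :: "'w \<Rightarrow> 'w \<Rightarrow> 'r" where
  "T_inv w = foldr opl_inv (reduced_word W S w) (delta \<one>)"

lemma word_inverse:
  assumes "set xs \<subseteq> S" "length xs = len (eval xs)"
  defines "x \<equiv> foldr opl_inv xs (delta \<one>)"
  shows "supported x" "star (delta (inv (eval xs))) x = delta \<one>" "star x (delta (inv (eval xs))) = delta \<one>"
proof -
  show x: "supported x"
    unfolding x_def using equivariantD(1)[OF equivariant_words(2)] assms by simp
  have rev: "set (rev xs) \<subseteq> S" "length (rev xs) = len (eval (rev xs))" "eval (rev xs) = inv (eval xs)"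
    using assms by (simp_all add: eval_rev)
  have sx: "star x f = foldr opl_inv xs f" if "supported f" for f
    by (rule equivariant_eqI[OF equivariant_star equivariant_words(2)[OF assms(1)] _ that])
      (simp add: star_one_right x flip: x_def)
  show "star (delta (inv (eval xs))) x = delta \<one>"
    using star_eq_word[OF rev(1,2) x] foldr_opl_inv(1)[OF assms(1)] rev(3) by (simp add: x_def)
  show "star x (delta (inv (eval xs))) = delta \<one>"
    using sx[of "delta (inv (eval xs))"] foldr_opl_inv(2)[OF assms(1), of "delta \<one>"]
      foldr_opl_one[OF rev(1,2)] rev(3) assms(1) by simp
qed

lemma inverse_unique:
  assumes "supported x" "supported y" "supported z" "star y x = delta \<one>" "star x z = delta \<one>"
  shows "y = z"
  using star_assoc[OF assms(2,1,3)] assms by (simp add: star_one_left star_one_right)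

lemma T_inv:
  assumes "w \<in> carrier W"
  shows "supported (T_inv w)" "star (delta (inv w)) (T_inv w) = delta \<one>"
    "star (T_inv w) (delta (inv w)) = delta \<one>"
  using word_inverse[of "reduced_word W S w"] reduced_word[OF assms] by (simp_all add: T_inv_def)

lemma T_inv_word:
  assumes "set xs \<subseteq> S" "length xs = len (eval xs)"
  shows "T_inv (eval xs) = foldr opl_inv xs (delta \<one>)"
  by (rule inverse_unique[of "delta (inv (eval xs))"]) (use T_inv word_inverse[OF assms] assms in auto)

lemma T_inv_one [simp]: "T_inv \<one> = delta \<one>"
  using T_inv_word[of "[]"] by simp

lemma T_inv_S_mult:
  assumes "s \<in> S" "w \<in> carrier W" "len w < len (s \<otimes> w)"
  shows "T_inv (s \<otimes> w) = opl_inv s (T_inv w)"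
proof -
  obtain xs where "set xs \<subseteq> S" "length xs = len w" "eval xs = w" using ex_reduced[OF assms(2)] by blast
  thus ?thesis
    using T_inv_word[of xs] T_inv_word[of "s # xs"] S_len_cases[OF assms(1,2)] assms by simp
qed

text \<open>The multiplication rule for the inverse basis, with \<open>q s\<close> negated. If
  \<open>sw < w\<close>, write \<open>T_s^-1\<close> as \<open>T_s - q s\<close> and let
  \<open>T_s\<close> cancel the first factor of \<open>T_inv w\<close>.\<close>

lemma opl_inv_T_inv:
  assumes "s \<in> S" "w \<in> carrier W"
  shows "opl_inv s (T_inv w) u = T_inv (s \<otimes> w) u - (if len (s \<otimes> w) < len w then q s * T_inv w u else 0)"
proof (cases "len w < len (s \<otimes> w)")
  case True
  thus ?thesis using T_inv_S_mult assms by simp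
next
  case False
  hence lt: "len (s \<otimes> w) < len w" using S_len_cases[OF assms] by linarith
  have x: "supported (T_inv (s \<otimes> w))" using assms T_inv by simp
  have w: "T_inv w = opl_inv s (T_inv (s \<otimes> w))"
    using T_inv_S_mult[of s "s \<otimes> w"] lt assms by simp
  have "opl_inv s (T_inv w) u = opl s (opl_inv s (T_inv (s \<otimes> w))) u - q s * T_inv w u"
    by (simp add: opl_inv_def[of s "T_inv w"] flip: w)
  thus ?thesis using lt by (simp add: opl_opl_inv[OF assms(1) x])
qed

text \<open>Triangularity with respect to length suffices for reading off a coefficient of
  \<open>hbar h\<close> at a longest element of the support of \<open>h\<close>.\<close>

lemma T_inv_unitriangular:
  assumes "w \<in> carrier W"
  shows "T_inv w w = 1" "u \<noteq> w \<Longrightarrow> len w \<le> len u \<Longrightarrow> T_inv w u = 0"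
proof -
  have "len w \<le> len u \<longrightarrow> T_inv w u = of_bool (u = w)" for u
    using assms
  proof (induction arbitrary: u rule: len_induct)
    case one
    show ?case by (simp add: delta_def)
  next
    case (step s w)
    show ?case
    proof (intro impI)
      assume le: "len (s \<otimes> w) \<le> len u"
      show "T_inv (s \<otimes> w) u = of_bool (u = s \<otimes> w)"
      proof (cases "u \<in> carrier W")
        case True
        have "T_inv w u = 0" using step le by auto
        moreover have "len w \<le> len (s \<otimes> u)" using S_len_cases[OF step(1) True] le step by linarith
        moreover have "(s \<otimes> u = w) = (u = s \<otimes> w)" using True step by auto
        ultimately show ?thesis
          using step True by (simp add: T_inv_S_mult opl_inv_def opl_def)
      next
        case False
        thus ?thesis using T_inv(1)[of "s \<otimes> w"] step by (auto simp: supported_def)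
      qed
    qed
  qed
  thus "T_inv w w = 1" "u \<noteq> w \<Longrightarrow> len w \<le> len u \<Longrightarrow> T_inv w u = 0" by auto
qed

definition hbar :: "('w \<Rightarrow> 'r) \<Rightarrow> 'w \<Rightarrow> 'r" where
  "hbar h u = (\<Sum>w\<in>carrier W. bar (h w) * T_inv w u)"

lemma bar_zero [simp]: "bar 0 = 0"
  using bar_add[of 0 0] by simp

lemma bar_uminus: "bar (- x) = - bar x"
  using bar_add[of x "- x"] by (simp add: eq_neg_iff_add_eq_0 add.commute)

lemma bar_diff: "bar (x - y) = bar x - bar y"
  using bar_add[of x "- y"] by (simp add: bar_uminus)

lemma bar_sum: "bar (\<Sum>i\<in>I. f i) = (\<Sum>i\<in>I. bar (f i))"
  by (induction I rule: infinite_finite_induct) (simp_all add: bar_add)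

lemma hbar_add: "hbar (\<lambda>u. h u + k u) u = hbar h u + hbar k u"
  by (simp add: hbar_def bar_add algebra_simps sum.distrib)

lemma hbar_diff: "hbar (\<lambda>u. h u - k u) u = hbar h u - hbar k u"
  by (simp add: hbar_def bar_diff algebra_simps sum_subtractf)

lemma hbar_smult: "hbar (\<lambda>u. c * h u) u = bar c * hbar h u"
  by (simp add: hbar_def bar_mult sum_distrib_left mult.assoc)

lemma hbar_sum: "hbar (\<lambda>u. \<Sum>i\<in>I. f i u) u = (\<Sum>i\<in>I. hbar (f i) u)"
  unfolding hbar_def bar_sum sum_distrib_right by (rule sum.swap)

lemma hbar_one: "hbar (delta \<one>) = delta \<one>"
proof
  fix u
  have "hbar (delta \<one>) u = (\<Sum>w\<in>carrier W. if w = \<one> then delta \<one> u else 0)"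
    unfolding hbar_def by (intro sum.cong) (auto simp: delta_def bar_one)
  thus "hbar (delta \<one>) u = delta \<one> u" using finite_carrier by simp
qed

lemma opl_inv_sum:
  "opl_inv s (\<lambda>u. \<Sum>i\<in>I. c i * g i u) u = (\<Sum>i\<in>I. c i * opl_inv s (g i) u)"
  by (simp add: opl_inv_def opl_def sum_distrib_left sum.distrib[symmetric] sum_subtractf[symmetric] algebra_simps)

text \<open>Multiplicativity of the bar involution in the case used by the Kazhdan--Lusztig
  recursion, left factor \<open>T_s\<close>. The sign from \<open>bar_q\<close> matches the one in
  \<open>opl_inv_T_inv\<close>.\<close>

lemma hbar_opl:
  assumes "s \<in> S" "supported h"
  shows "hbar (opl s h) = opl_inv s (hbar h)"
proof
  fix u
  have "hbar (opl s h) u = (\<Sum>w\<in>carrier W. bar (h (s \<otimes> w)) * T_inv w u) -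
      (\<Sum>w\<in>carrier W. bar (h w) * (if len (s \<otimes> w) < len w then q s * T_inv w u else 0))"
    unfolding hbar_def sum_subtractf[symmetric]
    by (intro sum.cong) (auto simp: opl_def bar_add bar_mult bar_q assms algebra_simps)
  also have "(\<Sum>w\<in>carrier W. bar (h (s \<otimes> w)) * T_inv w u) = (\<Sum>w\<in>carrier W. bar (h w) * T_inv (s \<otimes> w) u)"
    by (rule sum.reindex_bij_witness[of _ "\<lambda>w. s \<otimes> w" "\<lambda>w. s \<otimes> w"]) (use assms in auto)
  also have "\<dots> - (\<Sum>w\<in>carrier W. bar (h w) * (if len (s \<otimes> w) < len w then q s * T_inv w u else 0)) =
      (\<Sum>w\<in>carrier W. bar (h w) * opl_inv s (T_inv w) u)"
    unfolding sum_subtractf[symmetric]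
    by (intro sum.cong) (use assms in \<open>auto simp: opl_inv_T_inv algebra_simps\<close>)
  also have "\<dots> = opl_inv s (hbar h) u"
    unfolding hbar_def[abs_def] opl_inv_sum ..
  finally show "hbar (opl s h) u = opl_inv s (hbar h) u" .
qed

lemma hbar_top:
  assumes "w \<in> carrier W" "\<And>y. y \<in> carrier W \<Longrightarrow> h y \<noteq> 0 \<Longrightarrow> len y \<le> len w"
  shows "hbar h w = bar (h w)"
proof -
  have "bar (h y) * T_inv y w = (if y = w then bar (h w) else 0)" if "y \<in> carrier W" for y
    using assms(2)[OF that] T_inv_unitriangular[OF that] by (cases "h y = 0") auto
  thus ?thesis unfolding hbar_def using finite_carrier assms(1) by (simp cong: sum.cong)
qed

end

section \<open>Kazhdan--Lusztig theory\<close>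

definition push :: "('a \<Rightarrow> 'b) \<Rightarrow> ('a \<Rightarrow>\<^sub>0 int) \<Rightarrow> ('b \<Rightarrow>\<^sub>0 int)" where
  "push \<phi> f = (\<Sum>a\<in>Poly_Mapping.keys f. Poly_Mapping.single (\<phi> a) (Poly_Mapping.lookup f a))"

lemma push_superset:
  assumes "finite A" "Poly_Mapping.keys f \<subseteq> A"
  shows "push \<phi> f = (\<Sum>a\<in>A. Poly_Mapping.single (\<phi> a) (Poly_Mapping.lookup f a))"
  unfolding push_def using assms by (intro sum.mono_neutral_left) (auto simp: in_keys_iff)

lemma push_single [simp]: "push \<phi> (Poly_Mapping.single a c) = Poly_Mapping.single (\<phi> a) c"
  using push_superset[of "{a}" "Poly_Mapping.single a c" \<phi>] by (simp split: if_splits)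

lemma push_add: "push \<phi> (f + g) = push \<phi> f + push \<phi> g"
  using Poly_Mapping.keys_add[of f g]
  by (simp add: push_superset[of "Poly_Mapping.keys f \<union> Poly_Mapping.keys g"] lookup_add single_add sum.distrib)

lemma push_zero [simp]: "push \<phi> 0 = 0"
  by (simp add: push_def)

lemma push_sum: "push \<phi> (\<Sum>i\<in>I. f i) = (\<Sum>i\<in>I. push \<phi> (f i))"
  by (induction I rule: infinite_finite_induct) (simp_all add: push_add)

lemma sum_single_lookup:
  "(\<Sum>a\<in>Poly_Mapping.keys f. Poly_Mapping.single a (Poly_Mapping.lookup f a)) = f"
  by (rule poly_mapping_eqI) (auto simp: lookup_sum lookup_single when_def sum.delta in_keys_iff)

lemma poly_mapping_mult_eq:
  fixes f g :: "'a::monoid_add \<Rightarrow>\<^sub>0 'b::semiring_1"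
  shows "f * g = (\<Sum>a\<in>Poly_Mapping.keys f. \<Sum>b\<in>Poly_Mapping.keys g.
    Poly_Mapping.single (a + b) (Poly_Mapping.lookup f a * Poly_Mapping.lookup g b))"
  unfolding mult_single[symmetric] sum_product[symmetric] sum_single_lookup ..

lemma push_mult:
  fixes f g :: "'a::monoid_add \<Rightarrow>\<^sub>0 int" and \<phi> :: "'a \<Rightarrow> 'b::monoid_add"
  assumes "\<And>a b. \<phi> (a + b) = \<phi> a + \<phi> b"
  shows "push \<phi> (f * g) = push \<phi> f * push \<phi> g"
  unfolding poly_mapping_mult_eq[of f g] push_sum push_single assms
  unfolding push_def sum_product mult_single ..

definition gbar :: "('g::ab_group_add \<Rightarrow>\<^sub>0 int) \<Rightarrow> ('g \<Rightarrow>\<^sub>0 int)" where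
  "gbar = push uminus"

lemma lookup_gbar [simp]: "Poly_Mapping.lookup (gbar f) a = Poly_Mapping.lookup f (- a)"
proof -
  have "Poly_Mapping.lookup (gbar f) a =
      (\<Sum>b\<in>Poly_Mapping.keys f. if b = - a then Poly_Mapping.lookup f b else 0)"
    unfolding gbar_def push_def lookup_sum by (intro sum.cong) (auto simp: lookup_single when_def)
  also have "\<dots> = Poly_Mapping.lookup f (- a)"
    by (simp add: in_keys_iff)
  finally show ?thesis .
qed

lemma gbar_single [simp]: "gbar (Poly_Mapping.single a c) = Poly_Mapping.single (- a) c"
  by (simp add: gbar_def)

lemma finite_ex_max:
  fixes f :: "'a \<Rightarrow> nat"
  assumes "finite A" "z \<in> A"
  shows "\<exists>w\<in>A. \<forall>y\<in>A. f y \<le> f w"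
proof -
  have "Max (f ` A) \<in> f ` A" using assms by (intro Max_in) auto
  then obtain w where "w \<in> A" "f w = Max (f ` A)" by auto
  thus ?thesis using assms by (metis Max_ge finite_imageI imageI)
qed

text \<open>The group is a whole type, written additively, so that the finitely supported integer
  functions on it form a commutative ring type; \<open>P\<close> is the positive cone.\<close>

locale kl_data = coxeter W S for W :: "'w monoid" (structure) and S +
  fixes P :: "'g::ab_group_add set" and v :: "'w \<Rightarrow> 'g"
  assumes P_add: "a \<in> P \<Longrightarrow> b \<in> P \<Longrightarrow> a + b \<in> P"
    and P_zero: "0 \<notin> P"
    and P_total: "a \<in> P \<or> a = 0 \<or> - a \<in> P"
    and v_pos: "s \<in> S \<Longrightarrow> v s \<in> P"
    and v_conj: "s \<in> S \<Longrightarrow> t \<in> S \<Longrightarrow> conjugate_in W s t \<Longrightarrow> v s = v t"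
begin

lemma P_asym: "a \<in> P \<Longrightarrow> - a \<notin> P"
  using P_add[of a "- a"] P_zero by auto

abbreviation V :: "'w \<Rightarrow> 'g \<Rightarrow>\<^sub>0 int" where "V s \<equiv> Poly_Mapping.single (v s) 1"
abbreviation Vi :: "'w \<Rightarrow> 'g \<Rightarrow>\<^sub>0 int" where "Vi s \<equiv> Poly_Mapping.single (- v s) 1"

sublocale hecke_ring W S "\<lambda>s. V s - Vi s" gbar
proof
  fix s t assume "s \<in> S" "t \<in> S" "conjugate_in W s t"
  thus "V s - Vi s = V t - Vi t" using v_conj by simp
next
  show "gbar 1 = 1" using gbar_single[of 0 1] by simp
  show "gbar (x * y) = gbar x * gbar y" for x y
    unfolding gbar_def by (rule push_mult) simp
  show "gbar (x + y) = gbar x + gbar y" for x y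
    by (simp add: gbar_def push_add)
  show "gbar (V s - Vi s) = - (V s - Vi s)" for s
  proof (rule poly_mapping_eqI)
    fix k
    have "v s = - k \<longleftrightarrow> - v s = k" by (metis minus_minus)
    thus "Poly_Mapping.lookup (gbar (V s - Vi s)) k = Poly_Mapping.lookup (- (V s - Vi s)) k"
      by (auto simp: lookup_minus lookup_single when_def)
  qed
qed

lemma V_Vi: "V s * Vi s = 1" "Vi s * V s = 1"
  by (simp_all add: mult_single)

subsection \<open>Negative elements and bar-invariant parts\<close>

definition neg :: "('g \<Rightarrow>\<^sub>0 int) \<Rightarrow> bool" where
  "neg f \<longleftrightarrow> (\<forall>k\<in>Poly_Mapping.keys f. - k \<in> P)"

lemma neg_zero [simp]: "neg 0"
  by (simp add: neg_def)

lemma neg_add: "neg f \<Longrightarrow> neg g \<Longrightarrow> neg (f + g)"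
  unfolding neg_def using Poly_Mapping.keys_add[of f g] by blast

lemma neg_diff: "neg f \<Longrightarrow> neg g \<Longrightarrow> neg (f - g)"
  unfolding neg_def by (force simp: in_keys_iff lookup_minus)

lemma neg_Vi:
  assumes "s \<in> S"
  shows "neg (Vi s)" "neg f \<Longrightarrow> neg (Vi s * f)"
proof -
  show "neg (Vi s)" using v_pos[OF assms] by (auto simp: neg_def)
  show "neg (Vi s * f)" if "neg f"
  proof (unfold neg_def, intro ballI)
    fix k assume "k \<in> Poly_Mapping.keys (Vi s * f)"
    then obtain b where "k = - v s + b" "b \<in> Poly_Mapping.keys f"
      using keys_mult[of "Vi s" f] by auto
    thus "- k \<in> P" using that P_add[OF v_pos[OF assms], of "- b"] by (simp add: neg_def)
  qed
qed

text \<open>The bar negates exponents, and the positive cone is disjoint from its negative. This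
  rigidity is the source of the uniqueness of the basis.\<close>

lemma neg_bar_invariant:
  assumes "neg f" "gbar f = f"
  shows "f = 0"
proof (rule poly_mapping_eqI, rule ccontr)
  fix k assume "Poly_Mapping.lookup f k \<noteq> Poly_Mapping.lookup 0 k"
  hence k: "k \<in> Poly_Mapping.keys f" by (simp add: in_keys_iff)
  hence "- k \<in> Poly_Mapping.keys f" using assms(2) lookup_gbar[of f k] by (simp add: in_keys_iff)
  thus False using k assms(1) P_asym by (force simp: neg_def)
qed

text \<open>The bar-invariant element congruent to \<open>f\<close> modulo negative elements.\<close>

definition symm :: "('g \<Rightarrow>\<^sub>0 int) \<Rightarrow> ('g \<Rightarrow>\<^sub>0 int)" where
  "symm f = Abs_poly_mapping (\<lambda>k. if - k \<in> P then Poly_Mapping.lookup f (- k) else Poly_Mapping.lookup f k)"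

lemma lookup_symm:
  "Poly_Mapping.lookup (symm f) k = (if - k \<in> P then Poly_Mapping.lookup f (- k) else Poly_Mapping.lookup f k)"
proof -
  have "finite {k. (if - k \<in> P then Poly_Mapping.lookup f (- k) else Poly_Mapping.lookup f k) \<noteq> 0}"
  proof (rule finite_subset)
    show "{k. (if - k \<in> P then Poly_Mapping.lookup f (- k) else Poly_Mapping.lookup f k) \<noteq> 0}
        \<subseteq> Poly_Mapping.keys f \<union> uminus -` Poly_Mapping.keys f"
      by (auto simp: in_keys_iff split: if_splits)
  qed (simp add: finite_vimageI)
  thus ?thesis unfolding symm_def by simp
qed

lemma gbar_symm: "gbar (symm f) = symm f"
proof (rule poly_mapping_eqI)
  fix k
  show "Poly_Mapping.lookup (gbar (symm f)) k = Poly_Mapping.lookup (symm f) k"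
    using P_total[of k] P_asym[of k] by (auto simp: lookup_symm)
qed

lemma neg_diff_symm: "neg (f - symm f)"
  by (auto simp: neg_def in_keys_iff lookup_minus lookup_symm split: if_splits)

lemma keys_symm: "Poly_Mapping.keys (symm f) \<subseteq> Poly_Mapping.keys f \<union> uminus -` Poly_Mapping.keys f"
  by (auto simp: in_keys_iff lookup_symm split: if_splits)

subsection \<open>The Kazhdan--Lusztig basis\<close>

definition is_kl :: "'w \<Rightarrow> ('w \<Rightarrow> 'g \<Rightarrow>\<^sub>0 int) \<Rightarrow> bool" where
  "is_kl w c \<longleftrightarrow> supported c \<and> hbar c = c \<and> c w = 1 \<and> (\<forall>z. z \<noteq> w \<longrightarrow> neg (c z)) \<and>
     (\<forall>z. z \<noteq> w \<longrightarrow> c z \<noteq> 0 \<longrightarrow> bless z w)"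

lemma is_klD:
  assumes "is_kl w c"
  shows "supported c" "hbar c = c" "c w = 1" "z \<noteq> w \<Longrightarrow> neg (c z)" "z \<noteq> w \<Longrightarrow> c z \<noteq> 0 \<Longrightarrow> bless z w"
  using assms unfolding is_kl_def by blast+

text \<open>At a longest element of the support, \<open>hbar\<close> merely bars the coefficient,
  which is thus both negative and bar-invariant.\<close>

lemma bar_invariant_neg_eq_zero:
  assumes "supported d" "hbar d = d" "\<And>z. neg (d z)"
  shows "d z = 0"
proof (rule ccontr)
  assume z: "d z \<noteq> 0"
  define A where "A = {u \<in> carrier W. d u \<noteq> 0}"
  have "finite A" "z \<in> A" using finite_carrier z assms(1) by (auto simp: A_def supported_def)
  then obtain w where w: "w \<in> A" "\<And>y. y \<in> A \<Longrightarrow> len y \<le> len w"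
    using finite_ex_max[of A z len] by blast
  have "hbar d w = gbar (d w)" by (rule hbar_top) (use w in \<open>auto simp: A_def\<close>)
  hence "d w = 0" using neg_bar_invariant[of "d w"] assms by simp
  thus False using w by (simp add: A_def)
qed

lemma is_kl_unique:
  assumes "is_kl w c" "is_kl w c'"
  shows "c = c'"
proof -
  define d where "d = (\<lambda>u. c u - c' u)"
  have "supported d" unfolding d_def using assms by (intro supported_simps) (auto dest: is_klD)
  moreover have "hbar d = d"
    unfolding d_def hbar_diff[abs_def] using is_klD(2)[OF assms(1)] is_klD(2)[OF assms(2)]
    by (simp add: hbar_diff fun_eq_iff)
  moreover have "neg (d z)" for z
    using is_klD[OF assms(1)] is_klD[OF assms(2)] by (cases "z = w") (auto simp: d_def intro: neg_diff)
  ultimately have "d z = 0" for z by (rule bar_invariant_neg_eq_zero)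
  thus ?thesis by (simp add: d_def fun_eq_iff)
qed

definition C :: "'w \<Rightarrow> 'w \<Rightarrow> 'g \<Rightarrow>\<^sub>0 int" where
  "C w = (THE c. is_kl w c)"

lemma C_eqI: "is_kl w c \<Longrightarrow> C w = c"
  unfolding C_def using is_kl_unique by (intro the_equality) auto

lemma is_kl_one: "is_kl \<one> (delta \<one>)"
  by (auto simp: is_kl_def hbar_one) (auto simp: delta_def)

text \<open>Left multiplication by \<open>C_s = T_s + v_s^-1\<close>.\<close>

definition K :: "'w \<Rightarrow> ('w \<Rightarrow> 'g \<Rightarrow>\<^sub>0 int) \<Rightarrow> 'w \<Rightarrow> 'g \<Rightarrow>\<^sub>0 int" where
  "K s h u = opl s h u + Vi s * h u"

lemma supported_K: "supported h \<Longrightarrow> supported (K s h)"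
  unfolding K_def[abs_def] by (intro supported_simps)

lemma hbar_K:
  assumes "s \<in> S" "supported h" "hbar h = h"
  shows "hbar (K s h) = K s h"
proof
  fix u
  have "hbar (K s h) u = hbar (opl s h) u + gbar (Vi s) * hbar h u"
    unfolding K_def[abs_def] hbar_add hbar_smult ..
  also have "\<dots> = opl_inv s h u + V s * h u"
    using hbar_opl[OF assms(1,2)] assms(3) by simp
  also have "\<dots> = K s h u" by (simp add: K_def opl_inv_def algebra_simps)
  finally show "hbar (K s h) u = K s h u" .
qed

text \<open>The identity \<open>T_s C_s = v_s C_s\<close>, a form of the quadratic relation.\<close>

lemma opl_K:
  assumes "s \<in> S" "supported h"
  shows "opl s (K s h) u = V s * K s h u"
proof -
  have "opl s (K s h) u = opl s (opl s h) u + Vi s * opl s h u"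
    using equivariantD(2,3)[OF equivariant_opl[OF assms(1)]] assms(2)
    unfolding K_def[abs_def] by (simp add: fun_eq_iff)
  also have "\<dots> = h u + V s * opl s h u"
    unfolding opl_opl[OF assms] by (simp add: algebra_simps)
  also have "\<dots> = V s * K s h u"
    unfolding K_def distrib_left mult.assoc[symmetric] V_Vi by simp
  finally show ?thesis .
qed

lemma opl_diff_sum:
  "opl s (\<lambda>u. f u - (\<Sum>i\<in>I. c i * g i u)) u = opl s f u - (\<Sum>i\<in>I. c i * opl s (g i) u)"
  by (simp add: opl_def sum_distrib_left sum.distrib[symmetric] sum_subtractf[symmetric] algebra_simps)

text \<open>The value at \<open>z\<close> involves only values at longer elements of
  \<open>Z\<close>, so well-founded recursion runs downwards from the longest ones.\<close>

lemma ex_triangular_solution: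
  assumes "finite Z"
  shows "\<exists>m. \<forall>z\<in>Z. m z = symm (a z - (\<Sum>y | y \<in> Z \<and> len z < len y. m y * b y z))"
proof -
  define r where "r = {(y, z). y \<in> Z \<and> z \<in> Z \<and> len z < len y}"
  define N where "N = Max (insert 0 (len ` Z))"
  have "r \<subseteq> measure (\<lambda>y. Suc N - len y)"
  proof
    fix p assume "p \<in> r"
    then obtain y z where p: "p = (y, z)" "y \<in> Z" "z \<in> Z" "len z < len y" by (auto simp: r_def)
    moreover have "len y \<le> N" unfolding N_def using p assms by (intro Max_ge) auto
    ultimately show "p \<in> measure (\<lambda>y. Suc N - len y)" by auto
  qed
  hence wf: "wf r" using wf_subset wf_measure by blast
  define F where "F = (\<lambda>m z. symm (a z - (\<Sum>y | y \<in> Z \<and> len z < len y. m y * b y z)))"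
  have "wfrec r F z = F (wfrec r F) z" if "z \<in> Z" for z
  proof -
    have "F (cut (wfrec r F) r z) z = F (wfrec r F) z"
      unfolding F_def
      by (intro arg_cong[of _ _ symm] arg_cong2[of _ _ _ _ "(-)"] refl sum.cong)
        (use that in \<open>auto simp: cut_apply r_def\<close>)
    thus ?thesis using wfrec[OF wf, of F z] by simp
  qed
  thus ?thesis unfolding F_def by blast
qed

definition below :: "'w \<Rightarrow> 'w \<Rightarrow> 'w set" where
  "below s w = {z. M_triple W S s z w}"

lemma finite_below [simp]: "finite (below s w)"
  by (rule finite_subset[OF _ finite_bless[of w]]) (auto simp: below_def M_triple_iff)

lemma belowD:
  "z \<in> below s w \<Longrightarrow> bless z w" "z \<in> below s w \<Longrightarrow> len (s \<otimes> z) < len z" "z \<in> below s w \<Longrightarrow> z \<in> carrier W"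
  using bless_carrier by (auto simp: below_def M_triple_iff)

text \<open>A recursion for \<open>M^s_(z,w)\<close>: modulo negative elements it has to cancel the
  coefficient of \<open>T_z\<close>, and bar-invariance fixes the rest. Summing over all longer
  \<open>y\<close> instead of \<open>y > z\<close> adds only zero terms.\<close>

definition M_solution :: "'w \<Rightarrow> 'w \<Rightarrow> ('w \<Rightarrow> 'g \<Rightarrow>\<^sub>0 int) \<Rightarrow> bool" where
  "M_solution s w m \<longleftrightarrow> (\<forall>z\<in>below s w.
     m z = symm (V s * C w z - (\<Sum>y | y \<in> below s w \<and> len z < len y. m y * C y z)))"

text \<open>Existence of the Kazhdan--Lusztig basis by induction on the length: the correction terms are
  chosen to make the coefficients at the descents of \<open>s\<close> negative; at the ascents this is then
  automatic because the new element is an eigenvector of left multiplication by \<open>T\<^sub>s\<close>.\<close>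

lemma kl_step:
  assumes s: "s \<in> S" and w: "w \<in> carrier W" and up: "len w < len (s \<otimes> w)"
    and c: "is_kl w (C w)"
    and Cy: "\<And>z. bless z w \<Longrightarrow> is_kl z (C z)"
    and Cs: "\<And>z. bless z w \<Longrightarrow> len (s \<otimes> z) < len z \<Longrightarrow> opl s (C z) = (\<lambda>u. V s * C z u)"
    and m: "M_solution s w m"
  defines "E \<equiv> \<lambda>u. K s (C w) u - (\<Sum>z\<in>below s w. m z * C z u)"
  shows "is_kl (s \<otimes> w) E" "opl s E = (\<lambda>u. V s * E u)"
proof -
  let ?Z = "below s w"
  have kly: "is_kl z (C z)" if "z \<in> ?Z" for z using Cy belowD(1)[OF that] .
  have suppE: "supported E"
    unfolding E_def by (intro supported_simps supported_K supported_sum) (use c kly is_klD(1) in auto)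
  have mbar: "gbar (m z) = m z" if "z \<in> ?Z" for z
  proof -
    have "\<exists>x. m z = symm x" using m that unfolding M_solution_def by blast
    thus ?thesis using gbar_symm by auto
  qed
  have barE: "hbar E = E"
  proof
    fix u
    have "hbar E u = hbar (K s (C w)) u - (\<Sum>z\<in>?Z. gbar (m z) * hbar (C z) u)"
      unfolding E_def hbar_diff hbar_sum hbar_smult ..
    also have "\<dots> = E u"
      unfolding E_def hbar_K[OF s is_klD(1,2)[OF c]]
      by (intro arg_cong2[of _ _ _ _ "(-)"] HOL.refl sum.cong) (use mbar is_klD(2)[OF kly] in auto)
    finally show "hbar E u = E u" .
  qed
  show eig: "opl s E = (\<lambda>u. V s * E u)"
  proof
    fix u
    have "opl s E u = V s * K s (C w) u - (\<Sum>z\<in>?Z. m z * (V s * C z u))"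
      unfolding E_def opl_diff_sum opl_K[OF s is_klD(1)[OF c]]
      by (intro arg_cong2[of _ _ _ _ "(-)"] HOL.refl sum.cong) (use Cs belowD in auto)
    thus "opl s E u = V s * E u"
      unfolding E_def right_diff_distrib sum_distrib_left by (simp add: mult.left_commute)
  qed
  have C0: "C w z = 0" if "z \<noteq> w" "\<not> bless z w" for z using is_klD(5)[OF c] that by blast
  have Cy0: "C y z = 0" if "z \<noteq> y" "\<not> bless z y" "y \<in> ?Z" for z y
    using is_klD(5)[OF kly] that by blast
  \<comment> \<open>At a descent, \<open>q s\<close> from \<open>opl\<close> and
    \<open>v_s^-1\<close> from \<open>K\<close> add up to \<open>v_s\<close>.\<close>
  have Eat: "E u = C w (s \<otimes> u) + (if len (s \<otimes> u) < len u then V s * C w u else Vi s * C w u) -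
      (\<Sum>y\<in>?Z. m y * C y u)" if "u \<in> carrier W" for u
    using that by (simp add: E_def K_def opl_def algebra_simps)
  have Etop: "E (s \<otimes> w) = 1"
  proof -
    have "C w (s \<otimes> w) = 0" using C0[of "s \<otimes> w"] up bless_len[of "s \<otimes> w" w] by force
    moreover have "C y (s \<otimes> w) = 0" if "y \<in> ?Z" for y
      using Cy0[OF _ _ that, of "s \<otimes> w"] up bless_len[of "s \<otimes> w" y] bless_len[OF belowD(1)[OF that]] by force
    ultimately show ?thesis using Eat[of "s \<otimes> w"] s w is_klD(3)[OF c] by simp
  qed
  have Esupp: "bless z (s \<otimes> w)" if z: "z \<noteq> s \<otimes> w" "E z \<noteq> 0" for z
  proof (rule ccontr)
    assume nb: "\<not> bless z (s \<otimes> w)"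
    have zc: "z \<in> carrier W" using z suppE by (auto simp: supported_def)
    have ws: "bless w (s \<otimes> w)" using bless_S s w up by blast
    hence nw: "z \<noteq> w" "\<not> bless z w" using nb bless_trans by blast+
    have "C w z = 0" using C0 nw by blast
    \<comment> \<open>The shifted term vanishes because \<open>sz < w\<close> would lift to
      \<open>z < sw\<close>.\<close>
    moreover have "C w (s \<otimes> z) = 0"
    proof (rule C0)
      show "s \<otimes> z \<noteq> w" using z(1) s zc by auto
      show "\<not> bless (s \<otimes> z) w" using bless_lift_up[of "s \<otimes> z" w s] nb s zc up by auto
    qed
    moreover have "C y z = 0" if "y \<in> ?Z" for y
      using Cy0[OF _ _ that, of z] belowD(1)[OF that] nw bless_trans by blast
    ultimately show False using Eat[OF zc] z(2) by (simp split: if_splits)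
  qed
  have Edesc: "neg (E z)" if z: "z \<in> carrier W" "len (s \<otimes> z) < len z" "z \<noteq> s \<otimes> w" for z
  proof -
    have "s \<otimes> z \<noteq> w" using z s by auto
    hence "neg (C w (s \<otimes> z))" using is_klD(4)[OF c] by blast
    moreover have "neg (V s * C w z - (\<Sum>y\<in>?Z. m y * C y z))"
    proof (cases "z \<in> ?Z")
      case True
      \<comment> \<open>Elements \<open>y\<close> other than \<open>z\<close> that are no longer
        than \<open>z\<close> have coefficient 0 at \<open>z\<close>, while \<open>y = z\<close>
        itself contributes \<open>m z\<close>.\<close>
      have "(\<Sum>y\<in>?Z - {z}. m y * C y z) = (\<Sum>y | y \<in> ?Z \<and> len z < len y. m y * C y z)"
      proof (rule sum.mono_neutral_right)
        show "\<forall>y\<in>?Z - {z} - {y. y \<in> ?Z \<and> len z < len y}. m y * C y z = 0"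
          using Cy0[of z] bless_len[of z] by (metis (no_types, lifting) Diff_iff insertI1 mem_Collect_eq mult_zero_right)
      qed auto
      hence "(\<Sum>y\<in>?Z. m y * C y z) = m z + (\<Sum>y | y \<in> ?Z \<and> len z < len y. m y * C y z)"
        using sum.remove[OF finite_below True, of "\<lambda>y. m y * C y z"] is_klD(3)[OF kly[OF True]] by simp
      moreover have "m z = symm (V s * C w z - (\<Sum>y | y \<in> ?Z \<and> len z < len y. m y * C y z))"
        using m True by (simp add: M_solution_def)
      ultimately show ?thesis
        using neg_diff_symm[of "V s * C w z - (\<Sum>y | y \<in> ?Z \<and> len z < len y. m y * C y z)"]
        by (simp add: algebra_simps)
    next
      case False
      hence nb: "\<not> bless z w" using z s up by (simp add: below_def M_triple_iff)
      moreover have "z \<noteq> w" using z up by auto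
      ultimately have "C w z = 0" using C0 by blast
      moreover have "C y z = 0" if "y \<in> ?Z" for y
        using Cy0[OF _ _ that, of z] belowD(1)[OF that] nb bless_trans False that by blast
      ultimately show ?thesis by simp
    qed
    moreover have "E z = C w (s \<otimes> z) + (V s * C w z - (\<Sum>y\<in>?Z. m y * C y z))"
      using Eat[OF z(1)] z(2) by simp
    ultimately show ?thesis by (simp add: neg_add)
  qed
  have Easc: "neg (E z)" if z: "z \<in> carrier W" "\<not> len (s \<otimes> z) < len z" for z
  proof -
    have lt: "len z < len (s \<otimes> z)" using S_len_cases[OF s z(1)] z(2) by linarith
    \<comment> \<open>Comparing coefficients of the eigenvector equation at \<open>sz\<close>
      expresses the value at the ascent \<open>z\<close> as \<open>v_s^-1\<close> times the value at
      \<open>sz\<close>, which is negative or 1.\<close>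
    have "opl s E (s \<otimes> z) = V s * E (s \<otimes> z)" using eig by simp
    hence "E z = Vi s * E (s \<otimes> z)"
      using lt s z by (simp add: opl_def algebra_simps)
    moreover have "neg (Vi s * E (s \<otimes> z))"
      using Edesc[of "s \<otimes> z"] neg_Vi[OF s] Etop lt s z by (cases "s \<otimes> z = s \<otimes> w") auto
    ultimately show ?thesis by simp
  qed
  have "neg (E z)" if "z \<noteq> s \<otimes> w" for z
    using Edesc[of z] Easc[of z] suppE that by (cases "z \<in> carrier W") (auto simp: supported_def)
  thus "is_kl (s \<otimes> w) E" using suppE barE Etop Esupp by (simp add: is_kl_def)
qed

lemma ex_M_solution: "\<exists>m. M_solution s w m"
  unfolding M_solution_def using ex_triangular_solution[OF finite_below] .

text \<open>Every descent of \<open>w\<close> yields a Kazhdan--Lusztig element, and uniqueness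
  identifies them all. The eigenvector equation therefore holds for every descent of
  \<open>w\<close>, as the correction terms of later steps require.\<close>

lemma is_kl_C_eigenvector:
  assumes "w \<in> carrier W"
  shows "is_kl w (C w) \<and> (\<forall>s\<in>S. len (s \<otimes> w) < len w \<longrightarrow> opl s (C w) = (\<lambda>u. V s * C w u))"
  using assms
proof (induction "len w" arbitrary: w rule: less_induct)
  case less
  have E: "is_kl w (C w) \<and> opl s (C w) = (\<lambda>u. V s * C w u)" if s: "s \<in> S" "len (s \<otimes> w) < len w" for s
  proof -
    define x where "x = s \<otimes> w"
    have x: "x \<in> carrier W" "len x < len (s \<otimes> x)" "s \<otimes> x = w" "len x < len w"
      using s less.prems by (auto simp: x_def)
    obtain m where m: "M_solution s x m" using ex_M_solution by blast
    define E where "E = (\<lambda>u. K s (C x) u - (\<Sum>z\<in>below s x. m z * C z u))"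
    have IH: "is_kl z (C z)" "len (s \<otimes> z) < len z \<Longrightarrow> opl s (C z) = (\<lambda>u. V s * C z u)" if "bless z x" for z
      using less.hyps[of z] bless_len[OF that] bless_carrier[OF that] x s(1) by auto
    have "is_kl x (C x)" using less.hyps[of x] x by blast
    from kl_step[OF s(1) x(1,2) this IH m] have E: "is_kl w E" "opl s E = (\<lambda>u. V s * E u)"
      unfolding E_def x(3) by auto
    show ?thesis unfolding C_eqI[OF E(1)] by (intro conjI E)
  qed
  show ?case
  proof (cases "w = \<one>")
    case True
    thus ?thesis using is_kl_one C_eqI[OF is_kl_one] by simp
  next
    case False
    thus ?thesis using ex_descent[OF less.prems False] E by blast
  qed
qed

lemma is_kl_C: "w \<in> carrier W \<Longrightarrow> is_kl w (C w)"
  using is_kl_C_eigenvector by blast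

lemma C_S_mult:
  assumes "s \<in> S" "w \<in> carrier W" "len w < len (s \<otimes> w)" "M_solution s w m"
  shows "C (s \<otimes> w) u = K s (C w) u - (\<Sum>z\<in>below s w. m z * C z u)"
  by (subst C_eqI[OF kl_step(1)[OF assms(1-3) _ _ _ assms(4)]])
    (use is_kl_C_eigenvector assms bless_carrier in \<open>auto simp: is_kl_C\<close>)

text \<open>Unitriangularity, tested at a longest index with nonzero coefficient. It pins down the
  family \<open>M^s_(z,w)\<close>.\<close>

lemma C_independent:
  assumes "\<And>u. (\<Sum>z\<in>below s w. d z * C z u) = 0" "z \<in> below s w"
  shows "d z = 0"
proof (rule ccontr)
  assume z: "d z \<noteq> 0"
  define A where "A = {u \<in> below s w. d u \<noteq> 0}"
  have "finite A" "z \<in> A" using z assms(2) by (auto simp: A_def)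
  then obtain x where x: "x \<in> A" "\<And>y. y \<in> A \<Longrightarrow> len y \<le> len x"
    using finite_ex_max[of A z len] by blast
  have "d y * C y x = (if y = x then d x else 0)" if "y \<in> below s w" for y
  proof (cases "y = x")
    case False
    have kl: "is_kl y (C y)" using that belowD is_kl_C by blast
    show ?thesis
    proof (cases "d y = 0")
      case d: False
      hence "\<not> bless x y" using bless_len[of x y] x(2)[of y] that by (auto simp: A_def)
      hence "C y x = 0" using is_klD(5)[OF kl, of x] False by blast
      thus ?thesis using False by simp
    qed (use False in simp)
  next
    case True
    thus ?thesis using is_klD(3)[OF is_kl_C] belowD that by simp
  qed
  hence "(\<Sum>y\<in>below s w. d y * C y x) = d x" using x by (simp add: A_def cong: sum.cong)
  thus False using assms(1) x by (simp add: A_def)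
qed

subsection \<open>Degree bounds\<close>

text \<open>For \<open>n < 0\<close> this means \<open>f = 0\<close>, so a bound with negative
  right-hand side records vanishing.\<close>

definition bounded_by :: "('g \<Rightarrow> int) \<Rightarrow> int \<Rightarrow> ('g \<Rightarrow>\<^sub>0 int) \<Rightarrow> bool" where
  "bounded_by \<phi> n f \<longleftrightarrow> (\<forall>k\<in>Poly_Mapping.keys f. \<bar>\<phi> k\<bar> \<le> n)"

lemma bounded_by_zero [simp]: "bounded_by \<phi> n 0"
  by (simp add: bounded_by_def)

lemma bounded_by_mono: "bounded_by \<phi> m f \<Longrightarrow> m \<le> n \<Longrightarrow> bounded_by \<phi> n f"
  by (force simp: bounded_by_def)

lemma bounded_by_add: "bounded_by \<phi> n f \<Longrightarrow> bounded_by \<phi> n g \<Longrightarrow> bounded_by \<phi> n (f + g)"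
  unfolding bounded_by_def using Poly_Mapping.keys_add[of f g] by blast

lemma bounded_by_diff: "bounded_by \<phi> n f \<Longrightarrow> bounded_by \<phi> n g \<Longrightarrow> bounded_by \<phi> n (f - g)"
  unfolding bounded_by_def by (force simp: in_keys_iff lookup_minus)

lemma bounded_by_sum: "(\<And>i. i \<in> I \<Longrightarrow> bounded_by \<phi> n (f i)) \<Longrightarrow> bounded_by \<phi> n (\<Sum>i\<in>I. f i)"
  by (induction I rule: infinite_finite_induct) (auto intro: bounded_by_add)

text \<open>In the application \<open>\<phi>\<close> reads off the exponent of one parameter and
  \<open>L\<close> counts the matching letters, so \<open>L\<close> has to be allowed the value 0 on
  generators.\<close>

context
  fixes \<phi> :: "'g \<Rightarrow> int" and L :: "'w \<Rightarrow> int"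
  assumes \<phi>_add: "\<And>a b. \<phi> (a + b) = \<phi> a + \<phi> b"
    and L: "weight_function W S L"
    and \<phi>_v: "\<And>s. s \<in> S \<Longrightarrow> \<phi> (v s) = L s"
    and L_nonneg: "\<And>s. s \<in> S \<Longrightarrow> 0 \<le> L s"
begin

lemma \<phi>_zero: "\<phi> 0 = 0"
  using \<phi>_add[of 0 0] by simp

lemma \<phi>_uminus: "\<phi> (- a) = - \<phi> a"
  using \<phi>_add[of a "- a"] \<phi>_zero by simp

lemma bounded_by_mult: "bounded_by \<phi> m f \<Longrightarrow> bounded_by \<phi> n g \<Longrightarrow> bounded_by \<phi> (m + n) (f * g)"
  unfolding bounded_by_def using keys_mult[of f g] by (force simp: \<phi>_add)

lemma bounded_by_symm: "bounded_by \<phi> n f \<Longrightarrow> bounded_by \<phi> n (symm f)"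
  unfolding bounded_by_def using keys_symm[of f] \<phi>_uminus by (metis Un_iff abs_minus_cancel subsetD vimageE)

lemma bounded_by_V:
  assumes "s \<in> S"
  shows "bounded_by \<phi> (L s) (V s)" "bounded_by \<phi> (L s) (Vi s)"
  using \<phi>_v[OF assms] L_nonneg[OF assms] by (auto simp: bounded_by_def \<phi>_uminus)

text \<open>The bounds telescope: \<open>m y\<close> contributes \<open>L (sw) - L y\<close> and
  \<open>C y z\<close> contributes \<open>L y - L z\<close>. Symmetrizing only negates exponents,
  which keeps absolute values.\<close>

lemma M_solution_bounded:
  assumes s: "s \<in> S" and w: "w \<in> carrier W" and up: "len w < len (s \<otimes> w)"
    and m: "M_solution s w m"
    and C: "\<And>y z. y = w \<or> bless y w \<Longrightarrow> z \<in> carrier W \<Longrightarrow> bounded_by \<phi> (L y - L z) (C y z)"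
    and z: "z \<in> below s w"
  shows "bounded_by \<phi> (L (s \<otimes> w) - L z) (m z)"
  using z
proof (induction "len w - len z" arbitrary: z rule: less_induct)
  case less
  have zc: "z \<in> carrier W" using less.prems belowD by blast
  have "bounded_by \<phi> (L s + (L w - L z)) (V s * C w z)"
    by (intro bounded_by_mult bounded_by_V s C) (use zc in auto)
  moreover have "bounded_by \<phi> (L (s \<otimes> w) - L z) (m y * C y z)" if "y \<in> below s w" "len z < len y" for y
  proof -
    have yw: "bless y w" using that belowD by blast
    have "bounded_by \<phi> (L (s \<otimes> w) - L y) (m y)"
      using that less.prems bless_len[OF yw] by (intro less.hyps) auto
    from bounded_by_mult[OF this C[of y z]] show ?thesis using zc yw by simp
  qed
  moreover have "L (s \<otimes> w) = L s + L w" using weight_function_S_mult[OF L s w up] .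
  ultimately have "bounded_by \<phi> (L (s \<otimes> w) - L z)
      (symm (V s * C w z - (\<Sum>y | y \<in> below s w \<and> len z < len y. m y * C y z)))"
    by (intro bounded_by_symm bounded_by_diff bounded_by_sum) (auto simp: algebra_simps)
  thus ?case using m less.prems by (simp add: M_solution_def)
qed

lemma C_bounded:
  assumes "w \<in> carrier W" "z \<in> carrier W"
  shows "bounded_by \<phi> (L w - L z) (C w z)"
  using assms
proof (induction "len w" arbitrary: w z rule: less_induct)
  case less
  show ?case
  proof (cases "w = \<one>")
    case True
    thus ?thesis
      using C_eqI[OF is_kl_one] by (auto simp: delta_def bounded_by_def \<phi>_zero)
  next
    case False
    then obtain s where s: "s \<in> S" "len (s \<otimes> w) < len w" using ex_descent less.prems by blast
    define x where "x = s \<otimes> w"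
    have x: "x \<in> carrier W" "len x < len (s \<otimes> x)" "s \<otimes> x = w" "len x < len w"
      using s less.prems by (auto simp: x_def)
    obtain m where m: "M_solution s x m" using ex_M_solution by blast
    have Lw: "L w = L s + L x" using weight_function_S_mult[OF L s(1) x(1,2)] x(3) by simp
    have IH: "bounded_by \<phi> (L y - L u) (C y u)" if "y = x \<or> bless y x" "u \<in> carrier W" for y u
      using that x bless_len[of y x] bless_carrier[of y x] by (intro less.hyps) auto
    have M: "bounded_by \<phi> (L w - L y) (m y)" if "y \<in> below s x" for y
      using M_solution_bounded[OF s(1) x(1,2) m IH that] x(3) by simp
    have sum: "bounded_by \<phi> (L w - L z) (\<Sum>y\<in>below s x. m y * C y z)"
    proof (rule bounded_by_sum)
      fix y assume y: "y \<in> below s x"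
      from bounded_by_mult[OF M[OF y] IH[of y z]] show "bounded_by \<phi> (L w - L z) (m y * C y z)"
        using belowD[OF y] less.prems by simp
    qed
    have Vz: "bounded_by \<phi> (L s + (L x - L z)) (V s * C x z)" "bounded_by \<phi> (L s + (L x - L z)) (Vi s * C x z)"
      using bounded_by_V[OF s(1)] IH[of x z] less.prems by (auto intro!: bounded_by_mult)
    \<comment> \<open>\<open>L (sz)\<close> and \<open>L z\<close> differ by \<open>L s\<close> in
      one direction or the other, and \<open>L w = L s + L x\<close> leaves room for that.\<close>
    have Csz: "bounded_by \<phi> (L w - L z) (C x (s \<otimes> z))"
    proof (rule bounded_by_mono[OF IH[of x "s \<otimes> z"]])
      show "L x - L (s \<otimes> z) \<le> L w - L z"
        using S_len_cases[OF s(1) less.prems(2)] L_nonneg[OF s(1)]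
          weight_function_S_mult[OF L s(1) less.prems(2)] weight_function_S_mult[OF L s(1), of "s \<otimes> z"]
          less.prems s(1) Lw by fastforce
    qed (use s less.prems in auto)
    have "C w z = C x (s \<otimes> z) + (if len (s \<otimes> z) < len z then V s * C x z else Vi s * C x z) -
        (\<Sum>y\<in>below s x. m y * C y z)"
      using C_S_mult[OF s(1) x(1,2) m, of z] x(3) less.prems by (simp add: K_def opl_def algebra_simps)
    also have "bounded_by \<phi> (L w - L z) \<dots>"
      by (intro bounded_by_add bounded_by_diff Csz sum) (use Vz Lw in \<open>simp add: add_diff_eq\<close>)
    finally show ?thesis .
  qed
qed

end

end

section \<open>Comparison with the definitions\<close>

definition add_group :: "'g::ab_group_add set \<Rightarrow> 'g monoid" where
  "add_group H = \<lparr>carrier = H, monoid.mult = (+), one = 0\<rparr>"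

lemma add_group_simps [simp]:
  "carrier (add_group H) = H" "a \<otimes>\<^bsub>add_group H\<^esub> b = a + b" "\<one>\<^bsub>add_group H\<^esub> = 0"
  by (simp_all add: add_group_def)

lemma comm_group_add_group:
  assumes "0 \<in> H" "\<And>a b. a \<in> H \<Longrightarrow> b \<in> H \<Longrightarrow> a + b \<in> H" "\<And>a. a \<in> H \<Longrightarrow> - a \<in> H"
  shows "comm_group (add_group H)"
  by (rule comm_groupI) (use assms in \<open>auto simp: add_ac intro!: bexI[of _ "- _"]\<close>)

lemma inv_add_group:
  assumes "0 \<in> H" "\<And>a b. a \<in> H \<Longrightarrow> b \<in> H \<Longrightarrow> a + b \<in> H" "\<And>a. a \<in> H \<Longrightarrow> - a \<in> H" "a \<in> H"
  shows "inv\<^bsub>add_group H\<^esub> a = - a"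
proof -
  interpret comm_group "add_group H" using assms comm_group_add_group by blast
  show ?thesis by (rule inv_equality) (use assms in auto)
qed

lemma inv_add_group_UNIV [simp]: "inv\<^bsub>add_group UNIV\<^esub> a = - a"
  by (rule inv_add_group) auto

lemma group_ring_add_group [simp]:
  "f \<otimes>\<^bsub>group_ring (add_group H)\<^esub> g = f * g" "\<one>\<^bsub>group_ring (add_group H)\<^esub> = 1"
  "f \<oplus>\<^bsub>group_ring (add_group H)\<^esub> g = f + g" "carrier (group_ring (add_group H)) = {f. Poly_Mapping.keys f \<subseteq> H}"
  by (simp_all add: group_ring_def poly_mapping_mult_eq[of f g])

lemma laurent_ring_eq: "laurent_ring = group_ring (add_group UNIV)"
  by (simp add: laurent_ring_def add_group_def integer_group_def)

lemma total_order_add_group: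
  assumes "0 \<in> H" "\<And>a b. a \<in> H \<Longrightarrow> b \<in> H \<Longrightarrow> a + b \<in> H" "\<And>a. a \<in> H \<Longrightarrow> - a \<in> H"
    and "P \<subseteq> H" "\<And>a b. a \<in> P \<Longrightarrow> b \<in> P \<Longrightarrow> a + b \<in> P" "0 \<notin> P"
    and "\<And>a. a \<in> H \<Longrightarrow> a \<in> P \<or> a = 0 \<or> - a \<in> P"
  shows "total_order_on_group (add_group H) P"
proof -
  have inv: "m_inv (add_group H) ` P = uminus ` P"
    using inv_add_group[OF assms(1-3)] assms(4) by (intro image_cong) auto
  have "P \<inter> uminus ` P = {}"
    using assms(5,6) by force
  moreover have "H = P \<union> {0} \<union> uminus ` P"
  proof
    show "H \<subseteq> P \<union> {0} \<union> uminus ` P"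
      using assms(7) by (metis UnCI image_eqI insertI1 minus_minus subsetI)
  qed (use assms in auto)
  moreover have "0 \<notin> uminus ` P" using assms(6) by auto
  ultimately show ?thesis
    unfolding total_order_on_group_def inv
    using assms comm_group_add_group[OF assms(1-3)] by auto
qed

lemma push_ring_hom:
  assumes "\<And>a b. \<phi> (a + b) = \<phi> a + \<phi> b"
  shows "push \<phi> \<in> ring_hom (group_ring (add_group H)) laurent_ring"
proof -
  have "\<phi> 0 = 0" using assms[of 0 0] by simp
  hence "push \<phi> 1 = 1" using push_single[of \<phi> 0 1] by simp
  thus ?thesis
    unfolding laurent_ring_eq by (intro ring_hom_memI) (simp_all add: push_mult[OF assms] push_add)
qed

text \<open>An additive map on exponents induces a ring homomorphism of group rings, so an
  integer-valued linear form is enough to give a specialization.\<close>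

lemma specializes_to_push:
  fixes \<phi> :: "'g::ab_group_add \<Rightarrow> int"
  assumes "\<And>a b. \<phi> (a + b) = \<phi> a + \<phi> b" "\<And>s. s \<in> S \<Longrightarrow> \<phi> (v s) = L s"
    and "\<And>\<gamma>. \<gamma> \<in> Gamma_plus_W W S (add_group H) P v \<Longrightarrow> \<phi> \<gamma> > 0"
  shows "specializes_to W S (add_group H) P v L"
  unfolding specializes_to_def v_pow_def
proof (rule bexI[OF _ push_ring_hom[OF assms(1)]], intro conjI ballI)
  fix \<gamma> assume "\<gamma> \<in> Gamma_plus_W W S (add_group H) P v"
  thus "\<exists>n>0. push \<phi> (Poly_Mapping.single \<gamma> 1) = Poly_Mapping.single n 1"
    using assms(3) by (intro exI[of _ "\<phi> \<gamma>"]) simp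
qed (simp add: assms(2))

lemma Gamma_plus_W_subset: "Gamma_plus_W W S G P v \<subseteq> P"
  by (auto simp: Gamma_plus_W_def Gamma_plus_a_def Gamma_plus_b_def)

lemma equivalent_weightsI:
  fixes G :: "universe monoid"
  assumes "Gamma_equivalent W S G P v L L'"
  shows "equivalent_weights W S L L'"
proof -
  define \<Lambda> where "\<Lambda> i = (if i = 0 then L else L')" for i :: nat
  have "\<Lambda> 0 = L \<and> \<Lambda> 1 = L' \<and> (\<forall>i\<in>{1..1}. Gamma_equivalent W S G P v (\<Lambda> (i - 1)) (\<Lambda> i))"
    using assms by (simp add: \<Lambda>_def)
  thus ?thesis
    unfolding equivalent_weights_def
    by (intro disjI2 exI[where x = "1::nat"] exI[where x = \<Lambda>] exI[where x = "\<lambda>_. G"]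
        exI[where x = "\<lambda>_. P"] exI[where x = "\<lambda>_. v"])
qed

section \<open>The defined Hecke algebra in terms of coefficient functions\<close>

context kl_data
begin

abbreviation G :: "'g monoid" where "G \<equiv> add_group UNIV"
abbreviation H :: "('g \<Rightarrow>\<^sub>0 int, 'w \<Rightarrow>\<^sub>0 'g \<Rightarrow>\<^sub>0 int) module" where "H \<equiv> hecke_algebra W S G v"
abbreviation lk :: "('w \<Rightarrow>\<^sub>0 'g \<Rightarrow>\<^sub>0 int) \<Rightarrow> 'w \<Rightarrow> 'g \<Rightarrow>\<^sub>0 int" where "lk \<equiv> Poly_Mapping.lookup"

lemma lookup_sum_keys:
  fixes h :: "'w \<Rightarrow>\<^sub>0 'g \<Rightarrow>\<^sub>0 int"
  assumes "supported (lk h)" "\<And>w. F w 0 = 0"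
  shows "(\<Sum>w\<in>Poly_Mapping.keys h. F w (lk h w)) = (\<Sum>w\<in>carrier W. F w (lk h w))"
  using assms by (intro sum.mono_neutral_left finite_carrier) (auto simp: supported_def in_keys_iff)

lemma lookup_smult [simp]: "lk (hecke_smult G c h) w = c * lk h w"
  unfolding hecke_smult_def by (auto simp: lookup_sum lookup_single when_def in_keys_iff)

lemma lookup_T: "lk (hecke_T G w) = delta w"
  by (auto simp: hecke_T_def delta_def lookup_single when_def fun_eq_iff)

lemma carrier_H: "h \<in> carrier H \<longleftrightarrow> supported (lk h)"
  by (auto simp: hecke_algebra_def supported_def in_keys_iff)

definition pm :: "('w \<Rightarrow> 'g \<Rightarrow>\<^sub>0 int) \<Rightarrow> ('w \<Rightarrow>\<^sub>0 'g \<Rightarrow>\<^sub>0 int)" where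
  "pm = Abs_poly_mapping"

lemma lookup_pm:
  assumes "supported f"
  shows "lk (pm f) = f"
proof -
  have "finite {w. f w \<noteq> 0}"
    by (rule finite_subset[OF _ finite_carrier]) (use assms in \<open>auto simp: supported_def\<close>)
  thus ?thesis by (simp add: pm_def)
qed

lemma lookup_gen_T:
  assumes "s \<in> S" "w \<in> carrier W"
  shows "lk (hecke_gen_T W S G v s w) = opl s (delta w)"
proof
  fix u
  show "lk (hecke_gen_T W S G v s w) u = opl s (delta w) u"
  proof (cases "len w < len (s \<otimes> w)")
    case True
    thus ?thesis using assms by (simp add: hecke_gen_T_def lookup_T opl_delta)
  next
    case False
    hence "len (s \<otimes> w) < len w" using S_len_cases[OF assms] by linarith
    moreover have "s \<otimes> u = w \<longleftrightarrow> u = s \<otimes> w" if "u \<in> carrier W" using assms that by auto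
    ultimately show ?thesis using False assms
      by (auto simp: hecke_gen_T_def lookup_add lookup_T lookup_single when_def opl_def delta_def)
  qed
qed

lemma lookup_gen_mult:
  assumes "s \<in> S" "supported (lk h)"
  shows "lk (hecke_gen_mult W S G v s h) = opl s (lk h)"
proof
  fix u
  have "lk (hecke_gen_mult W S G v s h) u =
      (\<Sum>w\<in>carrier W. lk h w * lk (hecke_gen_T W S G v s w) u)"
    unfolding hecke_gen_mult_def lookup_sum lookup_smult
    using lookup_sum_keys[OF assms(2), of "\<lambda>w c. c * lk (hecke_gen_T W S G v s w) u"] by simp
  also have "\<dots> = (\<Sum>w\<in>carrier W. lk h w * opl s (delta w) u)"
    using lookup_gen_T[OF assms(1)] by simp
  also have "\<dots> = opl s (lk h) u"
    using equivariant_expansion[OF equivariant_opl assms(2)] assms(1) by simp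
  finally show "lk (hecke_gen_mult W S G v s h) u = opl s (lk h) u" .
qed

lemma lookup_foldr_gen_mult:
  assumes "set xs \<subseteq> S" "supported (lk h)"
  shows "lk (foldr (hecke_gen_mult W S G v) xs h) = foldr opl xs (lk h)"
  using assms(1)
proof (induction xs)
  case (Cons s xs)
  have "supported (foldr opl xs (lk h))"
    using equivariantD(1)[OF equivariant_words(1) assms(2)] Cons.prems by simp
  thus ?case using Cons by (simp add: lookup_gen_mult)
qed simp

lemma lookup_mult:
  assumes "supported (lk h)" "supported (lk k)"
  shows "lk (h \<otimes>\<^bsub>H\<^esub> k) = star (lk h) (lk k)"
proof
  fix u
  have "lk (h \<otimes>\<^bsub>H\<^esub> k) u = (\<Sum>w\<in>Poly_Mapping.keys h. lk h w *
      lk (foldr (hecke_gen_mult W S G v) (reduced_word W S w) k) u)"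
    by (simp add: hecke_algebra_def lookup_sum)
  also have "\<dots> = (\<Sum>w\<in>carrier W. lk h w * lk (foldr (hecke_gen_mult W S G v) (reduced_word W S w) k) u)"
    by (rule lookup_sum_keys[OF assms(1)]) simp
  also have "\<dots> = star (lk h) (lk k) u"
    unfolding star_def lmult_def
    by (intro sum.cong HOL.refl) (simp add: lookup_foldr_gen_mult reduced_word assms(2))
  finally show "lk (h \<otimes>\<^bsub>H\<^esub> k) u = star (lk h) (lk k) u" .
qed

text \<open>\<open>m_inv\<close> is a definite description, so uniqueness of two-sided inverses has
  to be supplied; it comes from associativity of \<open>star\<close>.\<close>

lemma lookup_inv_T:
  assumes "w \<in> carrier W"
  shows "lk (inv\<^bsub>H\<^esub> (hecke_T G (inv w))) = T_inv w"
proof -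
  have one: "lk \<one>\<^bsub>H\<^esub> = delta \<one>" by (simp add: hecke_algebra_def lookup_T)
  have T: "supported (lk (hecke_T G (inv w)))" using assms by (simp add: lookup_T)
  have inv: "y \<in> carrier H \<and> hecke_T G (inv w) \<otimes>\<^bsub>H\<^esub> y = \<one>\<^bsub>H\<^esub> \<and> y \<otimes>\<^bsub>H\<^esub> hecke_T G (inv w) = \<one>\<^bsub>H\<^esub> \<longleftrightarrow>
      supported (lk y) \<and> star (delta (inv w)) (lk y) = delta \<one> \<and> star (lk y) (delta (inv w)) = delta \<one>" for y
    using T by (auto simp: carrier_H poly_mapping_eq_iff lookup_mult one lookup_T)
  have "inv\<^bsub>H\<^esub> (hecke_T G (inv w)) = pm (T_inv w)"
    unfolding m_inv_def[of H] inv
  proof (rule the_equality)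
    show "supported (lk (pm (T_inv w))) \<and> star (delta (inv w)) (lk (pm (T_inv w))) = delta \<one> \<and>
        star (lk (pm (T_inv w))) (delta (inv w)) = delta \<one>"
      using T_inv[OF assms] by (simp add: lookup_pm)
    fix y assume "supported (lk y) \<and> star (delta (inv w)) (lk y) = delta \<one> \<and> star (lk y) (delta (inv w)) = delta \<one>"
    hence "lk y = T_inv w"
      using inverse_unique[of "delta (inv w)" "lk y" "T_inv w"] T_inv[OF assms] assms by simp
    thus "y = pm (T_inv w)" using T_inv(1)[OF assms] by (simp add: poly_mapping_eq_iff lookup_pm)
  qed
  thus ?thesis using T_inv(1)[OF assms] by (simp add: lookup_pm)
qed

lemma group_ring_bar_eq: "group_ring_bar G f = gbar f"
  by (simp add: group_ring_bar_def gbar_def push_def)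

lemma lookup_bar:
  assumes "supported (lk h)"
  shows "lk (hecke_bar W S G v h) = hbar (lk h)"
proof
  fix u
  have "lk (hecke_bar W S G v h) u = (\<Sum>w\<in>Poly_Mapping.keys h. gbar (lk h w) * lk (inv\<^bsub>H\<^esub> (hecke_T G (inv w))) u)"
    by (simp add: hecke_bar_def lookup_sum group_ring_bar_eq)
  also have "\<dots> = (\<Sum>w\<in>carrier W. gbar (lk h w) * lk (inv\<^bsub>H\<^esub> (hecke_T G (inv w))) u)"
    by (rule lookup_sum_keys[OF assms]) simp
  also have "\<dots> = hbar (lk h) u"
    unfolding hbar_def by (intro sum.cong HOL.refl) (simp add: lookup_inv_T)
  finally show "lk (hecke_bar W S G v h) u = hbar (lk h) u" .
qed

lemma neg_span_eq: "f \<in> neg_span G P \<longleftrightarrow> neg f"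
  unfolding neg_span_def neg_def by (force simp: image_iff)

lemma lookup_C:
  assumes "w \<in> carrier W"
  shows "lk (kl_C W S G P v w) = C w"
proof -
  have char: "(c \<in> carrier H \<and> hecke_bar W S G v c = c \<and> (\<exists>p. (\<forall>z. p z \<in> neg_span G P) \<and>
      c = hecke_T G w + (\<Sum>z | bless z w. Poly_Mapping.single z (p z)))) \<longleftrightarrow> is_kl w (lk c)" for c
  proof -
    have coeff: "c = hecke_T G w + (\<Sum>z | bless z w. Poly_Mapping.single z (p z)) \<longleftrightarrow>
        (\<forall>u. lk c u = of_bool (u = w) + (if bless u w then p u else 0))" for p
      using finite_bless[of w]
      by (auto simp: poly_mapping_eq_iff fun_eq_iff lookup_add lookup_T delta_def lookup_sum lookup_single
          when_def sum.delta)
    show ?thesis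
    proof (intro iffI)
      assume l: "c \<in> carrier H \<and> hecke_bar W S G v c = c \<and> (\<exists>p. (\<forall>z. p z \<in> neg_span G P) \<and>
        c = hecke_T G w + (\<Sum>z | bless z w. Poly_Mapping.single z (p z)))"
      then obtain p where p: "\<And>z. neg (p z)" "\<And>u. lk c u = of_bool (u = w) + (if bless u w then p u else 0)"
        unfolding coeff neg_span_eq by blast
      have "supported (lk c)" "hbar (lk c) = lk c"
        using l lookup_bar[of c] by (auto simp: carrier_H)
      moreover have "lk c w = 1" using p(2)[of w] bless_irrefl by simp
      moreover have "neg (lk c z)" "lk c z \<noteq> 0 \<Longrightarrow> bless z w" if "z \<noteq> w" for z
        using p(2)[of z] p(1)[of z] that by (auto split: if_splits)
      ultimately show "is_kl w (lk c)" unfolding is_kl_def by blast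
    next
      assume r: "is_kl w (lk c)"
      have "hecke_bar W S G v c = c"
        unfolding poly_mapping_eq_iff lookup_bar[OF is_klD(1)[OF r]] by (rule is_klD(2)[OF r])
      moreover have "\<exists>p. (\<forall>z. p z \<in> neg_span G P) \<and> c = hecke_T G w + (\<Sum>z | bless z w. Poly_Mapping.single z (p z))"
        unfolding coeff neg_span_eq
      \<comment> \<open>The family is cut off outside the elements below \<open>w\<close>, since the
        coefficient 1 at \<open>w\<close> itself is not negative.\<close>
      proof (intro exI[of _ "\<lambda>z. if bless z w then lk c z else 0"] conjI allI)
        show "neg (if bless z w then lk c z else 0)" for z
          using is_klD(4)[OF r, of z] bless_irrefl by auto
        show "lk c u = of_bool (u = w) + (if bless u w then if bless u w then lk c u else 0 else 0)" for u
          using is_klD(3)[OF r] is_klD(5)[OF r, of u] bless_irrefl by (cases "u = w") auto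
      qed
      ultimately show "c \<in> carrier H \<and> hecke_bar W S G v c = c \<and> (\<exists>p. (\<forall>z. p z \<in> neg_span G P) \<and>
        c = hecke_T G w + (\<Sum>z | bless z w. Poly_Mapping.single z (p z)))"
        using is_klD(1)[OF r] by (simp add: carrier_H)
    qed
  qed
  have supp: "supported (C w)" using is_klD(1)[OF is_kl_C[OF assms]] .
  have "kl_C W S G P v w = pm (C w)"
    unfolding kl_C_def char
  proof (rule the_equality)
    show "is_kl w (lk (pm (C w)))" using is_kl_C[OF assms] by (simp add: lookup_pm[OF supp])
    show "c = pm (C w)" if "is_kl w (lk c)" for c
      unfolding poly_mapping_eq_iff lookup_pm[OF supp] by (rule C_eqI[OF that, symmetric])
  qed
  thus ?thesis using supp by (simp add: lookup_pm)
qed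

text \<open>The defining equation is the recursion for \<open>C (sw)\<close> rearranged, so any
  solution gives the same combination of the \<open>C z\<close>, and independence makes it equal to
  \<open>m\<close>.\<close>

lemma kl_M_solution:
  assumes "s \<in> S" "w \<in> carrier W" "len w < len (s \<otimes> w)"
  obtains m where "M_solution s w m" "kl_M W S G P v s w = (\<lambda>z. if z \<in> below s w then m z else 0)"
proof -
  obtain m where m: "M_solution s w m" using ex_M_solution by blast
  have mult: "lk (hecke_T G s \<otimes>\<^bsub>H\<^esub> kl_C W S G P v w) = opl s (C w)"
    using assms is_klD(1)[OF is_kl_C[OF assms(2)]] by (simp add: lookup_mult lookup_T lookup_C star_S)
  have eq: "hecke_T G s \<otimes>\<^bsub>H\<^esub> kl_C W S G P v w = kl_C W S G P v (s \<otimes> w)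
          - hecke_smult G (Poly_Mapping.single (inv\<^bsub>G\<^esub> (v s)) 1) (kl_C W S G P v w)
          + (\<Sum>z | M_triple W S s z w. hecke_smult G (m' z) (kl_C W S G P v z)) \<longleftrightarrow>
      (\<forall>u. (\<Sum>z\<in>below s w. m' z * C z u) = (\<Sum>z\<in>below s w. m z * C z u))" for m'
  proof -
    have "(\<Sum>z | M_triple W S s z w. lk (hecke_smult G (m' z) (kl_C W S G P v z)) u) =
        (\<Sum>z\<in>below s w. m' z * C z u)" for u
      unfolding below_def[symmetric] by (intro sum.cong HOL.refl) (auto dest: belowD(3) simp: lookup_C)
    thus ?thesis
      using C_S_mult[OF assms m] assms
      by (auto simp: poly_mapping_eq_iff fun_eq_iff mult lookup_add lookup_minus lookup_sum lookup_C K_def algebra_simps)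
  qed
  have "kl_M W S G P v s w = (\<lambda>z. if z \<in> below s w then m z else 0)"
    unfolding kl_M_def eq
  proof (rule the_equality)
    fix m' assume m': "(\<forall>z. m' z \<in> carrier (group_ring G)) \<and> (\<forall>z. \<not> M_triple W S s z w \<longrightarrow> m' z = 0) \<and>
      (\<forall>u. (\<Sum>z\<in>below s w. m' z * C z u) = (\<Sum>z\<in>below s w. m z * C z u))"
    have "m' z - m z = 0" if "z \<in> below s w" for z
      by (rule C_independent[OF _ that, of "\<lambda>z. m' z - m z"])
        (use m' in \<open>simp add: left_diff_distrib sum_subtractf\<close>)
    thus "m' = (\<lambda>z. if z \<in> below s w then m z else 0)" using m' by (auto simp: below_def fun_eq_iff)
  qed (auto simp: below_def)
  thus ?thesis using that m by blast
qed

lemma Gamma_plus_bounded: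
  assumes \<phi>: "\<And>a b. \<phi> (a + b) = \<phi> a + \<phi> b" "\<And>s. s \<in> S \<Longrightarrow> \<phi> (v s) = L s"
    and L: "weight_function W S L" "\<And>s. s \<in> S \<Longrightarrow> 0 \<le> L s"
    and D: "\<And>z w. bless z w \<Longrightarrow> L w - L z \<le> D"
      "\<And>s z w. M_triple W S s z w \<Longrightarrow> 2 * (L (s \<otimes> w) - L z) \<le> D"
    and \<gamma>: "\<gamma> \<in> Gamma_plus_W W S G P v"
  shows "\<bar>\<phi> \<gamma>\<bar> \<le> D"
proof -
  note ctx = \<phi>(1) L(1) \<phi>(2) L(2)
  have \<phi>_uminus: "\<phi> (- a) = - \<phi> a" for a using \<phi>(1)[of a "- a"] \<phi>(1)[of 0 0] by simp
  consider "\<gamma> \<in> Gamma_plus_a W S G P v" | "\<gamma> \<in> Gamma_plus_b W S G P v"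
    using \<gamma> by (auto simp: Gamma_plus_W_def)
  thus ?thesis
  proof cases
    case 1
    then obtain z w where zw: "bless z w" "Poly_Mapping.lookup (C w z) (- \<gamma>) \<noteq> 0"
      unfolding Gamma_plus_a_def kl_P_def using lookup_C bless_carrier by fastforce
    have "bounded_by \<phi> (L w - L z) (C w z)"
      using C_bounded[OF ctx] bless_carrier[OF zw(1)] by blast
    hence "\<bar>\<phi> (- \<gamma>)\<bar> \<le> L w - L z" using zw(2) by (auto simp: bounded_by_def in_keys_iff)
    thus ?thesis using D(1)[OF zw(1)] by (simp add: \<phi>_uminus)
  next
    case 2
    then obtain s z w r n g i where
      t: "M_triple W S s z w" and
      sum: "kl_M W S G P v s w z = (\<Sum>i=1..(r::nat). Poly_Mapping.single (g i) (n i))" and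
      n: "\<And>i. i \<in> {1..r} \<Longrightarrow> n i \<noteq> 0" and
      incr: "\<And>i. i \<in> {2..r} \<Longrightarrow> - g (i - 1) + g i \<in> P" and
      i: "i \<in> {2..r}" "\<gamma> = - g (i - 1) + g i"
      unfolding Gamma_plus_b_def by auto
    have s: "s \<in> S" "w \<in> carrier W" "len w < len (s \<otimes> w)" and z: "z \<in> below s w"
      using t bless_carrier by (auto simp: M_triple_iff below_def)
    have less: "g k - g j \<in> P" if "1 \<le> j" "j < k" "k \<le> r" for j k
      using that(2,1,3)
    proof (induction rule: strict_inc_induct)
      case (base j)
      thus ?case using incr[of k] by auto
    next
      case (step j)
      have "- g j + g (Suc j) \<in> P" using incr[of "Suc j"] step by auto
      moreover have "g k - g (Suc j) \<in> P" using step by simp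
      ultimately have "(- g j + g (Suc j)) + (g k - g (Suc j)) \<in> P" by (rule P_add)
      thus ?case by (simp add: algebra_simps)
    qed
    have inj: "j = k" if "j \<in> {1..r}" "k \<in> {1..r}" "g j = g k" for j k
      using less[of j k] less[of k j] that P_zero by (cases j k rule: linorder_cases) auto
    have keys: "g j \<in> Poly_Mapping.keys (kl_M W S G P v s w z)" if j: "j \<in> {1..r}" for j
    proof -
      have "Poly_Mapping.lookup (kl_M W S G P v s w z) (g j) = (\<Sum>i=1..r. if i = j then n j else 0)"
        unfolding sum lookup_sum using inj j by (intro sum.cong HOL.refl) (auto simp: lookup_single when_def)
      thus ?thesis using j n[OF j] by (simp add: in_keys_iff)
    qed
    obtain m where m: "M_solution s w m" "kl_M W S G P v s w z = m z"
      using kl_M_solution[OF s] z by metis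
    have "bounded_by \<phi> (L (s \<otimes> w) - L z) (m z)"
      using s(2) bless_carrier by (intro M_solution_bounded[OF ctx s m(1) _ z] C_bounded[OF ctx]) blast+
    hence "\<bar>\<phi> (g j)\<bar> \<le> L (s \<otimes> w) - L z" if "j \<in> {1..r}" for j
      using keys[OF that] m(2) by (auto simp: bounded_by_def)
    moreover have "i \<in> {1..r}" "i - 1 \<in> {1..r}" using i(1) by auto
    ultimately have "\<bar>\<phi> (g i)\<bar> \<le> L (s \<otimes> w) - L z" "\<bar>\<phi> (g (i - 1))\<bar> \<le> L (s \<otimes> w) - L z"
      by blast+
    \<comment> \<open>A quotient of two exponents uses up the bound twice, whence the factor 2 in
      the hypothesis on \<open>D\<close>.\<close>
    moreover have "\<bar>\<phi> \<gamma>\<bar> \<le> \<bar>\<phi> (g i)\<bar> + \<bar>\<phi> (g (i - 1))\<bar>"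
      unfolding i(2) \<phi>(1) \<phi>_uminus by simp
    ultimately show ?thesis using D(2)[OF t] by simp
  qed
qed

end

section \<open>Equivalence of weight functions\<close>

lemma total_lexicographic:
  fixes f :: "nat \<Rightarrow> int"
  assumes "f \<noteq> 0"
  shows "(\<exists>n. f n > 0 \<and> (\<forall>i<n. f i = 0)) \<or> (\<exists>n. - f n > 0 \<and> (\<forall>i<n. f i = 0))"
proof -
  have "\<exists>n. f n \<noteq> 0" using assms by (auto simp: fun_eq_iff)
  hence "f (LEAST n. f n \<noteq> 0) \<noteq> 0" by (rule LeastI_ex)
  moreover have "\<forall>i<(LEAST n. f n \<noteq> 0). f i = 0" using not_less_Least by blast
  ultimately show ?thesis by (metis linorder_neqE neg_0_less_iff_less)
qed

text \<open>The group \<open>\<Gamma>\<close> will be the additive group of all sequences, so that its group ring is a ring type;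
  the parameters only involve the first two coordinates.\<close>

definition weighted_pos :: "int \<Rightarrow> int \<Rightarrow> (nat \<Rightarrow> int) set" where
  "weighted_pos a b = {f. a * f 0 + b * f 1 > 0 \<or>
     a * f 0 + b * f 1 = 0 \<and> (\<exists>n. f n > 0 \<and> (\<forall>i<n. f i = 0))}"

lemma weighted_pos_add:
  assumes "f \<in> weighted_pos a b" "g \<in> weighted_pos a b"
  shows "f + g \<in> weighted_pos a b"
proof -
  have "a * (f + g) 0 + b * (f + g) 1 = (a * f 0 + b * f 1) + (a * g 0 + b * g 1)"
    by (simp add: algebra_simps)
  \<comment> \<open>The first nonzero entry of the sum is at the smaller of the two
    positions.\<close>
  moreover have "\<exists>n. (f + g) n > 0 \<and> (\<forall>i<n. (f + g) i = 0)"
    if "f m > 0" "\<forall>i<m. f i = 0" "g n > 0" "\<forall>i<n. g i = 0" for m n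
    using that by (intro exI[of _ "min m n"]) (cases m n rule: linorder_cases; simp)
  ultimately show ?thesis using assms by (auto simp: weighted_pos_def)
qed

lemma weighted_pos_total: "f \<in> weighted_pos a b \<or> f = 0 \<or> - f \<in> weighted_pos a b"
  using total_lexicographic[of f] by (auto simp: weighted_pos_def algebra_simps)

section \<open>Fractions with bounded numerator and denominator\<close>

lemma ratio_setE:
  assumes "q \<in> ratio_set N"
  obtains i j where "0 < i" "i < 2 * int N" "0 < j" "j < 2 * int N" "q = of_int i / of_int j"
proof -
  obtain i j :: int where ij: "q > 0" "i \<noteq> 0" "j \<noteq> 0" "- 2 * int N < i" "i < 2 * int N"
    "- 2 * int N < j" "j < 2 * int N" "q = of_int i / of_int j \<or> q = - (of_int i / of_int j)"
    using assms by (auto simp: ratio_set_def)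
  have "q = \<bar>q\<bar>" using ij(1) by simp
  also have "\<dots> = of_int \<bar>i\<bar> / of_int \<bar>j\<bar>" using ij(8) by (auto simp: abs_divide)
  finally show thesis using that[of "\<bar>i\<bar>" "\<bar>j\<bar>"] ij by auto
qed

text \<open>The witness is the mediant of the two neighbours of \<open>b / a\<close> among the fractions with entries
  below \<open>K\<close>, where \<open>0 / 1\<close> and \<open>1 / 0\<close> serve as extreme neighbours.\<close>

lemma ex_mediant:
  fixes a b K :: int
  assumes pos: "a > 0" "b > 0" and K: "K > 1"
  obtains a' b' where "1 \<le> a'" "a' \<le> 2 * K" "1 \<le> b'" "b' \<le> 2 * K"
    "\<And>i j. \<bar>i\<bar> < K \<Longrightarrow> \<bar>j\<bar> < K \<Longrightarrow> a * i + b * j > 0 \<Longrightarrow> a' * i + b' * j > 0"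
proof -
  \<comment> \<open>A pair \<open>(c, d)\<close> stands for the fraction \<open>d/c\<close>; those
    in \<open>Lo\<close> lie strictly below \<open>b/a\<close>, those in \<open>Hi\<close> strictly
    above.\<close>
  define Lo where "Lo = {(c, d). 1 \<le> c \<and> c < K \<and> 0 \<le> d \<and> d < K \<and> a * d < b * c}"
  define Hi where "Hi = {(c, d). 0 \<le> c \<and> c < K \<and> 1 \<le> d \<and> d < K \<and> b * c < a * d}"
  have fin: "finite Lo" "finite Hi"
    by (rule finite_subset[of _ "{0..K} \<times> {0..K}"]; auto simp: Lo_def Hi_def)+
  have "(1, 0) \<in> Lo" "(0, 1) \<in> Hi" using pos K by (auto simp: Lo_def Hi_def)
  hence "Lo \<noteq> {}" "Hi \<noteq> {}" by auto
  define f :: "int \<times> int \<Rightarrow> rat" where "f p = of_int (snd p) / of_int (fst p)" for p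
  \<comment> \<open>In \<open>Hi\<close> the entry \<open>c\<close> may be 0, so inverses are
    compared: the smallest fraction above \<open>b/a\<close> has the largest inverse.\<close>
  define g :: "int \<times> int \<Rightarrow> rat" where "g p = of_int (fst p) / of_int (snd p)" for p
  have "Max (f ` Lo) \<in> f ` Lo" "Max (g ` Hi) \<in> g ` Hi"
    using fin \<open>Lo \<noteq> {}\<close> \<open>Hi \<noteq> {}\<close> by (simp_all add: Max_in)
  then obtain p r where pr: "p \<in> Lo" "f p = Max (f ` Lo)" "r \<in> Hi" "g r = Max (g ` Hi)" by force
  obtain c d c' d' where cd: "p = (c, d)" "r = (c', d')" by (metis surj_pair)
  have lo: "1 \<le> c" "c < K" "0 \<le> d" "d < K" "a * d < b * c" using pr(1) by (auto simp: cd Lo_def)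
  have hi: "0 \<le> c'" "c' < K" "1 \<le> d'" "d' < K" "b * c' < a * d'" using pr(3) by (auto simp: cd Hi_def)
  have lo_max: "y * c \<le> d * x" if "(x, y) \<in> Lo" for x y
  proof -
    have "f (x, y) \<le> f p" unfolding pr(2) using fin that by (intro Max_ge) auto
    moreover have "x > 0" using that by (auto simp: Lo_def)
    ultimately have "of_int (y * c) \<le> (of_int (d * x) :: rat)" using lo by (simp add: f_def cd divide_simps)
    thus ?thesis by (simp only: of_int_le_iff)
  qed
  have hi_max: "x * d' \<le> c' * y" if "(x, y) \<in> Hi" for x y
  proof -
    have "g (x, y) \<le> g r" unfolding pr(4) using fin that by (intro Max_ge) auto
    moreover have "y > 0" using that by (auto simp: Hi_def)
    ultimately have "of_int (x * d') \<le> (of_int (c' * y) :: rat)" using hi by (simp add: g_def cd divide_simps)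
    thus ?thesis by (simp only: of_int_le_iff)
  qed
  show thesis
  proof (rule that[of "c + c'" "d + d'"])
    fix i j assume ij: "\<bar>i\<bar> < K" "\<bar>j\<bar> < K" "a * i + b * j > 0"
    show "(c + c') * i + (d + d') * j > 0"
    proof (cases "i \<ge> 0 \<and> j \<ge> 0")
      case True
      hence "(c + c') * i \<ge> 0" "(d + d') * j \<ge> 0" using lo hi by auto
      moreover have "i > 0 \<or> j > 0" using True ij(3) by (cases "i = 0"; cases "j = 0") auto
      hence "(c + c') * i > 0 \<or> (d + d') * j > 0" using lo hi by auto
      ultimately show ?thesis by linarith
    next
      case False
      have "i > 0 \<or> j > 0"
      proof (rule ccontr)
        assume "\<not> (i > 0 \<or> j > 0)"
        hence "a * i \<le> 0" "b * j \<le> 0" using pos by (auto simp: mult_le_0_iff)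
        thus False using ij(3) by linarith
      qed
      with False consider "i > 0" "j < 0" | "i < 0" "j > 0" by linarith
      thus ?thesis
      proof cases
        case 1
        \<comment> \<open>The fraction \<open>i/(-j)\<close> exceeds \<open>b/a\<close>, so it is at
          least \<open>d'/c'\<close> and strictly above \<open>d/c\<close>; the sum of the two
          inequalities is strict.\<close>
        hence "(- j, i) \<in> Hi" using ij by (auto simp: Hi_def)
        hence "- j * d' \<le> c' * i" by (rule hi_max)
        moreover have "- j * d < c * i"
        proof -
          have "a * (- j * d) = (a * d) * - j" by simp
          also have "\<dots> < (b * c) * - j" using lo(5) 1 by (intro mult_strict_right_mono) auto
          also have "\<dots> = (b * - j) * c" by simp
          also have "\<dots> \<le> (a * i) * c" using ij(3) lo(1) by (intro mult_right_mono) auto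
          also have "\<dots> = a * (c * i)" by simp
          finally show ?thesis using pos by (simp only: mult_less_cancel_left_pos)
        qed
        ultimately show ?thesis by (simp add: algebra_simps)
      next
        case 2
        hence "(j, - i) \<in> Lo" using ij by (auto simp: Lo_def)
        hence "- i * c \<le> d * j" by (rule lo_max)
        moreover have "- i * c' < d' * j"
        proof -
          have "b * (- i * c') = (b * c') * - i" by simp
          also have "\<dots> < (a * d') * - i" using hi(5) 2 by (intro mult_strict_right_mono) auto
          also have "\<dots> = (a * - i) * d'" by simp
          also have "\<dots> \<le> (b * j) * d'" using ij(3) hi(3) by (intro mult_right_mono) auto
          also have "\<dots> = b * (d' * j)" by simp
          finally show ?thesis using pos by (simp only: mult_less_cancel_left_pos)
        qed
        ultimately show ?thesis by (simp add: algebra_simps)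
      qed
    qed
  qed (use lo hi in auto)
qed

lemma (in coxeter) weight_function_zero: "weight_function W S (\<lambda>w\<in>carrier W. 0)"
  by (simp add: weight_function_def)

text \<open>For the second bound: if \<open>s\<close> has weight 1, it also counts in
  \<open>z\<close>, because \<open>sz < z\<close>; if it has weight 0, then
  \<open>L (sw) = L w\<close>, and \<open>w\<close> is shorter than \<open>sw\<close>. Either way
  the difference is less than \<open>N\<close>.\<close>

lemma (in coxeter) indicator_weight_bounds:
  assumes L: "weight_function W S L" and L01: "\<And>s. s \<in> S \<Longrightarrow> L s = 0 \<or> L s = 1"
    and N: "\<And>w. w \<in> carrier W \<Longrightarrow> len w \<le> N" "N \<ge> 1"
  shows "bless z w \<Longrightarrow> L w - L z \<le> 2 * int N - 1"
    "M_triple W S s z w \<Longrightarrow> 2 * (L (s \<otimes> w) - L z) \<le> 2 * int N - 1"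
proof -
  have bounds: "0 \<le> L x" "L x \<le> int (len x)" if "x \<in> carrier W" for x
    using weight_function_bounds[OF L _ that] L01 by force+
  show "L w - L z \<le> 2 * int N - 1" if "bless z w"
    using bounds[of z] bounds[of w] N(1)[of w] N(2) bless_carrier[OF that] by simp
  show "2 * (L (s \<otimes> w) - L z) \<le> 2 * int N - 1" if "M_triple W S s z w"
  proof -
    have s: "s \<in> S" and z: "z \<in> carrier W" "len (s \<otimes> z) < len z"
      and w: "w \<in> carrier W" "len w < len (s \<otimes> w)"
      using that bless_carrier by (auto simp: M_triple_iff)
    have "L (s \<otimes> w) = L s + L w" using weight_function_S_mult[OF L s w] .
    moreover have "L z = L s + L (s \<otimes> z)"
      using weight_function_S_mult[OF L s, of "s \<otimes> z"] s z by simp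
    ultimately show ?thesis
      using L01[OF s] bounds[of w] bounds[of "s \<otimes> z"] bounds[of "s \<otimes> w"] N(1)[of "s \<otimes> w"] s z w by auto
  qed
qed

locale coxeter_partition = coxeter W S for W :: "'w monoid" (structure) and S +
  fixes Sx Sy :: "'w set"
  assumes S_eq: "S = Sx \<union> Sy" and disjoint: "Sx \<inter> Sy = {}"
    and not_conj: "\<forall>s\<in>Sx. \<forall>t\<in>Sy. \<not> conjugate_in W s t"
begin

abbreviation L\<^sub>a\<^sub>b :: "int \<Rightarrow> int \<Rightarrow> 'w \<Rightarrow> int" where "L\<^sub>a\<^sub>b \<equiv> weight_ab W Sx Sy"

definition sel :: "'g \<Rightarrow> 'g \<Rightarrow> 'w \<Rightarrow> 'g" where
  "sel x y s = (if s \<in> Sx then x else y)"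

lemma sel_conj: "s \<in> S \<Longrightarrow> t \<in> S \<Longrightarrow> conjugate_in W s t \<Longrightarrow> sel x y s = sel x y t"
  unfolding sel_def using S_eq not_conj conjugate_sym by (metis S_carrier Un_iff)

lemma weight_L: "weight_function W S (L\<^sub>a\<^sub>b a b)"
  using weight_ab(1)[OF S_eq disjoint not_conj] .

lemma L_eq: "s \<in> S \<Longrightarrow> L\<^sub>a\<^sub>b a b s = sel a b s"
  using weight_ab(2,3)[OF S_eq disjoint not_conj] S_eq by (auto simp: sel_def)

lemma Gamma_equivalentI:
  assumes "total_order_on_group G P" "x \<in> P" "y \<in> P" "a > 0" "b > 0" "a' > 0" "b' > 0"
    "specializes_to W S G P (sel x y) (L\<^sub>a\<^sub>b a b)" "specializes_to W S G P (sel x y) (L\<^sub>a\<^sub>b a' b')"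
  shows "Gamma_equivalent W S G P (sel x y) (L\<^sub>a\<^sub>b a b) (L\<^sub>a\<^sub>b a' b')"
  unfolding Gamma_equivalent_def parameters_def
proof (intro conjI ballI impI weight_L assms)
  show "sel x y s = sel x y t" if "s \<in> S" "t \<in> S" "conjugate_in W s t" for s t
    by (rule sel_conj[OF that])
qed (use assms in \<open>auto simp: L_eq sel_def\<close>)

text \<open>Weight functions with the same ratio are specializations of a common rank one group.\<close>

lemma equivalent_proportional:
  assumes pos: "a > 0" "b > 0" "c > 0" and ratio: "a * d = b * c"
  shows "equivalent_weights W S (L\<^sub>a\<^sub>b a b) (L\<^sub>a\<^sub>b c d)"
proof -
  define m where "m = gcd a b"
  have m: "m > 0" using pos by (simp add: m_def)
  have "gcd a b \<noteq> 0" using m by (simp add: m_def)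
  then obtain a0 b0 where ab: "a = a0 * m" "b = b0 * m" "coprime a0 b0"
    using gcd_coprime_exists unfolding m_def by blast
  have "a0 * m > 0" "b0 * m > 0" using pos unfolding ab(1,2)[symmetric] by auto
  hence a0: "a0 > 0" "b0 > 0" using m by (auto simp: zero_less_mult_iff)
  have "(a0 * m) * d = (b0 * m) * c" using ratio unfolding ab(1,2)[symmetric] .
  hence "m * (a0 * d) = m * (b0 * c)" by (simp add: mult_ac)
  hence eq: "a0 * d = b0 * c" using m by simp
  hence "a0 dvd c" using ab(3) by (metis coprime_dvd_mult_right_iff dvd_triv_left)
  then obtain k where c: "c = a0 * k" by blast
  hence d: "d = b0 * k" using eq a0 by simp
  have k: "k > 0" using c pos a0 by (simp add: zero_less_mult_iff)
  \<comment> \<open>A copy of the integers inside the prescribed type. A positive multiple of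
    coordinate 0 is positive on all of \<open>P\<close>, so the inclusion of
    \<open>Gamma_plus_W\<close> in \<open>P\<close> suffices.\<close>
  define H :: "universe set" where "H = {f. \<forall>n>0. f n = 0}"
  define P where "P = {f \<in> H. f 0 > 0}"
  define e :: "int \<Rightarrow> universe" where "e x = (\<lambda>n. if n = 0 then x else 0)" for x
  have order: "total_order_on_group (add_group H) P"
  proof (rule total_order_add_group)
    fix f assume f: "f \<in> H"
    show "f \<in> P \<or> f = 0 \<or> - f \<in> P"
    proof (cases "f 0 = 0")
      case True
      hence "f n = 0" for n using f by (cases n) (auto simp: H_def)
      thus ?thesis by (auto simp: fun_eq_iff)
    qed (use f in \<open>auto simp: P_def H_def\<close>)
  qed (auto simp: H_def P_def)
  have spec: "specializes_to W S (add_group H) P (sel (e a0) (e b0)) (L\<^sub>a\<^sub>b (a0 * n) (b0 * n))"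
    if "n > 0" for n
  proof (rule specializes_to_push[of "\<lambda>f. n * f 0"])
    show "n * \<gamma> 0 > 0" if "\<gamma> \<in> Gamma_plus_W W S (add_group H) P (sel (e a0) (e b0))" for \<gamma>
      using that Gamma_plus_W_subset \<open>n > 0\<close> by (fastforce simp: P_def)
  qed (auto simp: L_eq sel_def e_def algebra_simps)
  have "Gamma_equivalent W S (add_group H) P (sel (e a0) (e b0)) (L\<^sub>a\<^sub>b a b) (L\<^sub>a\<^sub>b c d)"
  proof (rule Gamma_equivalentI[OF order])
    show "e a0 \<in> P" "e b0 \<in> P" using a0 by (auto simp: P_def H_def e_def)
    show "specializes_to W S (add_group H) P (sel (e a0) (e b0)) (L\<^sub>a\<^sub>b a b)"
      using spec[OF m] unfolding ab(1,2)[symmetric] .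
    show "specializes_to W S (add_group H) P (sel (e a0) (e b0)) (L\<^sub>a\<^sub>b c d)"
      using spec[OF k] unfolding c d .
    show "d > 0" using d a0 k by simp
  qed (use pos in auto)
  thus ?thesis by (rule equivalent_weightsI)
qed

lemma equivalent_bounded:
  assumes pos: "a > 0" "b > 0" and "Sx \<noteq> {}"
    and N: "\<And>w. w \<in> carrier W \<Longrightarrow> len w \<le> N"
    and ratio: "(of_int b / of_int a :: rat) \<notin> ratio_set N"
  shows "\<exists>a' b'. 1 \<le> a' \<and> a' \<le> 4 * int N \<and> 1 \<le> b' \<and> b' \<le> 4 * int N \<and>
    equivalent_weights W S (L\<^sub>a\<^sub>b a b) (L\<^sub>a\<^sub>b a' b')"
proof -
  obtain s where "s \<in> S" using assms(3) S_eq by blast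
  hence N1: "N \<ge> 1" using N[of s] by simp
  define P where "P = weighted_pos a b"
  define e :: "nat \<Rightarrow> universe" where "e i = (\<lambda>n. if n = i then 1 else 0)" for i
  define v where "v = sel (e 0) (e 1)"
  have order: "total_order_on_group (add_group UNIV) P"
    using weighted_pos_add weighted_pos_total
    by (intro total_order_add_group) (auto simp: P_def weighted_pos_def)
  have eP: "e 0 \<in> P" "e 1 \<in> P" using pos by (auto simp: P_def weighted_pos_def e_def)
  interpret kl_data W S P v
  proof
    show "0 \<notin> P" by (simp add: P_def weighted_pos_def)
    show "x \<in> P \<or> x = 0 \<or> - x \<in> P" for x unfolding P_def by (rule weighted_pos_total)
    show "v s \<in> P" for s using eP by (simp add: v_def sel_def)
    show "v s = v t" if "s \<in> S" "t \<in> S" "conjugate_in W s t" for s t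
      unfolding v_def by (rule sel_conj[OF that])
  qed (auto simp: P_def weighted_pos_add)
  \<comment> \<open>Coordinate \<open>i\<close> of \<open>v s\<close> is 1 or 0 according to the
    part containing \<open>s\<close>, so it is paired with the weight function counting the letters
    of that part.\<close>
  have ind: "\<bar>\<gamma> i\<bar> \<le> 2 * int N - 1" if \<gamma>: "\<gamma> \<in> Gamma_plus_W W S (add_group UNIV) P v" and i: "i = 0 \<or> i = 1" for \<gamma> i
  proof (rule Gamma_plus_bounded[OF _ _ weight_L _ _ _ \<gamma>, of "\<lambda>f. f i" "of_bool (i = 0)" "of_bool (i = 1)"])
    note b = indicator_weight_bounds[OF weight_L _ N N1, of "of_bool (i = 0)" "of_bool (i = 1)"]
    show "L\<^sub>a\<^sub>b (of_bool (i = 0)) (of_bool (i = 1)) w - L\<^sub>a\<^sub>b (of_bool (i = 0)) (of_bool (i = 1)) z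
        \<le> 2 * int N - 1" if "bless z w" for z w
      by (rule b(1)[OF _ _ that]) (auto simp: L_eq sel_def)
    show "2 * (L\<^sub>a\<^sub>b (of_bool (i = 0)) (of_bool (i = 1)) (s \<otimes> w) - L\<^sub>a\<^sub>b (of_bool (i = 0)) (of_bool (i = 1)) z)
        \<le> 2 * int N - 1" if "M_triple W S s z w" for s z w
      by (rule b(2)[OF _ _ that]) (auto simp: L_eq sel_def)
  qed (use i in \<open>auto simp: L_eq v_def sel_def e_def\<close>)
  \<comment> \<open>These coordinates vanish on both parameters, so the zero weight function and
    \<open>D = 0\<close> satisfy the hypotheses of the degree bound.\<close>
  have zero: "\<gamma> i = 0" if \<gamma>: "\<gamma> \<in> Gamma_plus_W W S (add_group UNIV) P v" and i: "i \<ge> 2" for \<gamma> i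
  proof -
    have "\<bar>\<gamma> i\<bar> \<le> 0"
      by (rule Gamma_plus_bounded[OF _ _ weight_function_zero _ _ _ \<gamma>, of "\<lambda>f. f i"])
        (use i in \<open>auto simp: v_def sel_def e_def M_triple_iff dest!: bless_carrier\<close>)
    thus ?thesis by simp
  qed
  \<comment> \<open>Otherwise \<open>\<gamma>\<close> has weight 0 and is positive only by the
    tie-break. Then its first two coordinates are both nonzero, and their quotient is
    \<open>b/a\<close> up to sign, which puts \<open>b/a\<close> in
    \<open>ratio_set N\<close>.\<close>
  have gpos: "a * \<gamma> 0 + b * \<gamma> 1 > 0" if \<gamma>: "\<gamma> \<in> Gamma_plus_W W S (add_group UNIV) P v" for \<gamma>
  proof (rule ccontr)
    assume "\<not> a * \<gamma> 0 + b * \<gamma> 1 > 0"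
    moreover have "\<gamma> \<in> P" by (rule subsetD[OF Gamma_plus_W_subset \<gamma>])
    ultimately obtain n where n: "a * \<gamma> 0 + b * \<gamma> 1 = 0" "\<gamma> n > 0"
      by (auto simp: P_def weighted_pos_def)
    have "n < 2" using zero[OF \<gamma>, of n] n(2) by (cases "n < 2") auto
    hence "\<gamma> 0 \<noteq> 0 \<or> \<gamma> 1 \<noteq> 0" using n(2) by (cases "n = 0") (auto simp: less_2_cases_iff)
    hence nz: "\<gamma> 0 \<noteq> 0" "\<gamma> 1 \<noteq> 0" using n(1) pos by auto
    have "(of_int (a * \<gamma> 0 + b * \<gamma> 1) :: rat) = 0" using n(1) by simp
    hence "(of_int b / of_int a :: rat) = - (of_int (\<gamma> 0) / of_int (\<gamma> 1))"
      using nz pos by (simp add: field_simps add_eq_0_iff)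
    moreover have "(of_int b / of_int a :: rat) > 0" using pos by simp
    ultimately have "(of_int b / of_int a :: rat) \<in> ratio_set N"
      unfolding ratio_set_def using nz ind[OF \<gamma>, of 0] ind[OF \<gamma>, of 1]
      by (intro CollectI conjI exI[of _ "\<gamma> 0"] exI[of _ "\<gamma> 1"]) auto
    thus False using ratio by simp
  qed
  \<comment> \<open>With \<open>K = 2N\<close>, the box of the mediant lemma contains the first two
    coordinates of every element of \<open>Gamma_plus_W\<close>; this yields the bound
    \<open>4N\<close>.\<close>
  obtain a' b' where ab': "1 \<le> a'" "a' \<le> 2 * (2 * int N)" "1 \<le> b'" "b' \<le> 2 * (2 * int N)"
    "\<And>i j. \<bar>i\<bar> < 2 * int N \<Longrightarrow> \<bar>j\<bar> < 2 * int N \<Longrightarrow> a * i + b * j > 0 \<Longrightarrow> a' * i + b' * j > 0"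
    using ex_mediant[OF pos, of "2 * int N"] N1 by auto
  have spec: "specializes_to W S (add_group UNIV) P v (L\<^sub>a\<^sub>b x y)"
    if "\<And>\<gamma>. \<gamma> \<in> Gamma_plus_W W S (add_group UNIV) P v \<Longrightarrow> x * \<gamma> 0 + y * \<gamma> 1 > 0" for x y
    by (rule specializes_to_push[of "\<lambda>f. x * f 0 + y * f 1"])
      (use that in \<open>auto simp: L_eq sel_def v_def e_def algebra_simps\<close>)
  have "a' * \<gamma> 0 + b' * \<gamma> 1 > 0" if "\<gamma> \<in> Gamma_plus_W W S (add_group UNIV) P v" for \<gamma>
    using ab'(5)[OF _ _ gpos[OF that]] ind[OF that, of 0] ind[OF that, of 1] by simp
  hence "Gamma_equivalent W S (add_group UNIV) P v (L\<^sub>a\<^sub>b a b) (L\<^sub>a\<^sub>b a' b')"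
    using order eP pos ab' spec gpos unfolding v_def by (intro Gamma_equivalentI) auto
  from equivalent_weightsI[OF this] show ?thesis using ab' by auto
qed

end

theorem corollary3p6:
  fixes W :: "'w monoid" and S Sx Sy :: "'w set" and w0 :: 'w and a b :: int
  assumes "coxeter_system W S"
    and "finite (carrier W)"
    and "longest_element W S w0"
    and "S = Sx \<union> Sy" and "Sx \<inter> Sy = {}" and "Sx \<noteq> {}" and "Sy \<noteq> {}"
    and "\<forall>s\<in>Sx. \<forall>t\<in>Sy. \<not> conjugate_in W s t"
    and "a > 0" and "b > 0"
  shows "((of_int b / of_int a :: rat) \<in> ratio_set (cox_length W S w0) \<longrightarrow>
           (\<exists>c d :: int. 0 < c \<and> c < 2 * int (cox_length W S w0) \<and>
              0 < d \<and> d < 2 * int (cox_length W S w0) \<and>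
              (of_int b / of_int a :: rat) = of_int d / of_int c) \<and>
           (\<forall>c d :: int. 0 < c \<and> c < 2 * int (cox_length W S w0) \<and>
              0 < d \<and> d < 2 * int (cox_length W S w0) \<and>
              (of_int b / of_int a :: rat) = of_int d / of_int c \<longrightarrow>
              equivalent_weights W S (weight_ab W Sx Sy a b) (weight_ab W Sx Sy c d)))
       \<and> ((of_int b / of_int a :: rat) \<notin> ratio_set (cox_length W S w0) \<longrightarrow>
           (\<exists>a' b' :: int. 1 \<le> a' \<and> a' \<le> 8 * int (cox_length W S w0) ^ 3 \<and>
              1 \<le> b' \<and> b' \<le> 8 * int (cox_length W S w0) ^ 3 \<and>
              equivalent_weights W S (weight_ab W Sx Sy a b) (weight_ab W Sx Sy a' b')))"
proof -
  have "group W" using assms(1) by (simp add: coxeter_system_def)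
  then interpret coxeter_partition W S Sx Sy
    by (intro coxeter_partition.intro coxeter.intro coxeter_axioms.intro
        coxeter_partition_axioms.intro assms)
  define N where "N = cox_length W S w0"
  have N: "len w \<le> N" if "w \<in> carrier W" for w
    using assms(3) that by (auto simp: longest_element_def N_def)
  obtain s where "s \<in> S" using assms(4,6) by blast
  hence N1: "N \<ge> 1" using N[of s] by simp
  \<comment> \<open>The linear bound \<open>4N\<close> lies within the cubic one because
    \<open>N\<close> is at least 1.\<close>
  have "int N \<le> int N ^ 3" using N1 by (simp add: self_le_power)
  hence cube: "4 * int N \<le> 8 * int N ^ 3" using N1 by linarith
  have equiv: "equivalent_weights W S (weight_ab W Sx Sy a b) (weight_ab W Sx Sy c d)"
    if "0 < c" "0 < d" "(of_int b / of_int a :: rat) = of_int d / of_int c" for c d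
  proof (rule equivalent_proportional)
    have "(of_int (a * d) :: rat) = of_int (b * c)"
      using that assms(9) by (simp add: field_simps)
    thus "a * d = b * c" by (simp only: of_int_eq_iff)
  qed (use assms that in auto)
  have "\<exists>c d :: int. 0 < c \<and> c < 2 * int N \<and> 0 < d \<and> d < 2 * int N \<and>
      (of_int b / of_int a :: rat) = of_int d / of_int c"
    if "(of_int b / of_int a :: rat) \<in> ratio_set N"
    using ratio_setE[OF that] by metis
  moreover have "\<exists>a' b' :: int. 1 \<le> a' \<and> a' \<le> 8 * int N ^ 3 \<and> 1 \<le> b' \<and> b' \<le> 8 * int N ^ 3 \<and>
      equivalent_weights W S (weight_ab W Sx Sy a b) (weight_ab W Sx Sy a' b')"
    if "(of_int b / of_int a :: rat) \<notin> ratio_set N"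
    using equivalent_bounded[OF assms(9,10,6) N that] cube by (meson order_trans)
  ultimately show ?thesis unfolding N_def[symmetric] using equiv by blast
qed

end
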